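(* Let $\theta:\mathbb{R}_+\times\mathbb{R}\to\mathbb{R}$ be a compactly supported $C^1$ function. Then, for every $(t_0,x_0)\in\mathbb{R}_+\times\mathbb{R}$, all $u_L,u_R\in\mathcal{U}$, and any positive numbers $s,r$ satisfying $$\frac{s}{r}\,\sup|\lambda_i(t,x,u)|\le 1$$ (the supremum being taken over $1\le i\le p$, $(t,x)\in\mathbb{R}_+\times\mathbb{R}$ and $u\in\mathcal{U}$), the approximate generalized Riemann solution $W_G(t,x)=W_G(t,x;u_L,u_R;t_0,x_0)$ satisfies $$\begin{aligned}\Delta(s,r;\theta)=\;&\int_{x_0-r}^{x_0+r}W_G(t_0+s,x)\,\theta(t_0+s,x)\,dx-\int_{x_0-r}^{x_0+r}W_G(t_0,x)\,\theta(t_0,x)\,dx\\&+\int_{t_0}^{t_0+s}f\big(t,x_0+r,W_G(t,x_0+r)\big)\theta(t,x_0+r)\,dt\\&-\int_{t_0}^{t_0+s}f\big(t,x_0-r,W_G(t,x_0-r)\big)\theta(t,x_0-r)\,dt\\&+O(1)\,(s^2+r^2)\,(s+r+|u_R-u_L|)\,\|\theta\|_{C^1},\end{aligned}$$ where $$\Delta(s,r;\theta):=\int_{t_0}^{t_0+s}\int_{x_0-r}^{x_0+r}\Big(W_G\,\partial_t\theta+f(t,x,W_G)\,\partial_x\theta+g(t,x,W_G)\,\theta\Big)\,dx\,dt$$ and $\|\theta\|_{C^1}=\|\theta\|_{C^0}+\|\partial_t\theta\|_{C^0}+\|\partial_x\theta\|_{C^0}$.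
   Context: Setting. Fix $p\ge1$ and a small neighborhood $\mathcal{U}$ of the origin in $\mathbb{R}^p$. The maps $f,g:\mathbb{R}_+\times\mathbb{R}\times\mathcal{U}\to\mathbb{R}^p$, $(t,x,u)\mapsto f(t,x,u),\,g(t,x,u)$, are smooth. The matrix $A(t,x,u):=\frac{Df}{Du}(t,x,u)$ has $p$ real distinct eigenvalues $\lambda_1(t,x,u)<\dots<\lambda_p(t,x,u)$ with right eigenvectors $r_1,\dots,r_p$, and for each $i$ the $i$-th field is either genuinely nonlinear ($\nabla_u\lambda_i\cdot r_i\neq0$ everywhere) or linearly degenerate ($\nabla_u\lambda_i\cdot r_i\equiv0$). The system of balance laws is $\partial_tu+\partial_xf(t,x,u)=g(t,x,u)$. Set $q(t,x,u):=g(t,x,u)-\frac{\partial f}{\partial x}(t,x,u)$. Classical Riemann problem. $R_C(u_L,u_R;t_0,x_0)$ is the problem $\partial_tu+\partial_xf(t_0,x_0,u)=0$ for $t>t_0$, with data at $t=t_0$ equal to $u_L$ for $x<x_0$ and $u_R$ for $x>x_0$. Since $\mathcal{U}$ is small, it has the (Lax) self-similar entropy solution $W_C(\xi)=W_C(\xi;u_L,u_R;t_0,x_0)$, $\xi=\frac{x-x_0}{t-t_0}$, made of constant states $u_L=u_0,u_1,\dots,u_p=u_R$, where $u_{i-1}$ and $u_i$ are connected by an $i$-wave ($i$-rarefaction, admissible $i$-shock, or $i$-contact discontinuity). Approximate generalized Riemann solution. For $t>t_0$, $x\in\mathbb{R}$, $$W_G(t,x;u_L,u_R;t_0,x_0):=W_C(\xi)+(t-t_0)\,q\big(t_0,x_0,W_C(\xi)\big),\qquad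 \xi=\frac{x-x_0}{t-t_0},$$ and at $t=t_0$ it equals $u_L$ for $x<x_0$ and $u_R$ for $x>x_0$. The states involved are understood to lie in $\mathcal{U}$. $O(1)$ denotes a quantity, possibly depending on $u_L,u_R,t_0,x_0,s,r,\theta$, that is bounded in norm by a constant depending only on $\mathcal{U}$ and on $f,g$ (through bounds on these maps and their derivatives, and on the hyperbolicity, in the region under consideration). *)

theory Defs
  imports "HOL-Analysis.Analysis"
begin

section \<open>Regularity\<close>

text \<open>
  Derivatives are taken within the set \<open>S\<close>, which is always of the form \<open>{0..} \<times> UNIV\<close> or
  \<open>{0..} \<times> UNIV \<times> \<Omega>\<close> with \<open>\<Omega>\<close> open: they are one-sided in time at \<open>t = 0\<close>, ordinary
  otherwise, and unique.
\<close>

primrec Ck_on ::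
  "nat \<Rightarrow> 'a::real_normed_vector set \<Rightarrow> ('a \<Rightarrow> 'b::real_normed_vector) \<Rightarrow> bool" where
  "Ck_on 0 S F \<longleftrightarrow> continuous_on S F"
| "Ck_on (Suc k) S F \<longleftrightarrow>
     (\<exists>F'. (\<forall>z\<in>S. (F has_derivative F' z) (at z within S)) \<and> (\<forall>v. Ck_on k S (\<lambda>z. F' z v)))"

definition smooth_on ::
  "'a::real_normed_vector set \<Rightarrow> ('a \<Rightarrow> 'b::real_normed_vector) \<Rightarrow> bool" where
  "smooth_on S F \<longleftrightarrow> (\<forall>k. Ck_on k S F)"

text \<open>
  \<open>Ck_bounded k M S R F\<close>: the derivatives of \<open>F\<close> (within \<open>S\<close>) of order at most \<open>k\<close> have
  norm at most \<open>M\<close>, as multilinear maps, at all points of \<open>R \<subseteq> S\<close>.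
\<close>

primrec Ck_bounded ::
  "nat \<Rightarrow> real \<Rightarrow> 'a::real_normed_vector set \<Rightarrow> 'a set \<Rightarrow> ('a \<Rightarrow> 'b::real_normed_vector) \<Rightarrow> bool" where
  "Ck_bounded 0 M S R F \<longleftrightarrow> (\<forall>z\<in>R. norm (F z) \<le> M)"
| "Ck_bounded (Suc k) M S R F \<longleftrightarrow>
     (\<forall>z\<in>R. norm (F z) \<le> M) \<and>
     (\<exists>F'. (\<forall>z\<in>S. (F has_derivative F' z) (at z within S)) \<and>
           (\<forall>v. norm v \<le> 1 \<longrightarrow> Ck_bounded k M S R (\<lambda>z. F' z v)))"

section \<open>The system of balance laws\<close>

text \<open>
  The unknown takes values in \<open>real ^ 'n\<close>, so \<open>p = CARD('n)\<close>. Characteristic fields are numbered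
  by \<open>i \<in> {1..CARD('n)}\<close>; \<open>lam i\<close> and \<open>rv i\<close> are the \<open>i\<close>-th eigenvalue and right eigenvector.
\<close>

type_synonym 'n flux = "real \<Rightarrow> real \<Rightarrow> real ^ 'n \<Rightarrow> real ^ 'n"
type_synonym 'n eigval = "nat \<Rightarrow> real \<Rightarrow> real \<Rightarrow> real ^ 'n \<Rightarrow> real"
type_synonym 'n eigvec = "nat \<Rightarrow> real \<Rightarrow> real \<Rightarrow> real ^ 'n \<Rightarrow> real ^ 'n"

abbreviation uncurry3 :: "('a \<Rightarrow> 'b \<Rightarrow> 'c \<Rightarrow> 'd) \<Rightarrow> 'a \<times> 'b \<times> 'c \<Rightarrow> 'd" where
  "uncurry3 F \<equiv> (\<lambda>(t, x, u). F t x u)"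

definition flux_matrix :: "'n::finite flux \<Rightarrow> real \<Rightarrow> real \<Rightarrow> real ^ 'n \<Rightarrow> real ^ 'n ^ 'n" where
  "flux_matrix f t x u = jacobian (f t x) (at u)"

definition strictly_hyperbolic ::
  "(real ^ 'n::finite) set \<Rightarrow> 'n flux \<Rightarrow> 'n eigval \<Rightarrow> 'n eigvec \<Rightarrow> bool" where
  "strictly_hyperbolic \<Omega> f lam rv \<longleftrightarrow>
     (\<forall>t\<ge>0. \<forall>x. \<forall>u\<in>\<Omega>.
        (\<forall>i\<in>{1..CARD('n)}. rv i t x u \<noteq> 0 \<and>
            flux_matrix f t x u *v rv i t x u = lam i t x u *\<^sub>R rv i t x u) \<and>
        (\<forall>i\<in>{1..<CARD('n)}. lam i t x u < lam (Suc i) t x u))"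

text \<open>\<open>\<nabla>\<^sub>u lam\<^sub>i \<cdot> rv\<^sub>i\<close>; the eigenvalues are simple, hence differentiable in \<open>u\<close>.\<close>

definition lam_slope ::
  "'n::finite eigval \<Rightarrow> 'n eigvec \<Rightarrow> nat \<Rightarrow> real \<Rightarrow> real \<Rightarrow> real ^ 'n \<Rightarrow> real" where
  "lam_slope lam rv i t x u = frechet_derivative (lam i t x) (at u) (rv i t x u)"

definition genuinely_nonlinear ::
  "(real ^ 'n::finite) set \<Rightarrow> 'n eigval \<Rightarrow> 'n eigvec \<Rightarrow> nat \<Rightarrow> bool" where
  "genuinely_nonlinear \<Omega> lam rv i \<longleftrightarrow> (\<forall>t\<ge>0. \<forall>x. \<forall>u\<in>\<Omega>. lam_slope lam rv i t x u \<noteq> 0)"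

definition linearly_degenerate ::
  "(real ^ 'n::finite) set \<Rightarrow> 'n eigval \<Rightarrow> 'n eigvec \<Rightarrow> nat \<Rightarrow> bool" where
  "linearly_degenerate \<Omega> lam rv i \<longleftrightarrow> (\<forall>t\<ge>0. \<forall>x. \<forall>u\<in>\<Omega>. lam_slope lam rv i t x u = 0)"

definition balance_law ::
  "(real ^ 'n::finite) set \<Rightarrow> 'n flux \<Rightarrow> 'n flux \<Rightarrow> 'n eigval \<Rightarrow> 'n eigvec \<Rightarrow> bool" where
  "balance_law \<Omega> f g lam rv \<longleftrightarrow>
     smooth_on ({0..} \<times> UNIV \<times> \<Omega>) (uncurry3 f) \<and>
     smooth_on ({0..} \<times> UNIV \<times> \<Omega>) (uncurry3 g) \<and>
     strictly_hyperbolic \<Omega> f lam rv \<and>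
     (\<forall>i\<in>{1..CARD('n)}. genuinely_nonlinear \<Omega> lam rv i \<or> linearly_degenerate \<Omega> lam rv i)"

text \<open>
  The bounds through which the constant \<open>O(1)\<close> depends on \<open>f\<close> and \<open>g\<close>: \<open>M\<close> bounds the maps and
  their derivatives, \<open>c\<close> is a lower bound for the gaps between consecutive eigenvalues, both on
  \<open>Q \<times> \<Omega>\<close>, where \<open>Q\<close> is a region of the half plane.
\<close>

definition bounds_on ::
  "real \<Rightarrow> real \<Rightarrow> (real \<times> real) set \<Rightarrow> (real ^ 'n::finite) set \<Rightarrow>
   'n flux \<Rightarrow> 'n flux \<Rightarrow> 'n eigval \<Rightarrow> bool" where
  "bounds_on M c Q \<Omega> f g lam \<longleftrightarrow>
     Ck_bounded 2 M ({0..} \<times> UNIV \<times> \<Omega>) {(t, x, u). (t, x) \<in> Q \<and> u \<in> \<Omega>} (uncurry3 f) \<and>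
     Ck_bounded 2 M ({0..} \<times> UNIV \<times> \<Omega>) {(t, x, u). (t, x) \<in> Q \<and> u \<in> \<Omega>} (uncurry3 g) \<and>
     (\<forall>(t, x)\<in>Q. \<forall>u\<in>\<Omega>. \<forall>i\<in>{1..<CARD('n)}. c \<le> lam (Suc i) t x u - lam i t x u)"

definition reduced_source ::
  "'n::finite flux \<Rightarrow> 'n flux \<Rightarrow> real \<Rightarrow> real \<Rightarrow> real ^ 'n \<Rightarrow> real ^ 'n" where
  "reduced_source f g t x u = g t x u - vector_derivative (\<lambda>y. f t y u) (at x)"

section \<open>The classical Riemann problem\<close>

text \<open>
  The following predicates concern the system with frozen coefficients
  \<open>\<partial>\<^sub>t u + \<partial>\<^sub>x f(t\<^sub>0, x\<^sub>0, u) = 0\<close> and a self-similar profile \<open>W\<close>, a function of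
  \<open>\<xi> = (x - x\<^sub>0) / (t - t\<^sub>0)\<close>.  The wave connecting \<open>um\<close> (left) to \<open>up\<close> (right)
  occupies the interval \<open>{a..b}\<close> of values of \<open>\<xi>\<close>, with \<open>a = b\<close> for discontinuities.
\<close>

definition rankine_hugoniot ::
  "'n::finite flux \<Rightarrow> real \<Rightarrow> real \<Rightarrow> real ^ 'n \<Rightarrow> real ^ 'n \<Rightarrow> real \<Rightarrow> bool" where
  "rankine_hugoniot f t0 x0 um up \<sigma> \<longleftrightarrow> f t0 x0 up - f t0 x0 um = \<sigma> *\<^sub>R (up - um)"

definition rarefaction_wave where
  "rarefaction_wave lam rv i t0 x0 (W :: real \<Rightarrow> real ^ 'n::finite) um up a b \<longleftrightarrow>
     a < b \<and> W a = um \<and> W b = up \<and>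
     (\<forall>\<xi>\<in>{a..b}. lam i t0 x0 (W \<xi>) = \<xi> \<and>
        (W has_vector_derivative
           (1 / lam_slope lam rv i t0 x0 (W \<xi>)) *\<^sub>R rv i t0 x0 (W \<xi>)) (at \<xi> within {a..b}))"

text \<open>Admissibility of shocks is expressed by Lax's shock inequalities.\<close>

definition shock_wave where
  "shock_wave f lam i t0 x0 (um :: real ^ 'n::finite) up \<sigma> \<longleftrightarrow>
     rankine_hugoniot f t0 x0 um up \<sigma> \<and> lam i t0 x0 up < \<sigma> \<and> \<sigma> < lam i t0 x0 um"

definition contact_wave where
  "contact_wave f lam i t0 x0 (um :: real ^ 'n::finite) up \<sigma> \<longleftrightarrow>
     rankine_hugoniot f t0 x0 um up \<sigma> \<and> lam i t0 x0 um = \<sigma> \<and> lam i t0 x0 up = \<sigma>"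

text \<open>The first alternative below is the wave of zero strength.\<close>

definition elementary_wave ::
  "(real ^ 'n::finite) set \<Rightarrow> 'n flux \<Rightarrow> 'n eigval \<Rightarrow> 'n eigvec \<Rightarrow> nat \<Rightarrow> real \<Rightarrow> real \<Rightarrow>
   (real \<Rightarrow> real ^ 'n) \<Rightarrow> real ^ 'n \<Rightarrow> real ^ 'n \<Rightarrow> real \<Rightarrow> real \<Rightarrow> bool" where
  "elementary_wave \<Omega> f lam rv i t0 x0 W um up a b \<longleftrightarrow>
     (up = um \<and> a = lam i t0 x0 um \<and> b = a) \<or>
     (genuinely_nonlinear \<Omega> lam rv i \<and>
        (rarefaction_wave lam rv i t0 x0 W um up a b \<or>
         (shock_wave f lam i t0 x0 um up a \<and> b = a))) \<or>
     (linearly_degenerate \<Omega> lam rv i \<and> contact_wave f lam i t0 x0 um up a \<and> b = a)"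

text \<open>
  The value of \<open>W\<close> exactly at the speed of a discontinuity is left unspecified.
\<close>

definition lax_solution ::
  "(real ^ 'n::finite) set \<Rightarrow> 'n flux \<Rightarrow> 'n eigval \<Rightarrow> 'n eigvec \<Rightarrow>
   real ^ 'n \<Rightarrow> real ^ 'n \<Rightarrow> real \<Rightarrow> real \<Rightarrow> (real \<Rightarrow> real ^ 'n) \<Rightarrow> bool" where
  "lax_solution \<Omega> f lam rv uL uR t0 x0 W \<longleftrightarrow>
     (\<exists>v a b.
        v 0 = uL \<and> v CARD('n) = uR \<and>
        (\<forall>i\<in>{1..CARD('n)}. elementary_wave \<Omega> f lam rv i t0 x0 W (v (i - 1)) (v i) (a i) (b i)) \<and>
        (\<forall>i\<in>{1..<CARD('n)}. b i < a (Suc i)) \<and>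
        (\<forall>\<xi>. \<xi> < a 1 \<longrightarrow> W \<xi> = uL) \<and>
        (\<forall>i\<in>{1..<CARD('n)}. \<forall>\<xi>\<in>{b i<..<a (Suc i)}. W \<xi> = v i) \<and>
        (\<forall>\<xi>. b CARD('n) < \<xi> \<longrightarrow> W \<xi> = uR))"

section \<open>The approximate generalized Riemann solution\<close>

definition approx_sol ::
  "'n::finite flux \<Rightarrow> 'n flux \<Rightarrow> real ^ 'n \<Rightarrow> real ^ 'n \<Rightarrow> real \<Rightarrow> real \<Rightarrow> (real \<Rightarrow> real ^ 'n) \<Rightarrow>
   real \<Rightarrow> real \<Rightarrow> real ^ 'n" where
  "approx_sol f g uL uR t0 x0 W t x =
     (if t0 < t then
        (let \<xi> = (x - x0) / (t - t0) in W \<xi> + (t - t0) *\<^sub>R reduced_source f g t0 x0 (W \<xi>))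
      else if x < x0 then uL else uR)"

section \<open>Test functions and the weak form\<close>

definition dt :: "(real \<Rightarrow> real \<Rightarrow> real) \<Rightarrow> real \<Rightarrow> real \<Rightarrow> real" where
  "dt \<theta> t x = vector_derivative (\<lambda>\<tau>. \<theta> \<tau> x) (at t within {0..})"

definition dx :: "(real \<Rightarrow> real \<Rightarrow> real) \<Rightarrow> real \<Rightarrow> real \<Rightarrow> real" where
  "dx \<theta> t x = vector_derivative (\<lambda>y. \<theta> t y) (at x)"

definition test_function :: "(real \<Rightarrow> real \<Rightarrow> real) \<Rightarrow> bool" where
  "test_function \<theta> \<longleftrightarrow>
     Ck_on 1 ({0..} \<times> UNIV) (\<lambda>(t, x). \<theta> t x) \<and>
     (\<exists>K. compact K \<and> (\<forall>t\<ge>0. \<forall>x. (t, x) \<notin> K \<longrightarrow> \<theta> t x = 0))"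

definition C0_norm :: "(real \<Rightarrow> real \<Rightarrow> real) \<Rightarrow> real" where
  "C0_norm \<theta> = (SUP (t, x)\<in>{0..} \<times> UNIV. \<bar>\<theta> t x\<bar>)"

definition C1_norm :: "(real \<Rightarrow> real \<Rightarrow> real) \<Rightarrow> real" where
  "C1_norm \<theta> = C0_norm \<theta> + C0_norm (dt \<theta>) + C0_norm (dx \<theta>)"

definition Delta ::
  "'n::finite flux \<Rightarrow> 'n flux \<Rightarrow> (real \<Rightarrow> real \<Rightarrow> real ^ 'n) \<Rightarrow> real \<Rightarrow> real \<Rightarrow>
   real \<Rightarrow> real \<Rightarrow> (real \<Rightarrow> real \<Rightarrow> real) \<Rightarrow> real ^ 'n" where
  "Delta f g WG t0 x0 s r \<theta> =
     integral {t0..t0 + s} (\<lambda>t. integral {x0 - r..x0 + r} (\<lambda>x.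
       dt \<theta> t x *\<^sub>R WG t x + dx \<theta> t x *\<^sub>R f t x (WG t x) + \<theta> t x *\<^sub>R g t x (WG t x)))"

definition boundary_terms ::
  "'n::finite flux \<Rightarrow> (real \<Rightarrow> real \<Rightarrow> real ^ 'n) \<Rightarrow> real \<Rightarrow> real \<Rightarrow>
   real \<Rightarrow> real \<Rightarrow> (real \<Rightarrow> real \<Rightarrow> real) \<Rightarrow> real ^ 'n" where
  "boundary_terms f WG t0 x0 s r \<theta> =
     integral {x0 - r..x0 + r} (\<lambda>x. \<theta> (t0 + s) x *\<^sub>R WG (t0 + s) x)
     - integral {x0 - r..x0 + r} (\<lambda>x. \<theta> t0 x *\<^sub>R WG t0 x)
     + integral {t0..t0 + s} (\<lambda>t. \<theta> t (x0 + r) *\<^sub>R f t (x0 + r) (WG t (x0 + r)))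
     - integral {t0..t0 + s} (\<lambda>t. \<theta> t (x0 - r) *\<^sub>R f t (x0 - r) (WG t (x0 - r)))"

text \<open>The supremum is extended-real-valued: the wave speeds need not be bounded a priori.\<close>

definition sup_speed :: "(real ^ 'n::finite) set \<Rightarrow> 'n eigval \<Rightarrow> ereal" where
  "sup_speed U lam =
     (SUP (i, t, x, u)\<in>{1..CARD('n)} \<times> {0..} \<times> UNIV \<times> U. ereal \<bar>lam i t x u\<bar>)"

end

theory Submission
  imports Defs
begin

text \<open>
  Write \<open>WG = H(t, W(\<xi>))\<close> with \<open>H(t, u) = u + (t - t\<^sub>0) q(u)\<close>. For a frozen state \<open>u\<close> the
  field \<open>(H(t, u), f(t, x, H(t, u)))\<close> has divergence \<open>q(u) + f\<^sub>x\<close>, which equals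
  \<open>g(t, x, H(t, u))\<close> up to \<open>O(s + r)\<close>. So if \<open>W\<close> is replaced by a step function with values
  \<open>u\<^sub>k\<close> and jumps along rays of slope \<open>\<sigma>\<^sub>k\<close>, the divergence theorem in the sectors between the rays
  leaves only the contributions of the jumps of \<open>f(t, x, H) - \<sigma>\<^sub>k H\<close>. These are
  \<open>O(s) |u\<^sub>k - u\<^sub>k\<^sub>-\<^sub>1|\<close> plus the Rankine-Hugoniot defect of the step, which vanishes for shocks and
  contacts and, summed over a fine discretization, becomes arbitrarily small for rarefactions. Letting the
  step functions converge to \<open>W\<close> uniformly, the error is \<open>O(s\<^sup>2)\<close> times the total variation of \<open>W\<close>.

  The total variation is \<open>O(|u\<^sub>R - u\<^sub>L|)\<close>: in a small ball the increments of an \<open>i\<close>-wave lie in a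
  narrow cone around the \<open>i\<close>-th eigenvector of the flux matrix at the origin, on which the \<open>i\<close>-th
  coordinate in the eigenbasis is monotone. The coordinates are bounded in terms of \<open>M\<close>, \<open>c\<close> and
  the dimension only, so the matrix relating the wave strengths to \<open>u\<^sub>R - u\<^sub>L\<close> is uniformly
  diagonally dominant.
\<close>

section \<open>Step functions along rays\<close>

text \<open>The constant has to be the same for all \<open>f\<close> and \<open>g\<close> that share
  \<open>M\<close> and \<open>c\<close>, so a compactness argument or a qualitative inverse function
  theorem for the wave curves would not do. Everything spectral is therefore made quantitative at
  the single state 0, and the size of the ball enters through one explicit inequality,
  \<open>small\<close> in \<open>frozen_system\<close>. The profile \<open>W\<close> is free at the
  speeds of its jumps, and nothing is assumed about the continuity of the derivative of a
  rarefaction; integrability is not presupposed but inherited from step functions that are uniformly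
  close off finitely many points of each time slice. The condition on \<open>s\<close> and
  \<open>r\<close> keeps all rays inside the cell, so that its sides see only the two outer states,
  except possibly at the final time. In the remainder, the factor \<open>s + r\<close> belongs to
  the source, whose residual is integrated over a cell of area \<open>2 * r * s\<close>; the jumps
  give \<open>s\<^sup>2 * (1 + s)\<close> times the size of the data, and there the growth in
  \<open>s\<close> is absorbed because the size of the data is at most the diameter of the
  ball.\<close>

lemma continuous_on_uncurried_compose:
  assumes "continuous_on (A \<times> B) (\<lambda>(t, x). F t x)" "continuous_on S a" "continuous_on S b"
    and "\<And>s. s \<in> S \<Longrightarrow> a s \<in> A" "\<And>s. s \<in> S \<Longrightarrow> b s \<in> B"
  shows "continuous_on S (\<lambda>s. F (a s) (b s))"
  using continuous_on_compose2[OF assms(1) continuous_on_Pair[OF assms(2,3)]] assms(4,5)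
  by fastforce

text \<open>The Leibniz rule in \<open>t\<close> and the fundamental theorem of calculus in the
  endpoint give the two partial derivatives of \<open>integral {lo..b} (h t)\<close>; these combine
  to a total derivative, and the chain rule along the line finishes.\<close>

lemma integral_moving_endpoint_has_derivative:
  fixes h ht :: "real \<Rightarrow> real \<Rightarrow> 'b::banach"
  assumes hc: "continuous_on ({t0..t1} \<times> {lo..hi}) (\<lambda>(t, x). h t x)"
    and htc: "continuous_on ({t0..t1} \<times> {lo..hi}) (\<lambda>(t, x). ht t x)"
    and hd: "\<And>t x. t \<in> {t0..t1} \<Longrightarrow> x \<in> {lo..hi} \<Longrightarrow>
      ((\<lambda>t. h t x) has_vector_derivative ht t x) (at t within {t0..t1})"
    and \<beta>: "\<And>t. t \<in> {t0..t1} \<Longrightarrow> \<alpha> + \<sigma> * t \<in> {lo..hi}"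
    and t: "t \<in> {t0..t1}"
  shows "((\<lambda>t. integral {lo..\<alpha> + \<sigma> * t} (h t)) has_vector_derivative
    integral {lo..\<alpha> + \<sigma> * t} (ht t) + \<sigma> *\<^sub>R h t (\<alpha> + \<sigma> * t)) (at t within {t0..t1})"
proof -
  let ?X = "{t0..t1}" and ?Y = "{lo..hi}"
  let ?G = "\<lambda>t b. integral {lo..b} (h t)"
  have hcx: "continuous_on ?Y (h t)" if "t \<in> ?X" for t
    by (rule continuous_on_uncurried_compose[OF hc]) (use that in \<open>auto intro!: continuous_intros\<close>)
  let ?b = "\<alpha> + \<sigma> * t"
  have b: "?b \<in> ?Y" using \<beta> t by blast
  have sub: "{lo..?b} \<subseteq> ?Y" using b by auto
  have fx: "((\<lambda>t. ?G t ?b) has_derivative (\<lambda>d. d *\<^sub>R integral {lo..?b} (ht t))) (at t within ?X)"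
  proof -
    have "((\<lambda>t. integral (cbox lo ?b) (h t)) has_vector_derivative integral (cbox lo ?b) (ht t))
        (at t within ?X)"
    proof (rule leibniz_rule_vector_derivative)
      show "((\<lambda>t. h t x) has_vector_derivative ht t x) (at t within ?X)"
        if "t \<in> ?X" "x \<in> cbox lo ?b" for t x
        using hd that sub by auto
      show "h t integrable_on cbox lo ?b" if "t \<in> ?X" for t
        using continuous_on_subset[OF hcx[OF that] sub] by (auto intro: integrable_continuous_real)
      show "continuous_on (?X \<times> cbox lo ?b) (\<lambda>(t, x). ht t x)"
        by (rule continuous_on_subset[OF htc]) (metis Sigma_mono box_real(2) order_refl sub)
    qed (use t in auto)
    then show ?thesis by (simp add: has_vector_derivative_def)
  qed
  have fy: "((\<lambda>b. ?G t b) has_derivative blinfun_apply (blinfun_scaleR_left (h t b))) (at b within ?Y)"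
    if "t \<in> ?X" "b \<in> ?Y" for t b
  proof -
    have "((\<lambda>b. ?G t b) has_vector_derivative h t b) (at b within ?Y)"
      using integral_has_vector_derivative[OF hcx[OF that(1)] that(2)] .
    moreover have "blinfun_apply (blinfun_scaleR_left (h t b)) = (\<lambda>d. d *\<^sub>R h t b)"
      by (simp add: fun_eq_iff)
    ultimately show ?thesis by (simp add: has_vector_derivative_def)
  qed
  \<comment> \<open>Total differentiability needs one partial derivative to be jointly continuous as
    a map into bounded linear maps; for the endpoint this is the continuity of
    \<open>h\<close>.\<close>
  have cont: "continuous (at (t, ?b) within ?X \<times> ?Y) (\<lambda>(t, b). blinfun_scaleR_left (h t b))"
  proof -
    have "continuous_on (?X \<times> ?Y) (\<lambda>p. blinfun_scaleR_left ((\<lambda>(t, x). h t x) p))"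
      by (intro bounded_linear.continuous_on[OF bounded_linear_blinfun_scaleR_left] hc)
    then show ?thesis
      using t b by (simp add: continuous_on_eq_continuous_within case_prod_unfold)
  qed
  have G: "((\<lambda>(t, b). ?G t b) has_derivative
      (\<lambda>(dt, db). dt *\<^sub>R integral {lo..?b} (ht t) + blinfun_scaleR_left (h t ?b) db))
      (at (t, ?b) within ?X \<times> ?Y)"
    by (rule has_derivative_partialsI[OF fx fy cont b]) auto
  have g: "((\<lambda>t. (t, \<alpha> + \<sigma> * t)) has_derivative (\<lambda>d. (d, \<sigma> * d))) (at t within ?X)"
    by (auto intro!: derivative_eq_intros)
  have "(\<lambda>t. (t, \<alpha> + \<sigma> * t)) ` ?X \<subseteq> ?X \<times> ?Y"
    using \<beta> by blast
  from has_derivative_in_compose[OF g has_derivative_subset[OF G this]]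
  show ?thesis
    by (simp add: has_vector_derivative_def scaleR_add_right mult.commute)
qed

text \<open>The divergence theorem between the side \<open>lo\<close> and a ray. Differentiating the
  integral of \<open>h\<close> up to the ray produces \<open>\<sigma> *\<^sub>R h\<close> there,
  which is what turns the flux \<open>\<phi>\<close> through the ray into
  \<open>\<phi> - \<sigma> h\<close>.\<close>

lemma sector_integral:
  fixes h ht \<phi> \<phi>x :: "real \<Rightarrow> real \<Rightarrow> 'b::banach"
  assumes hc: "continuous_on ({t0..t1} \<times> {lo..hi}) (\<lambda>(t, x). h t x)"
    and htc: "continuous_on ({t0..t1} \<times> {lo..hi}) (\<lambda>(t, x). ht t x)"
    and \<phi>c: "continuous_on ({t0..t1} \<times> {lo..hi}) (\<lambda>(t, x). \<phi> t x)"
    and \<phi>xc: "continuous_on ({t0..t1} \<times> {lo..hi}) (\<lambda>(t, x). \<phi>x t x)"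
    and hd: "\<And>t x. t \<in> {t0..t1} \<Longrightarrow> x \<in> {lo..hi} \<Longrightarrow>
      ((\<lambda>t. h t x) has_vector_derivative ht t x) (at t within {t0..t1})"
    and \<phi>d: "\<And>t x. t \<in> {t0..t1} \<Longrightarrow> x \<in> {lo..hi} \<Longrightarrow>
      ((\<lambda>x. \<phi> t x) has_vector_derivative \<phi>x t x) (at x within {lo..hi})"
    and \<beta>: "\<And>t. t \<in> {t0..t1} \<Longrightarrow> \<alpha> + \<sigma> * t \<in> {lo..hi}"
    and t: "t0 \<le> t1"
  shows "((\<lambda>t. integral {lo..\<alpha> + \<sigma> * t} (\<lambda>x. ht t x + \<phi>x t x)) has_integral
      integral {lo..\<alpha> + \<sigma> * t1} (h t1) - integral {lo..\<alpha> + \<sigma> * t0} (h t0)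
      + integral {t0..t1} (\<lambda>t. \<phi> t (\<alpha> + \<sigma> * t) - \<sigma> *\<^sub>R h t (\<alpha> + \<sigma> * t))
      - integral {t0..t1} (\<lambda>t. \<phi> t lo)) {t0..t1}"
proof -
  let ?b = "\<lambda>t. \<alpha> + \<sigma> * t" and ?R = "{t0..t1} \<times> {lo..hi}"
  have lohi: "lo \<le> hi" using \<beta>[of t0] t by auto
  have line: "continuous_on {t0..t1} (\<lambda>t. F t (?b t))" "continuous_on {t0..t1} (\<lambda>t. F t lo)"
    if "continuous_on ?R (\<lambda>(t, x). F t x)" for F :: "real \<Rightarrow> real \<Rightarrow> 'b"
    by (rule continuous_on_uncurried_compose[OF that];
        use \<beta> lohi in \<open>auto intro!: continuous_intros\<close>)+
  have slice: "F t integrable_on {lo..?b t}"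
    if "continuous_on ?R (\<lambda>(t, x). F t x)" "t \<in> {t0..t1}" for F :: "real \<Rightarrow> real \<Rightarrow> 'b" and t
    by (intro integrable_continuous_real continuous_on_uncurried_compose[OF that(1)])
      (use \<beta>[OF that(2)] that(2) in \<open>auto intro!: continuous_intros\<close>)
  have "((\<lambda>t. integral {lo..?b t} (ht t) + \<sigma> *\<^sub>R h t (?b t)) has_integral
      integral {lo..?b t1} (h t1) - integral {lo..?b t0} (h t0)) {t0..t1}"
    by (rule fundamental_theorem_of_calculus[OF t])
      (rule integral_moving_endpoint_has_derivative[OF hc htc hd \<beta>])
  moreover have "((\<lambda>t. \<phi> t (?b t) - \<sigma> *\<^sub>R h t (?b t)) has_integral
      integral {t0..t1} (\<lambda>t. \<phi> t (?b t) - \<sigma> *\<^sub>R h t (?b t))) {t0..t1}"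
    by (intro integrable_integral integrable_continuous_real continuous_intros line hc \<phi>c)
  moreover have "((\<lambda>t. \<phi> t lo) has_integral integral {t0..t1} (\<lambda>t. \<phi> t lo)) {t0..t1}"
    by (intro integrable_integral integrable_continuous_real line \<phi>c)
  ultimately have "((\<lambda>t. integral {lo..?b t} (ht t) + \<sigma> *\<^sub>R h t (?b t)
        + (\<phi> t (?b t) - \<sigma> *\<^sub>R h t (?b t)) - \<phi> t lo) has_integral
      integral {lo..?b t1} (h t1) - integral {lo..?b t0} (h t0)
      + integral {t0..t1} (\<lambda>t. \<phi> t (?b t) - \<sigma> *\<^sub>R h t (?b t))
      - integral {t0..t1} (\<lambda>t. \<phi> t lo)) {t0..t1}"
    by (intro has_integral_add has_integral_diff)
  moreover have "integral {lo..?b t} (\<lambda>x. ht t x + \<phi>x t x)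
      = integral {lo..?b t} (ht t) + \<sigma> *\<^sub>R h t (?b t) + (\<phi> t (?b t) - \<sigma> *\<^sub>R h t (?b t)) - \<phi> t lo"
    if t: "t \<in> {t0..t1}" for t
  proof -
    have "(\<phi>x t has_integral \<phi> t (?b t) - \<phi> t lo) {lo..?b t}"
      using \<beta>[OF t] by (intro fundamental_theorem_of_calculus)
        (auto intro!: has_vector_derivative_within_subset[OF \<phi>d[OF t]])
    then show ?thesis
      using slice[OF htc t] slice[OF \<phi>xc t]
      by (subst integral_add) (auto simp: integral_unique)
  qed
  ultimately show ?thesis by (subst has_integral_cong) auto
qed

text \<open>Rescaling to the fixed interval \<open>{0..1}\<close> moves the dependence on
  \<open>t\<close> into the integrand, where continuity in a parameter applies.\<close>

lemma continuous_on_integral_moving_endpoint: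
  fixes F :: "real \<Rightarrow> real \<Rightarrow> 'b::euclidean_space"
  assumes F: "continuous_on (T \<times> {lo..hi}) (\<lambda>(t, x). F t x)"
    and b: "continuous_on T b" "\<And>t. t \<in> T \<Longrightarrow> b t \<in> {lo..hi}"
  shows "continuous_on T (\<lambda>t. integral {lo..b t} (F t))"
proof -
  have "integral {lo..b t} (F t) = integral {0..1} (\<lambda>y. (b t - lo) *\<^sub>R F t (lo + y * (b t - lo)))"
    if t: "t \<in> T" for t
  proof -
    have "((\<lambda>y. (b t - lo) *\<^sub>R F t (lo + y * (b t - lo))) has_integral
        integral {lo + 0 * (b t - lo)..lo + 1 * (b t - lo)} (F t)) {0..1}"
    proof (rule has_integral_substitution[where c = lo and d = "b t"])
      show "continuous_on {lo..b t} (F t)"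
        by (rule continuous_on_uncurried_compose[OF F])
          (use b(2)[OF t] t in \<open>auto intro!: continuous_intros\<close>)
      show "(\<lambda>y. lo + y * (b t - lo)) ` {0..1} \<subseteq> {lo..b t}"
      proof clarify
        fix y :: real assume "y \<in> {0..1}"
        with b(2)[OF t] mult_left_le_one_le[of "b t - lo" y]
        show "lo + y * (b t - lo) \<in> {lo..b t}" by auto
      qed
    qed (use b(2)[OF t] in \<open>auto intro!: derivative_eq_intros\<close>)
    from integral_unique[OF this] show ?thesis by simp
  qed
  moreover have "continuous_on T
      (\<lambda>t. integral (cbox 0 1) (\<lambda>y. (b t - lo) *\<^sub>R F t (lo + y * (b t - lo))))"
  proof (rule integral_continuous_on_param)
    have "lo + y * (b t - lo) \<in> {lo..hi}" if "t \<in> T" "y \<in> {0..1}" for t y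
      using that b(2)[OF that(1)] mult_left_le_one_le[of "b t - lo" y] by auto
    then have "continuous_on (T \<times> {0..1})
        (\<lambda>p. (b (fst p) - lo) *\<^sub>R F (fst p) (lo + snd p * (b (fst p) - lo)))"
      by (intro continuous_intros continuous_on_uncurried_compose[OF F]
          continuous_on_compose2[OF b(1)]) auto
    then show "continuous_on (T \<times> cbox 0 1) (\<lambda>(t, y). (b t - lo) *\<^sub>R F t (lo + y * (b t - lo)))"
      by (simp add: case_prod_unfold)
  qed
  ultimately show ?thesis by (simp cong: continuous_on_cong)
qed

text \<open>
  A list \<open>[(\<sigma>\<^sub>1, u\<^sub>1), \<dots>, (\<sigma>\<^sub>k, u\<^sub>k)]\<close> and a state \<open>u\<^sub>0\<close> encode the piecewise
  constant self-similar function whose value jumps from \<open>u\<^sub>j\<^sub>-\<^sub>1\<close> to \<open>u\<^sub>j\<close> across the ray of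
  slope \<open>\<sigma>\<^sub>j\<close>.
\<close>

fun step_val :: "'a \<Rightarrow> (real \<times> 'a) list \<Rightarrow> real \<Rightarrow> real \<Rightarrow> 'a" where
  "step_val u [] \<tau> y = u"
| "step_val u ((\<sigma>, v) # xs) \<tau> y = (if y \<le> \<sigma> * \<tau> then u else step_val v xs \<tau> y)"

fun last_val :: "'a \<Rightarrow> (real \<times> 'a) list \<Rightarrow> 'a" where
  "last_val u [] = u"
| "last_val u ((\<sigma>, v) # xs) = last_val v xs"

fun variation :: "'a::real_normed_vector \<Rightarrow> (real \<times> 'a) list \<Rightarrow> real" where
  "variation u [] = 0"
| "variation u ((\<sigma>, v) # xs) = norm (v - u) + variation v xs"

fun rh_defect :: "('a::real_normed_vector \<Rightarrow> 'a) \<Rightarrow> 'a \<Rightarrow> (real \<times> 'a) list \<Rightarrow> real" where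
  "rh_defect F u [] = 0"
| "rh_defect F u ((\<sigma>, v) # xs) = norm (F v - F u - \<sigma> *\<^sub>R (v - u)) + rh_defect F v xs"

text \<open>\<open>G\<close> collects the admissible states. Sorted slopes keep the rays from
  crossing, and \<open>\<Lambda>\<close> will be chosen such that they do not leave the
  cell.\<close>

definition step_data :: "real \<Rightarrow> 'a set \<Rightarrow> 'a \<Rightarrow> (real \<times> 'a) list \<Rightarrow> bool" where
  "step_data \<Lambda> G u xs \<longleftrightarrow>
     u \<in> G \<and> snd ` set xs \<subseteq> G \<and> sorted (map fst xs) \<and> (\<forall>\<sigma>\<in>fst ` set xs. \<bar>\<sigma>\<bar> \<le> \<Lambda>)"

lemma step_data_Nil [simp]: "step_data \<Lambda> G u [] \<longleftrightarrow> u \<in> G"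
  by (simp add: step_data_def)

lemma step_data_Cons:
  "step_data \<Lambda> G u ((\<sigma>, v) # xs) \<longleftrightarrow>
    u \<in> G \<and> \<bar>\<sigma>\<bar> \<le> \<Lambda> \<and> (\<forall>\<sigma>'\<in>fst ` set xs. \<sigma> \<le> \<sigma>') \<and> step_data \<Lambda> G v xs"
  by (auto simp: step_data_def)

lemma step_val_left:
  assumes "\<forall>\<sigma>'\<in>fst ` set xs. \<sigma> \<le> \<sigma>'" "0 \<le> \<tau>" "y \<le> \<sigma> * \<tau>"
  shows "step_val u xs \<tau> y = u"
proof (cases xs)
  case (Cons p ys)
  then obtain \<sigma>' v where "xs = (\<sigma>', v) # ys" by (cases p) auto
  moreover from this have "\<sigma> * \<tau> \<le> \<sigma>' * \<tau>" using assms by (auto intro: mult_right_mono)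
  ultimately show ?thesis using assms(3) by auto
qed simp

lemma step_val_right:
  assumes "\<forall>\<sigma>'\<in>fst ` set xs. \<sigma>' * \<tau> < y"
  shows "step_val u xs \<tau> y = last_val u xs"
  using assms by (induction u xs rule: last_val.induct) auto

lemma step_val_in: "step_data \<Lambda> G u xs \<Longrightarrow> step_val u xs \<tau> y \<in> G"
  by (induction u xs \<tau> y rule: step_val.induct) (auto simp: step_data_Cons)

section \<open>Green's formula for step functions in a space-time rectangle\<close>

locale cell =
  fixes t0 t1 x0 lo hi \<Lambda> :: real
  assumes t01: "t0 \<le> t1"
    and x0: "lo \<le> x0" "x0 \<le> hi"
    and ray: "\<And>\<sigma> t. \<bar>\<sigma>\<bar> \<le> \<Lambda> \<Longrightarrow> t \<in> {t0..t1} \<Longrightarrow> x0 + \<sigma> * (t - t0) \<in> {lo..hi}"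
begin

abbreviation step :: "'a \<Rightarrow> (real \<times> 'a) list \<Rightarrow> real \<Rightarrow> real \<Rightarrow> 'a" where
  "step u xs t x \<equiv> step_val u xs (t - t0) (x - x0)"

text \<open>Left of the first ray the remaining list still shows its initial state \<open>v\<close>,
  since its slopes are larger. Hence prepending a jump alters the integrand only on
  \<open>{lo..ray}\<close>, by the difference of two fixed states; all inductions over jumps below
  rest on this.\<close>

lemma step_slice:
  fixes \<Psi> :: "real \<Rightarrow> real \<Rightarrow> 'a \<Rightarrow> 'b::euclidean_space"
  assumes \<Psi>: "\<And>u. u \<in> G \<Longrightarrow> continuous_on {lo..hi} (\<lambda>x. \<Psi> t x u)"
    and t: "t \<in> {t0..t1}"
  shows "step_data \<Lambda> G u xs \<Longrightarrow> (\<lambda>x. \<Psi> t x (step u xs t x)) integrable_on {lo..hi}"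
    and "step_data \<Lambda> G u ((\<sigma>, v) # xs) \<Longrightarrow>
      integral {lo..hi} (\<lambda>x. \<Psi> t x (step u ((\<sigma>, v) # xs) t x))
      = integral {lo..hi} (\<lambda>x. \<Psi> t x (step v xs t x))
        + integral {lo..x0 + \<sigma> * (t - t0)} (\<lambda>x. \<Psi> t x u - \<Psi> t x v)"
proof -
  have extend: "((\<lambda>x. \<Psi> t x (step u ((\<sigma>, v) # xs) t x)) has_integral
      integral {lo..hi} (\<lambda>x. \<Psi> t x (step v xs t x))
        + integral {lo..x0 + \<sigma> * (t - t0)} (\<lambda>x. \<Psi> t x u - \<Psi> t x v)) {lo..hi}"
    if i: "(\<lambda>x. \<Psi> t x (step v xs t x)) integrable_on {lo..hi}"
      and s: "step_data \<Lambda> G u ((\<sigma>, v) # xs)" for \<sigma> u v xs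
  proof -
    let ?b = "x0 + \<sigma> * (t - t0)"
    have b: "?b \<in> {lo..hi}" using s t ray by (auto simp: step_data_Cons)
    have uv: "u \<in> G" "v \<in> G" using s by (auto simp: step_data_Cons step_data_def)
    have "(\<lambda>x. \<Psi> t x u - \<Psi> t x v) integrable_on {lo..?b}"
      using b by (intro integrable_continuous_real continuous_intros continuous_on_subset[OF \<Psi>] uv) auto
    then have "((\<lambda>x. if x \<in> {lo..?b} then \<Psi> t x u - \<Psi> t x v else 0) has_integral
        integral {lo..?b} (\<lambda>x. \<Psi> t x u - \<Psi> t x v)) {lo..hi}"
      using b by (subst has_integral_restrict) auto
    from has_integral_add[OF integrable_integral[OF i] this]
    show ?thesis
    proof (rule has_integral_eq[rotated])
      fix x assume x: "x \<in> {lo..hi}"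
      have "step v xs t x = v" if "x \<le> ?b"
        using that s t by (intro step_val_left[where \<sigma> = \<sigma>]) (auto simp: step_data_Cons)
      then show "\<Psi> t x (step v xs t x) + (if x \<in> {lo..?b} then \<Psi> t x u - \<Psi> t x v else 0)
          = \<Psi> t x (step u ((\<sigma>, v) # xs) t x)"
        using x by auto
    qed
  qed
  show int: "(\<lambda>x. \<Psi> t x (step u xs t x)) integrable_on {lo..hi}" if "step_data \<Lambda> G u xs" for u xs
    using that
  proof (induction u xs rule: last_val.induct)
    case (1 u)
    then show ?case by (auto intro!: integrable_continuous_real \<Psi>)
  next
    case (2 u \<sigma> v xs)
    from 2(2) have "step_data \<Lambda> G v xs" by (simp add: step_data_Cons)
    from extend[OF 2(1)[OF this] 2(2)] show ?case by (rule has_integral_integrable)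
  qed
  assume s: "step_data \<Lambda> G u ((\<sigma>, v) # xs)"
  then have "step_data \<Lambda> G v xs" by (simp add: step_data_Cons)
  from extend[OF int[OF this] s]
  show "integral {lo..hi} (\<lambda>x. \<Psi> t x (step u ((\<sigma>, v) # xs) t x))
      = integral {lo..hi} (\<lambda>x. \<Psi> t x (step v xs t x))
        + integral {lo..x0 + \<sigma> * (t - t0)} (\<lambda>x. \<Psi> t x u - \<Psi> t x v)"
    by (rule integral_unique)
qed

lemma slice_continuous:
  assumes "continuous_on ({t0..t1} \<times> {lo..hi}) (\<lambda>(t, x). F t x)" "t \<in> {t0..t1}"
  shows "continuous_on {lo..hi} (F t)"
  by (rule continuous_on_uncurried_compose[OF assms(1)])
    (use assms(2) in \<open>auto intro!: continuous_intros\<close>)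

lemma continuous_on_step_integral:
  fixes \<Psi> :: "real \<Rightarrow> real \<Rightarrow> 'a \<Rightarrow> 'b::euclidean_space"
  assumes \<Psi>: "\<And>u. u \<in> G \<Longrightarrow> continuous_on ({t0..t1} \<times> {lo..hi}) (\<lambda>(t, x). \<Psi> t x u)"
  shows "step_data \<Lambda> G u xs \<Longrightarrow>
    continuous_on {t0..t1} (\<lambda>t. integral {lo..hi} (\<lambda>x. \<Psi> t x (step u xs t x)))"
proof (induction u xs rule: last_val.induct)
  case (1 u)
  then show ?case
    using continuous_on_integral_moving_endpoint[OF \<Psi>, of u "\<lambda>_. hi"] x0 by auto
next
  case (2 u \<sigma> v xs)
  have s: "step_data \<Lambda> G v xs" and uv: "u \<in> G" "v \<in> G" and \<sigma>: "\<bar>\<sigma>\<bar> \<le> \<Lambda>"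
    using 2(2) by (auto simp: step_data_Cons step_data_def)
  have "continuous_on ({t0..t1} \<times> {lo..hi}) (\<lambda>(t, x). \<Psi> t x u - \<Psi> t x v)"
    using continuous_on_diff[OF \<Psi>[OF uv(1)] \<Psi>[OF uv(2)]] by (simp add: case_prod_unfold)
  then have "continuous_on {t0..t1}
      (\<lambda>t. integral {lo..x0 + \<sigma> * (t - t0)} (\<lambda>x. \<Psi> t x u - \<Psi> t x v))"
    by (rule continuous_on_integral_moving_endpoint) (use ray[OF \<sigma>] in \<open>auto intro!: continuous_intros\<close>)
  then have "continuous_on {t0..t1} (\<lambda>t. integral {lo..hi} (\<lambda>x. \<Psi> t x (step v xs t x))
      + integral {lo..x0 + \<sigma> * (t - t0)} (\<lambda>x. \<Psi> t x u - \<Psi> t x v))"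
    by (intro continuous_on_add 2(1)[OF s])
  moreover have "integral {lo..hi} (\<lambda>x. \<Psi> t x (step u ((\<sigma>, v) # xs) t x))
      = integral {lo..hi} (\<lambda>x. \<Psi> t x (step v xs t x))
        + integral {lo..x0 + \<sigma> * (t - t0)} (\<lambda>x. \<Psi> t x u - \<Psi> t x v)" if "t \<in> {t0..t1}" for t
    using that by (intro step_slice(2)[OF slice_continuous[OF \<Psi>] _ 2(2)]) auto
  ultimately show ?case by (subst continuous_on_cong[OF refl]) auto
qed

lemma step_green:
  fixes h ht \<phi> \<phi>x :: "real \<Rightarrow> real \<Rightarrow> 'a::real_normed_vector \<Rightarrow> 'b::euclidean_space"
  assumes hc: "\<And>u. u \<in> G \<Longrightarrow> continuous_on ({t0..t1} \<times> {lo..hi}) (\<lambda>(t, x). h t x u)"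
    and htc: "\<And>u. u \<in> G \<Longrightarrow> continuous_on ({t0..t1} \<times> {lo..hi}) (\<lambda>(t, x). ht t x u)"
    and \<phi>c: "\<And>u. u \<in> G \<Longrightarrow> continuous_on ({t0..t1} \<times> {lo..hi}) (\<lambda>(t, x). \<phi> t x u)"
    and \<phi>xc: "\<And>u. u \<in> G \<Longrightarrow> continuous_on ({t0..t1} \<times> {lo..hi}) (\<lambda>(t, x). \<phi>x t x u)"
    and hd: "\<And>u t x. u \<in> G \<Longrightarrow> t \<in> {t0..t1} \<Longrightarrow> x \<in> {lo..hi} \<Longrightarrow>
      ((\<lambda>t. h t x u) has_vector_derivative ht t x u) (at t within {t0..t1})"
    and \<phi>d: "\<And>u t x. u \<in> G \<Longrightarrow> t \<in> {t0..t1} \<Longrightarrow> x \<in> {lo..hi} \<Longrightarrow>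
      ((\<lambda>x. \<phi> t x u) has_vector_derivative \<phi>x t x u) (at x within {lo..hi})"
    and jump: "\<And>u v \<sigma> t. u \<in> G \<Longrightarrow> v \<in> G \<Longrightarrow> \<bar>\<sigma>\<bar> \<le> \<Lambda> \<Longrightarrow> t \<in> {t0..t1} \<Longrightarrow>
      norm (\<phi> t (x0 + \<sigma> * (t - t0)) v - \<phi> t (x0 + \<sigma> * (t - t0)) u
        - \<sigma> *\<^sub>R (h t (x0 + \<sigma> * (t - t0)) v - h t (x0 + \<sigma> * (t - t0)) u))
      \<le> C1 * norm (v - u) + C0 * norm (F v - F u - \<sigma> *\<^sub>R (v - u))"
  shows "step_data \<Lambda> G u xs \<Longrightarrow>
    norm (integral {t0..t1} (\<lambda>t. integral {lo..hi}
        (\<lambda>x. ht t x (step u xs t x) + \<phi>x t x (step u xs t x)))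
      - (integral {lo..hi} (\<lambda>x. h t1 x (step u xs t1 x)) - integral {lo..hi} (\<lambda>x. h t0 x (step u xs t0 x))
        + integral {t0..t1} (\<lambda>t. \<phi> t hi (last_val u xs)) - integral {t0..t1} (\<lambda>t. \<phi> t lo u)))
    \<le> (t1 - t0) * (C1 * variation u xs + C0 * rh_defect F u xs)"
proof (induction u xs rule: last_val.induct)
  case (1 u)
  then have u: "u \<in> G" by simp
  \<comment> \<open>Without jumps the whole cell is the sector bounded by the vertical line at
    \<open>hi\<close>.\<close>
  from sector_integral[OF hc[OF u] htc[OF u] \<phi>c[OF u] \<phi>xc[OF u] hd[OF u] \<phi>d[OF u], of hi 0] t01 x0
  show ?case by (simp add: integral_unique)
next
  case (2 u \<sigma> v xs)
  have s: "step_data \<Lambda> G v xs" and u: "u \<in> G" and v: "v \<in> G" and \<sigma>: "\<bar>\<sigma>\<bar> \<le> \<Lambda>"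
    using 2(2) by (auto simp: step_data_Cons step_data_def)
  let ?R = "{t0..t1} \<times> {lo..hi}" and ?b = "\<lambda>t. x0 + \<sigma> * (t - t0)"
  let ?J = "\<lambda>t x u. ht t x u + \<phi>x t x u"
  define jmp where
    "jmp t = (\<phi> t (?b t) u - \<phi> t (?b t) v) - \<sigma> *\<^sub>R (h t (?b t) u - h t (?b t) v)" for t
  have diff: "continuous_on ?R (\<lambda>(t, x). F t x u - F t x v)"
    if "\<And>u. u \<in> G \<Longrightarrow> continuous_on ?R (\<lambda>(t, x). F t x u)" for F :: "real \<Rightarrow> real \<Rightarrow> 'a \<Rightarrow> 'b"
    using continuous_on_diff[OF that[OF u] that[OF v]] by (simp add: case_prod_unfold)
  have Jc: "continuous_on ?R (\<lambda>(t, x). ?J t x u)" if "u \<in> G" for u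
    using continuous_on_add[OF htc[OF that] \<phi>xc[OF that]] by (simp add: case_prod_unfold)
  have int_lo: "(\<lambda>t. \<phi> t lo w) integrable_on {t0..t1}" if "w \<in> G" for w
    by (intro integrable_continuous_real continuous_on_uncurried_compose[OF \<phi>c[OF that]])
      (use x0 in \<open>auto intro!: continuous_intros\<close>)
  \<comment> \<open>\<open>sector_integral\<close> parametrizes the ray by absolute time, so its
    intercept is \<open>x0 - \<sigma> * t0\<close>.\<close>
  have "((\<lambda>t. integral {lo..x0 - \<sigma> * t0 + \<sigma> * t}
        (\<lambda>x. (ht t x u - ht t x v) + (\<phi>x t x u - \<phi>x t x v))) has_integral
      integral {lo..x0 - \<sigma> * t0 + \<sigma> * t1} (\<lambda>x. h t1 x u - h t1 x v)
      - integral {lo..x0 - \<sigma> * t0 + \<sigma> * t0} (\<lambda>x. h t0 x u - h t0 x v)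
      + integral {t0..t1} (\<lambda>t. (\<phi> t (x0 - \<sigma> * t0 + \<sigma> * t) u - \<phi> t (x0 - \<sigma> * t0 + \<sigma> * t) v)
         - \<sigma> *\<^sub>R (h t (x0 - \<sigma> * t0 + \<sigma> * t) u - h t (x0 - \<sigma> * t0 + \<sigma> * t) v))
      - integral {t0..t1} (\<lambda>t. \<phi> t lo u - \<phi> t lo v)) {t0..t1}"
  proof (rule sector_integral[OF diff[of h, OF hc] diff[of ht, OF htc] diff[of \<phi>, OF \<phi>c]
        diff[of \<phi>x, OF \<phi>xc] has_vector_derivative_diff has_vector_derivative_diff])
    show "x0 - \<sigma> * t0 + \<sigma> * t \<in> {lo..hi}" if "t \<in> {t0..t1}" for t
      using ray[OF \<sigma> that] by (simp add: algebra_simps)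
  qed (use hd \<phi>d u v t01 in auto)
  moreover have "x0 - \<sigma> * t0 + \<sigma> * t = ?b t" for t by (simp add: algebra_simps)
  ultimately have sector: "((\<lambda>t. integral {lo..?b t} (\<lambda>x. ?J t x u - ?J t x v)) has_integral
      integral {lo..?b t1} (\<lambda>x. h t1 x u - h t1 x v) - integral {lo..?b t0} (\<lambda>x. h t0 x u - h t0 x v)
      + integral {t0..t1} jmp - integral {t0..t1} (\<lambda>t. \<phi> t lo u - \<phi> t lo v)) {t0..t1}"
    unfolding jmp_def[abs_def] by (simp only: add_diff_add)
  have lo_diff: "integral {t0..t1} (\<lambda>t. \<phi> t lo u - \<phi> t lo v)
      = integral {t0..t1} (\<lambda>t. \<phi> t lo u) - integral {t0..t1} (\<lambda>t. \<phi> t lo v)"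
    by (intro integral_diff int_lo u v)
  have J_split: "integral {t0..t1} (\<lambda>t. integral {lo..hi} (\<lambda>x. ?J t x (step u ((\<sigma>, v) # xs) t x)))
      = integral {t0..t1} (\<lambda>t. integral {lo..hi} (\<lambda>x. ?J t x (step v xs t x)))
        + integral {t0..t1} (\<lambda>t. integral {lo..?b t} (\<lambda>x. ?J t x u - ?J t x v))"
  proof -
    have "integral {t0..t1} (\<lambda>t. integral {lo..hi} (\<lambda>x. ?J t x (step u ((\<sigma>, v) # xs) t x)))
      = integral {t0..t1} (\<lambda>t. integral {lo..hi} (\<lambda>x. ?J t x (step v xs t x))
          + integral {lo..?b t} (\<lambda>x. ?J t x u - ?J t x v))"
      by (rule integral_cong, rule step_slice(2)[OF slice_continuous[OF Jc] _ 2(2)]) auto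
    also have "\<dots> = integral {t0..t1} (\<lambda>t. integral {lo..hi} (\<lambda>x. ?J t x (step v xs t x)))
        + integral {t0..t1} (\<lambda>t. integral {lo..?b t} (\<lambda>x. ?J t x u - ?J t x v))"
      by (intro integral_add has_integral_integrable[OF sector] integrable_continuous_real
          continuous_on_step_integral[OF Jc s]) auto
    finally show ?thesis .
  qed
  have h_split: "integral {lo..hi} (\<lambda>x. h t x (step u ((\<sigma>, v) # xs) t x))
      = integral {lo..hi} (\<lambda>x. h t x (step v xs t x)) + integral {lo..?b t} (\<lambda>x. h t x u - h t x v)"
    if "t \<in> {t0..t1}" for t
    using that by (intro step_slice(2)[OF slice_continuous[OF hc] _ 2(2)]) auto
  have ends: "t0 \<in> {t0..t1}" "t1 \<in> {t0..t1}" using t01 by auto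
  let ?c = "C1 * norm (v - u) + C0 * norm (F v - F u - \<sigma> *\<^sub>R (v - u))"
  have "norm (integral {t0..t1} jmp) \<le> ?c * (t1 - t0)"
  proof (rule integral_bound[OF t01])
    have jmpc: "continuous_on {t0..t1} (\<lambda>t. E t (?b t) w)"
      if "\<And>u. u \<in> G \<Longrightarrow> continuous_on ?R (\<lambda>(t, x). E t x u)" "w \<in> G"
      for E :: "real \<Rightarrow> real \<Rightarrow> 'a \<Rightarrow> 'b" and w
      by (rule continuous_on_uncurried_compose[OF that(1)[OF that(2)]])
        (use ray[OF \<sigma>] in \<open>auto intro!: continuous_intros\<close>)
    show "continuous_on {t0..t1} jmp"
      unfolding jmp_def by (intro continuous_intros jmpc hc \<phi>c u v)
    fix t assume "t \<in> {t0..t1}"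
    moreover have "norm (jmp t) = norm (\<phi> t (?b t) v - \<phi> t (?b t) u - \<sigma> *\<^sub>R (h t (?b t) v - h t (?b t) u))"
      unfolding jmp_def by (subst norm_minus_cancel[symmetric]) (simp add: algebra_simps)
    ultimately show "norm (jmp t) \<le> ?c" using jump[OF u v \<sigma>] by simp
  qed
  then have "norm (integral {t0..t1} jmp) \<le> (t1 - t0) * ?c" by (simp add: mult.commute)
  from norm_triangle_mono[OF this 2(1)[OF s]] show ?case
    unfolding J_split h_split[OF ends(1)] h_split[OF ends(2)] integral_unique[OF sector] lo_diff
    by (simp add: algebra_simps)
qed

end

section \<open>Uniform limits of step functions, up to finite exceptional sets\<close>

lemma integral_diff_bound_spike_finite:
  fixes f g :: "real \<Rightarrow> 'b::banach"
  assumes "f integrable_on {a..b}" "g integrable_on {a..b}" "finite E" "0 \<le> B" "a \<le> b"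
    and "\<And>x. x \<in> {a..b} - E \<Longrightarrow> norm (f x - g x) \<le> B"
  shows "norm (integral {a..b} f - integral {a..b} g) \<le> B * (b - a)"
  using has_integral_bound_spike_finite[of B E "\<lambda>x. f x - g x" _ a b] assms
    has_integral_diff[OF integrable_integral[OF assms(1)] integrable_integral[OF assms(2)]]
  by simp

text \<open>Overwriting the approximant by \<open>f\<close> on the finite set makes the estimate
  hold everywhere and does not affect integrability.\<close>

lemma integrable_uniform_limit_spike_finite:
  fixes f :: "real \<Rightarrow> 'b::banach"
  assumes "\<And>e. 0 < e \<Longrightarrow>
    \<exists>g E. finite E \<and> g integrable_on {a..b} \<and> (\<forall>x\<in>{a..b} - E. norm (f x - g x) \<le> e)"
  shows "f integrable_on {a..b}"
proof -
  have "\<exists>g. (\<forall>x\<in>cbox a b. norm (f x - g x) \<le> e) \<and> g integrable_on cbox a b" if "0 < e" for e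
  proof -
    obtain g E where "finite E" "g integrable_on {a..b}" "\<forall>x\<in>{a..b} - E. norm (f x - g x) \<le> e"
      using assms \<open>0 < e\<close> by blast
    then show ?thesis
      using \<open>0 < e\<close> integrable_spike_finite[of E "{a..b}" "\<lambda>x. if x \<in> E then f x else g x" g]
      by (intro exI[of _ "\<lambda>x. if x \<in> E then f x else g x"]) auto
  qed
  then show ?thesis using integrable_uniform_limit[of a b f] by simp
qed

context cell
begin

text \<open>The exceptional set may depend on \<open>t\<close>: the profile is free at the speed of
  a jump, and the point where such a ray meets a slice moves with time.\<close>

definition step_approx ::
  "'a::real_normed_vector set \<Rightarrow> (real \<Rightarrow> real \<Rightarrow> 'a) \<Rightarrow> real \<Rightarrow> 'a \<Rightarrow> (real \<times> 'a) list \<Rightarrow> bool" where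
  "step_approx G w e u xs \<longleftrightarrow> step_data \<Lambda> G u xs \<and>
     (\<forall>t\<in>{t0..t1}. \<exists>E. finite E \<and> (\<forall>x\<in>{lo..hi} - E. norm (w t x - step u xs t x) \<le> e))"

lemma lo_hi: "lo \<le> hi"
  using x0 by simp

context
  fixes w :: "real \<Rightarrow> real \<Rightarrow> 'a::real_normed_vector" and G :: "'a set"
  assumes wG: "\<And>t x. t \<in> {t0..t1} \<Longrightarrow> x \<in> {lo..hi} \<Longrightarrow> w t x \<in> G"
begin

context
  fixes \<Psi> :: "real \<Rightarrow> real \<Rightarrow> 'a \<Rightarrow> 'b::euclidean_space" and L :: real
  assumes L: "0 \<le> L"
    and \<Psi>: "\<And>u. u \<in> G \<Longrightarrow> continuous_on ({t0..t1} \<times> {lo..hi}) (\<lambda>(t, x). \<Psi> t x u)"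
    and lip: "\<And>t x u v. t \<in> {t0..t1} \<Longrightarrow> x \<in> {lo..hi} \<Longrightarrow> u \<in> G \<Longrightarrow> v \<in> G \<Longrightarrow>
      norm (\<Psi> t x u - \<Psi> t x v) \<le> L * norm (u - v)"
begin

lemma slice_step_integrable:
  "step_data \<Lambda> G u xs \<Longrightarrow> t \<in> {t0..t1} \<Longrightarrow> (\<lambda>x. \<Psi> t x (step u xs t x)) integrable_on {lo..hi}"
  by (rule step_slice(1)[OF slice_continuous[OF \<Psi>]]) auto

lemma slice_close:
  assumes "step_approx G w e u xs" "t \<in> {t0..t1}"
  shows "\<exists>E. finite E \<and>
    (\<forall>x\<in>{lo..hi} - E. norm (\<Psi> t x (w t x) - \<Psi> t x (step u xs t x)) \<le> L * e)"
proof -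
  from assms obtain E where E: "finite E" "\<forall>x\<in>{lo..hi} - E. norm (w t x - step u xs t x) \<le> e"
    and s: "step_data \<Lambda> G u xs"
    unfolding step_approx_def by blast
  have "norm (\<Psi> t x (w t x) - \<Psi> t x (step u xs t x)) \<le> L * e" if x: "x \<in> {lo..hi} - E" for x
  proof -
    have "norm (\<Psi> t x (w t x) - \<Psi> t x (step u xs t x)) \<le> L * norm (w t x - step u xs t x)"
      using x by (intro lip[OF assms(2)] wG[OF assms(2)] step_val_in[OF s]) auto
    also have "\<dots> \<le> L * e"
      using E(2) x L by (intro mult_left_mono) auto
    finally show ?thesis .
  qed
  with E(1) show ?thesis by blast
qed

text \<open>Nothing is known about the regularity of \<open>w\<close>; composition with a Lipschitz
  field preserves uniform closeness, so integrability passes from step functions to the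
  limit.\<close>

lemma slice_integrable:
  assumes approx: "\<And>e. 0 < e \<Longrightarrow> \<exists>u xs. step_approx G w e u xs" and t: "t \<in> {t0..t1}"
  shows "(\<lambda>x. \<Psi> t x (w t x)) integrable_on {lo..hi}"
proof (rule integrable_uniform_limit_spike_finite)
  fix e :: real assume "0 < e"
  then have "0 < e / (L + 1)" using L by simp
  then obtain u xs where s: "step_approx G w (e / (L + 1)) u xs" using approx by blast
  have "L * (e / (L + 1)) \<le> e" using L \<open>0 < e\<close> by (simp add: field_simps)
  with slice_close[OF s t] slice_step_integrable[of u xs t] s t
  show "\<exists>g E. finite E \<and> g integrable_on {lo..hi} \<and>
      (\<forall>x\<in>{lo..hi} - E. norm (\<Psi> t x (w t x) - g x) \<le> e)"
    unfolding step_approx_def by (meson order_trans)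
qed

lemma slice_integral_close:
  assumes approx: "\<And>e. 0 < e \<Longrightarrow> \<exists>u xs. step_approx G w e u xs" and t: "t \<in> {t0..t1}"
    and s: "step_approx G w e u xs" and e: "0 \<le> e"
  shows "norm (integral {lo..hi} (\<lambda>x. \<Psi> t x (w t x)) - integral {lo..hi} (\<lambda>x. \<Psi> t x (step u xs t x)))
    \<le> L * e * (hi - lo)"
proof -
  obtain E where "finite E"
    "\<forall>x\<in>{lo..hi} - E. norm (\<Psi> t x (w t x) - \<Psi> t x (step u xs t x)) \<le> L * e"
    using slice_close[OF s t] by blast
  then show ?thesis
    using s L e by (intro integral_diff_bound_spike_finite slice_integrable[OF approx t]
        slice_step_integrable t lo_hi) (auto simp: step_approx_def)
qed

lemma double_integrable:
  assumes approx: "\<And>e. 0 < e \<Longrightarrow> \<exists>u xs. step_approx G w e u xs"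
  shows "(\<lambda>t. integral {lo..hi} (\<lambda>x. \<Psi> t x (w t x))) integrable_on {t0..t1}"
proof (rule integrable_uniform_limit_spike_finite)
  fix e :: real assume e: "0 < e"
  define d where "d = e / (L * (hi - lo) + 1)"
  have p: "0 < L * (hi - lo) + 1" using L lo_hi by (simp add: add_nonneg_pos)
  then have d: "0 < d" using e by (simp add: d_def)
  have "L * d * (hi - lo) = e * (L * (hi - lo)) / (L * (hi - lo) + 1)" by (simp add: d_def)
  also have "\<dots> \<le> e" using p e by (simp add: divide_le_eq distrib_left)
  finally have le: "L * d * (hi - lo) \<le> e" .
  obtain u xs where s: "step_approx G w d u xs" using approx[OF d] by blast
  let ?g = "\<lambda>t. integral {lo..hi} (\<lambda>x. \<Psi> t x (step u xs t x))"
  have "?g integrable_on {t0..t1}"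
    using s by (intro integrable_continuous_real continuous_on_step_integral[OF \<Psi>])
      (auto simp: step_approx_def)
  moreover have "norm (integral {lo..hi} (\<lambda>x. \<Psi> t x (w t x)) - ?g t) \<le> e" if "t \<in> {t0..t1}" for t
    using slice_integral_close[OF approx that s] d le by linarith
  ultimately show "\<exists>g E. finite E \<and> g integrable_on {t0..t1} \<and>
      (\<forall>t\<in>{t0..t1} - E. norm (integral {lo..hi} (\<lambda>x. \<Psi> t x (w t x)) - g t) \<le> e)"
    by (intro exI[of _ ?g] exI[of _ "{}"]) auto
qed

lemma double_integral_close:
  assumes approx: "\<And>e. 0 < e \<Longrightarrow> \<exists>u xs. step_approx G w e u xs"
    and s: "step_approx G w e u xs" and e: "0 \<le> e"
  shows "norm (integral {t0..t1} (\<lambda>t. integral {lo..hi} (\<lambda>x. \<Psi> t x (w t x)))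
      - integral {t0..t1} (\<lambda>t. integral {lo..hi} (\<lambda>x. \<Psi> t x (step u xs t x))))
    \<le> L * e * (hi - lo) * (t1 - t0)"
proof (rule integral_diff_bound_spike_finite[where E = "{}"])
  show "(\<lambda>t. integral {lo..hi} (\<lambda>x. \<Psi> t x (step u xs t x))) integrable_on {t0..t1}"
    using s by (intro integrable_continuous_real continuous_on_step_integral[OF \<Psi>])
      (auto simp: step_approx_def)
qed (use slice_integral_close[OF approx _ s e] double_integrable[OF approx] L e lo_hi t01 in auto)

end

lemma double_integral_diff_bound:
  fixes \<Psi>1 \<Psi>2 :: "real \<Rightarrow> real \<Rightarrow> 'a \<Rightarrow> 'b::euclidean_space"
  assumes approx: "\<And>e. 0 < e \<Longrightarrow> \<exists>u xs. step_approx G w e u xs"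
    and L: "0 \<le> L" and B: "0 \<le> B"
    and c1: "\<And>u. u \<in> G \<Longrightarrow> continuous_on ({t0..t1} \<times> {lo..hi}) (\<lambda>(t, x). \<Psi>1 t x u)"
    and lip1: "\<And>t x u v. t \<in> {t0..t1} \<Longrightarrow> x \<in> {lo..hi} \<Longrightarrow> u \<in> G \<Longrightarrow> v \<in> G \<Longrightarrow>
      norm (\<Psi>1 t x u - \<Psi>1 t x v) \<le> L * norm (u - v)"
    and c2: "\<And>u. u \<in> G \<Longrightarrow> continuous_on ({t0..t1} \<times> {lo..hi}) (\<lambda>(t, x). \<Psi>2 t x u)"
    and lip2: "\<And>t x u v. t \<in> {t0..t1} \<Longrightarrow> x \<in> {lo..hi} \<Longrightarrow> u \<in> G \<Longrightarrow> v \<in> G \<Longrightarrow>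
      norm (\<Psi>2 t x u - \<Psi>2 t x v) \<le> L * norm (u - v)"
    and diff: "\<And>t x u. t \<in> {t0..t1} \<Longrightarrow> x \<in> {lo..hi} \<Longrightarrow> u \<in> G \<Longrightarrow>
      norm (\<Psi>1 t x u - \<Psi>2 t x u) \<le> B"
  shows "norm (integral {t0..t1} (\<lambda>t. integral {lo..hi} (\<lambda>x. \<Psi>1 t x (w t x)))
      - integral {t0..t1} (\<lambda>t. integral {lo..hi} (\<lambda>x. \<Psi>2 t x (w t x))))
    \<le> B * (hi - lo) * (t1 - t0)"
proof (rule integral_diff_bound_spike_finite[where E = "{}"])
  fix t assume t: "t \<in> {t0..t1} - {}"
  show "norm (integral {lo..hi} (\<lambda>x. \<Psi>1 t x (w t x)) - integral {lo..hi} (\<lambda>x. \<Psi>2 t x (w t x)))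
      \<le> B * (hi - lo)"
    using slice_integrable[OF L c1 lip1 approx] slice_integrable[OF L c2 lip2 approx] t B lo_hi
    by (intro integral_diff_bound_spike_finite[where E = "{}"]) (auto intro!: diff wG)
qed (use double_integrable[OF L c1 lip1 approx] double_integrable[OF L c2 lip2 approx] B lo_hi t01 in auto)

text \<open>The variation of the approximants stays below one fixed \<open>V\<close>, while their
  defect and their distance to \<open>w\<close> tend to 0; so only the variation term of
  \<open>step_green\<close> survives.\<close>

lemma green_estimate:
  fixes h ht \<phi> \<phi>x :: "real \<Rightarrow> real \<Rightarrow> 'a \<Rightarrow> 'b::euclidean_space"
  assumes L: "0 \<le> L"
    and hc: "\<And>u. u \<in> G \<Longrightarrow> continuous_on ({t0..t1} \<times> {lo..hi}) (\<lambda>(t, x). h t x u)"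
    and htc: "\<And>u. u \<in> G \<Longrightarrow> continuous_on ({t0..t1} \<times> {lo..hi}) (\<lambda>(t, x). ht t x u)"
    and \<phi>c: "\<And>u. u \<in> G \<Longrightarrow> continuous_on ({t0..t1} \<times> {lo..hi}) (\<lambda>(t, x). \<phi> t x u)"
    and \<phi>xc: "\<And>u. u \<in> G \<Longrightarrow> continuous_on ({t0..t1} \<times> {lo..hi}) (\<lambda>(t, x). \<phi>x t x u)"
    and hd: "\<And>u t x. u \<in> G \<Longrightarrow> t \<in> {t0..t1} \<Longrightarrow> x \<in> {lo..hi} \<Longrightarrow>
      ((\<lambda>t. h t x u) has_vector_derivative ht t x u) (at t within {t0..t1})"
    and \<phi>d: "\<And>u t x. u \<in> G \<Longrightarrow> t \<in> {t0..t1} \<Longrightarrow> x \<in> {lo..hi} \<Longrightarrow>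
      ((\<lambda>x. \<phi> t x u) has_vector_derivative \<phi>x t x u) (at x within {lo..hi})"
    and jump: "\<And>u v \<sigma> t. u \<in> G \<Longrightarrow> v \<in> G \<Longrightarrow> \<bar>\<sigma>\<bar> \<le> \<Lambda> \<Longrightarrow> t \<in> {t0..t1} \<Longrightarrow>
      norm (\<phi> t (x0 + \<sigma> * (t - t0)) v - \<phi> t (x0 + \<sigma> * (t - t0)) u
        - \<sigma> *\<^sub>R (h t (x0 + \<sigma> * (t - t0)) v - h t (x0 + \<sigma> * (t - t0)) u))
      \<le> C1 * norm (v - u) + C0 * norm (F v - F u - \<sigma> *\<^sub>R (v - u))"
    and C: "0 \<le> C1" "0 \<le> C0"
    and lip_h: "\<And>t x u v. t \<in> {t0..t1} \<Longrightarrow> x \<in> {lo..hi} \<Longrightarrow> u \<in> G \<Longrightarrow> v \<in> G \<Longrightarrow>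
      norm (h t x u - h t x v) \<le> L * norm (u - v)"
    and lip_J: "\<And>t x u v. t \<in> {t0..t1} \<Longrightarrow> x \<in> {lo..hi} \<Longrightarrow> u \<in> G \<Longrightarrow> v \<in> G \<Longrightarrow>
      norm ((ht t x u + \<phi>x t x u) - (ht t x v + \<phi>x t x v)) \<le> L * norm (u - v)"
    and approx: "\<And>e. 0 < e \<Longrightarrow> \<exists>xs. step_approx G w e uL xs \<and> last_val uL xs = uR \<and>
      variation uL xs \<le> V \<and> rh_defect F uL xs \<le> e"
  shows "norm (integral {t0..t1} (\<lambda>t. integral {lo..hi} (\<lambda>x. ht t x (w t x) + \<phi>x t x (w t x)))
      - (integral {lo..hi} (\<lambda>x. h t1 x (w t1 x)) - integral {lo..hi} (\<lambda>x. h t0 x (w t0 x))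
        + integral {t0..t1} (\<lambda>t. \<phi> t hi uR) - integral {t0..t1} (\<lambda>t. \<phi> t lo uL)))
    \<le> (t1 - t0) * (C1 * V)"
proof -
  have approx': "\<exists>u xs. step_approx G w e u xs" if "0 < e" for e using approx[OF that] by blast
  let ?J = "\<lambda>t x u. ht t x u + \<phi>x t x u"
  have Jc: "continuous_on ({t0..t1} \<times> {lo..hi}) (\<lambda>(t, x). ?J t x u)" if "u \<in> G" for u
    using continuous_on_add[OF htc[OF that] \<phi>xc[OF that]] by (simp add: case_prod_unfold)
  define DW where "DW = integral {t0..t1} (\<lambda>t. integral {lo..hi} (\<lambda>x. ?J t x (w t x)))"
  define HW where "HW t = integral {lo..hi} (\<lambda>x. h t x (w t x))" for t
  define P where "P = integral {t0..t1} (\<lambda>t. \<phi> t hi uR) - integral {t0..t1} (\<lambda>t. \<phi> t lo uL)"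
  \<comment> \<open>The total coefficient of \<open>e\<close>: the defect, the double integral, and
    the two slices at \<open>t1\<close> and \<open>t0\<close>.\<close>
  define K where "K = (t1 - t0) * C0 + L * (hi - lo) * (t1 - t0) + L * (hi - lo) + L * (hi - lo)"
  have K: "0 \<le> K" using C L t01 lo_hi by (simp add: K_def)
  have main: "norm (DW - (HW t1 - HW t0 + P)) \<le> (t1 - t0) * (C1 * V) + K * e" if e: "0 < e" for e
  proof -
    obtain xs where s: "step_approx G w e uL xs" and lv: "last_val uL xs = uR"
      and V: "variation uL xs \<le> V" and rh: "rh_defect F uL xs \<le> e"
      using approx[OF e] by blast
    define DS where "DS = integral {t0..t1} (\<lambda>t. integral {lo..hi} (\<lambda>x. ?J t x (step uL xs t x)))"
    define HS where "HS t = integral {lo..hi} (\<lambda>x. h t x (step uL xs t x))" for t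
    have "norm (DS - (HS t1 - HS t0 + P)) \<le> (t1 - t0) * (C1 * variation uL xs + C0 * rh_defect F uL xs)"
      using step_green[OF hc htc \<phi>c \<phi>xc hd \<phi>d jump, of G uL xs] s
      unfolding DS_def HS_def P_def lv step_approx_def by (simp add: algebra_simps)
    also have "\<dots> \<le> (t1 - t0) * (C1 * V + C0 * e)"
      using V rh C t01 by (intro mult_left_mono add_mono) auto
    finally have "norm (DS - (HS t1 - HS t0 + P)) \<le> (t1 - t0) * (C1 * V + C0 * e)" .
    moreover have "norm (DW - DS) \<le> L * e * (hi - lo) * (t1 - t0)"
      unfolding DW_def DS_def
      by (rule double_integral_close[OF L Jc lip_J approx' s]) (use e in auto)
    moreover have "norm (HW t - HS t) \<le> L * e * (hi - lo)" if "t \<in> {t0..t1}" for t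
      unfolding HW_def HS_def
      by (rule slice_integral_close[OF L hc lip_h approx' that s]) (use e in auto)
    then have "norm (HW t1 - HS t1) \<le> L * e * (hi - lo)" "norm (HW t0 - HS t0) \<le> L * e * (hi - lo)"
      using t01 by auto
    moreover have "norm (DW - (HW t1 - HW t0 + P)) \<le> norm (DS - (HS t1 - HS t0 + P))
        + norm (DW - DS) + norm (HW t1 - HS t1) + norm (HW t0 - HS t0)"
    proof -
      have "DW - (HW t1 - HW t0 + P)
          = (DS - (HS t1 - HS t0 + P)) + (DW - DS) - (HW t1 - HS t1) + (HW t0 - HS t0)"
        by simp
      then show ?thesis by (smt (verit) norm_triangle_ineq norm_triangle_ineq4)
    qed
    ultimately show ?thesis by (simp add: K_def algebra_simps)
  qed
  have "norm (DW - (HW t1 - HW t0 + P)) \<le> (t1 - t0) * (C1 * V)"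
  proof (rule field_le_epsilon)
    fix e :: real assume "0 < e"
    then have "0 < e / (K + 1)" "K * (e / (K + 1)) \<le> e" using K by (simp_all add: field_simps)
    with main[of "e / (K + 1)"]
    show "norm (DW - (HW t1 - HW t0 + P)) \<le> (t1 - t0) * (C1 * V) + e" by linarith
  qed
  then show ?thesis unfolding DW_def HW_def P_def by (simp add: algebra_simps)
qed

end

end

section \<open>Strength of the waves\<close>

locale eigenbasis =
  fixes A :: "'v::euclidean_space \<Rightarrow> 'v" and l :: "nat \<Rightarrow> real" and d :: "nat \<Rightarrow> 'v" and M c :: real
    and idx :: "nat set"
  assumes finite_idx [simp]: "finite idx"
    and card_idx: "card idx = DIM('v)"
    and lin: "linear A"
    and A_bound: "\<And>x. norm (A x) \<le> M * norm x"
    and eig: "\<And>i. i \<in> idx \<Longrightarrow> A (d i) = l i *\<^sub>R d i"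
    and unit: "\<And>i. i \<in> idx \<Longrightarrow> norm (d i) = 1"
    and gap: "\<And>i j. i \<in> idx \<Longrightarrow> j \<in> idx \<Longrightarrow> i < j \<Longrightarrow> c \<le> l j - l i"
    and c: "0 < c"
    and M: "c \<le> 2 * M"
begin

abbreviation p :: nat where
  "p \<equiv> card idx"

text \<open>Each of the \<open>p - 1\<close> factors of the polynomial that isolates an eigenvector
  has norm at most \<open>2 * M\<close>, and its value at the remaining eigenvalue contributes at
  least \<open>c\<close> per factor.\<close>

definition bound :: real where
  "bound = (2 * M / c) ^ (p - 1)"

lemma bound_ge_1: "1 \<le> bound"
  unfolding bound_def using M c by (intro one_le_power) (simp add: le_divide_eq)

lemma sep: "c \<le> \<bar>l i - l j\<bar>" if "i \<in> idx" "j \<in> idx" "i \<noteq> j"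
  using gap[of i j] gap[of j i] that by (cases "i < j") (auto simp: abs_if)

lemma l_bound: "\<bar>l i\<bar> \<le> M" if "i \<in> idx"
  using A_bound[of "d i"] eig[OF that] unit[OF that] by simp

text \<open>An unnormalized Lagrange interpolation polynomial evaluated at \<open>A\<close>: for the
  list of all indices except \<open>i\<close> it is a nonzero multiple of the spectral projection
  onto \<open>d i\<close>.\<close>

fun kill :: "nat list \<Rightarrow> 'v \<Rightarrow> 'v" where
  "kill [] x = x"
| "kill (j # js) x = A (kill js x) - l j *\<^sub>R kill js x"

lemma linear_kill: "linear (kill js)"
proof (induction js)
  case Nil
  then show ?case by (simp add: linear_iff)
next
  case (Cons j js)
  then show ?case using lin by (simp add: linear_iff algebra_simps)
qed

lemma kill_eig: "i \<in> idx \<Longrightarrow> kill js (d i) = (\<Prod>j\<leftarrow>js. l i - l j) *\<^sub>R d i"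
  by (induction js) (simp_all add: linear_scale[OF lin] eig algebra_simps)

lemma kill_bound: "set js \<subseteq> idx \<Longrightarrow> norm (kill js x) \<le> (2 * M) ^ length js * norm x"
proof (induction js)
  case (Cons j js)
  have "norm (kill (j # js) x) \<le> norm (A (kill js x)) + \<bar>l j\<bar> * norm (kill js x)"
    using norm_triangle_ineq4[of "A (kill js x)" "l j *\<^sub>R kill js x"] by simp
  also have "\<dots> \<le> M * norm (kill js x) + M * norm (kill js x)"
    using A_bound l_bound[of j] Cons.prems by (intro add_mono mult_right_mono) auto
  also have "\<dots> = 2 * M * norm (kill js x)" by simp
  also have "\<dots> \<le> 2 * M * ((2 * M) ^ length js * norm x)"
    using Cons M c by (intro mult_left_mono) auto
  finally show ?case by (simp add: mult.assoc)
qed simp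

definition others :: "nat \<Rightarrow> nat list" where
  "others i = sorted_list_of_set (idx - {i})"

lemma set_others: "set (others i) = idx - {i}"
  by (simp add: others_def)

lemma length_others: "i \<in> idx \<Longrightarrow> length (others i) = p - 1"
  by (simp add: others_def)

definition scale :: "nat \<Rightarrow> real" where
  "scale i = (\<Prod>j\<leftarrow>others i. l i - l j)"

lemma scale_ge: "i \<in> idx \<Longrightarrow> c ^ (p - 1) \<le> \<bar>scale i\<bar>"
proof -
  have "c ^ length js \<le> \<bar>\<Prod>j\<leftarrow>js. l i - l j\<bar>" if "set js \<subseteq> idx - {i}" "i \<in> idx" for js
    using that
  proof (induction js)
    case (Cons j js)
    then show ?case using c sep[of i j] by (auto simp: abs_mult intro!: mult_mono)
  qed simp
  then show "i \<in> idx \<Longrightarrow> c ^ (p - 1) \<le> \<bar>scale i\<bar>"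
    using length_others[of i] set_others[of i] by (metis order_refl scale_def)
qed

lemma scale_nonzero: "i \<in> idx \<Longrightarrow> scale i \<noteq> 0"
  using scale_ge[of i] c zero_less_power[of c "p - 1"] by linarith

lemma kill_others: "i \<in> idx \<Longrightarrow> j \<in> idx \<Longrightarrow>
    kill (others i) (d j) = (if i = j then scale i *\<^sub>R d i else 0)"
  by (auto simp: kill_eig scale_def prod_list_zero_iff set_others)

text \<open>
  Using the polynomial \<open>\<Prod>\<^sub>j\<^sub>\<noteq>\<^sub>i (A - l\<^sub>j)\<close>, and not an abstract dual basis, gives a bound for the
  coordinates that depends on \<open>M\<close>, \<open>c\<close> and the dimension only.
\<close>

definition coord :: "nat \<Rightarrow> 'v \<Rightarrow> real" where
  "coord i x = (kill (others i) x \<bullet> d i) / scale i"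

lemma linear_coord: "linear (coord i)"
  using linear_kill[of "others i"]
  by (simp add: linear_iff coord_def inner_add_left add_divide_distrib)

lemma coord_d: "i \<in> idx \<Longrightarrow> j \<in> idx \<Longrightarrow> coord i (d j) = (if i = j then 1 else 0)"
  using unit scale_nonzero by (auto simp: coord_def kill_others dot_square_norm)

lemma coord_bound: "i \<in> idx \<Longrightarrow> \<bar>coord i x\<bar> \<le> bound * norm x"
proof -
  assume i: "i \<in> idx"
  have c': "0 < c ^ (p - 1)" using c by simp
  have "\<bar>kill (others i) x \<bullet> d i\<bar> \<le> norm (kill (others i) x)"
    using Cauchy_Schwarz_ineq2[of "kill (others i) x" "d i"] unit[OF i] by simp
  also have "\<dots> \<le> (2 * M) ^ (p - 1) * norm x"
    using kill_bound[of "others i" x] length_others[OF i] by (simp add: set_others)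
  finally have "\<bar>coord i x\<bar> \<le> (2 * M) ^ (p - 1) * norm x / \<bar>scale i\<bar>"
    by (simp add: coord_def divide_right_mono)
  also have "\<dots> \<le> (2 * M) ^ (p - 1) * norm x / c ^ (p - 1)"
    using scale_ge[OF i] c' M c scale_nonzero[OF i]
    by (intro divide_left_mono mult_pos_pos mult_nonneg_nonneg) auto
  finally show "\<bar>coord i x\<bar> \<le> bound * norm x" by (simp add: bound_def power_divide)
qed

lemma coord_sum: "i \<in> idx \<Longrightarrow> coord i (\<Sum>j\<in>idx. u j *\<^sub>R d j) = u i"
  by (simp add: linear_sum[OF linear_coord] linear_scale[OF linear_coord] coord_d
      if_distrib[where f = "(*) _"] cong: if_cong)

text \<open>The functionals \<open>coord i\<close> are dual to the vectors \<open>d i\<close>, which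
  are therefore independent; their number is the dimension, so they span.\<close>

lemma coord_expand: "(\<Sum>i\<in>idx. coord i x *\<^sub>R d i) = x"
proof -
  have inj: "inj_on d idx"
  proof (rule inj_onI)
    fix i j assume "i \<in> idx" "j \<in> idx" "d i = d j"
    then show "i = j" using coord_d[of i i] coord_d[of i j] by (auto split: if_splits)
  qed
  have "independent (d ` idx)"
  proof (rule independent_if_scalars_zero)
    fix f x assume "(\<Sum>x\<in>d ` idx. f x *\<^sub>R x) = 0" and "x \<in> d ` idx"
    then obtain i where i: "i \<in> idx" "x = d i" by blast
    have "(\<Sum>j\<in>idx. f (d j) *\<^sub>R d j) = 0"
      using \<open>(\<Sum>x\<in>d ` idx. f x *\<^sub>R x) = 0\<close> by (simp add: sum.reindex[OF inj])
    from arg_cong[OF this, of "coord i"] coord_sum[OF i(1), of "\<lambda>j. f (d j)"] i(2)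
    show "f x = 0" by (simp add: linear_0[OF linear_coord])
  qed simp
  moreover have "card (d ` idx) = DIM('v)" using inj by (simp add: card_image card_idx)
  ultimately have "span (d ` idx) = UNIV"
    using card_ge_dim_independent[of "d ` idx" UNIV] by auto
  then have "x \<in> range (\<lambda>f. \<Sum>v\<in>d ` idx. f v *\<^sub>R v)"
    by (simp add: span_finite[symmetric])
  then obtain f where "x = (\<Sum>v\<in>d ` idx. f v *\<^sub>R v)"
    by blast
  then have x: "x = (\<Sum>j\<in>idx. f (d j) *\<^sub>R d j)" by (simp add: sum.reindex[OF inj])
  have "coord i x = f (d i)" if "i \<in> idx" for i
    by (subst x) (rule coord_sum[OF that])
  then show ?thesis by (subst (2) x) simp
qed

lemma coord_A: "i \<in> idx \<Longrightarrow> coord i (A x) = l i * coord i x"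
proof -
  assume i: "i \<in> idx"
  have "A x = A (\<Sum>j\<in>idx. coord j x *\<^sub>R d j)" by (simp add: coord_expand)
  also have "\<dots> = (\<Sum>j\<in>idx. (l j * coord j x) *\<^sub>R d j)"
    by (simp add: linear_sum[OF lin] linear_scale[OF lin] eig mult.commute)
  finally show "coord i (A x) = l i * coord i x" using coord_sum[OF i] by simp
qed

lemma norm_le_sum_coord: "norm x \<le> (\<Sum>i\<in>idx. \<bar>coord i x\<bar>)"
proof -
  have "norm (\<Sum>i\<in>idx. coord i x *\<^sub>R d i) \<le> (\<Sum>i\<in>idx. norm (coord i x *\<^sub>R d i))"
    by (rule norm_sum)
  also have "\<dots> = (\<Sum>i\<in>idx. \<bar>coord i x\<bar>)" by (intro sum.cong) (auto simp: unit)
  finally show ?thesis by (simp add: coord_expand)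
qed

text \<open>In these coordinates \<open>A - \<mu>\<close> is multiplication by
  \<open>l i - \<mu>\<close>. A small residual thus leaves only coordinates whose eigenvalue is near
  \<open>\<mu>\<close>.\<close>

lemma coord_residual: "i \<in> idx \<Longrightarrow> \<bar>l i - \<mu>\<bar> * \<bar>coord i x\<bar> \<le> bound * norm (A x - \<mu> *\<^sub>R x)"
  using coord_bound[of i "A x - \<mu> *\<^sub>R x"]
  by (simp add: linear_diff[OF linear_coord] linear_scale[OF linear_coord] coord_A
      abs_mult[symmetric] left_diff_distrib)

text \<open>A Bauer-Fike type estimate. If every eigenvalue were farther away,
  \<open>coord_residual\<close> would make all coordinates so small that their sum falls short of
  the norm of \<open>x\<close>.\<close>

lemma approx_eigenvalue:
  assumes "x \<noteq> 0" "norm (A x - \<mu> *\<^sub>R x) \<le> \<epsilon> * norm x"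
  shows "\<exists>i\<in>idx. \<bar>l i - \<mu>\<bar> \<le> p * bound * \<epsilon>"
proof (rule ccontr)
  assume "\<not> ?thesis"
  then have far: "p * bound * \<epsilon> < \<bar>l i - \<mu>\<bar>" if "i \<in> idx" for i using that by force
  have "0 \<le> \<epsilon> * norm x"
    using assms(2) norm_ge_zero[of "A x - \<mu> *\<^sub>R x"] by linarith
  then have e: "0 \<le> \<epsilon>" using assms(1) by (simp add: zero_le_mult_iff)
  have B: "0 < bound" using bound_ge_1 by simp
  have ge: "(p * bound * \<epsilon>) * \<bar>coord i x\<bar> \<le> bound * (\<epsilon> * norm x)" if "i \<in> idx" for i
  proof -
    have "(p * bound * \<epsilon>) * \<bar>coord i x\<bar> \<le> \<bar>l i - \<mu>\<bar> * \<bar>coord i x\<bar>"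
      using far[OF that] by (intro mult_right_mono) auto
    also have "\<dots> \<le> bound * norm (A x - \<mu> *\<^sub>R x)" by (rule coord_residual[OF that])
    also have "\<dots> \<le> bound * (\<epsilon> * norm x)" using assms(2) B by (intro mult_left_mono) auto
    finally show ?thesis .
  qed
  obtain k where k: "k \<in> idx" "coord k x \<noteq> 0"
  proof (rule ccontr)
    assume "\<not> thesis"
    then have "(\<Sum>i\<in>idx. \<bar>coord i x\<bar>) = 0" using that by (intro sum.neutral) auto
    with norm_le_sum_coord[of x] assms(1) show False by simp
  qed
  \<comment> \<open>One nonzero coordinate supplies the strictness on which the contradiction
    depends.\<close>
  have strict: "(p * bound * \<epsilon>) * \<bar>coord k x\<bar> < bound * (\<epsilon> * norm x)"
  proof -
    have "(p * bound * \<epsilon>) * \<bar>coord k x\<bar> < \<bar>l k - \<mu>\<bar> * \<bar>coord k x\<bar>"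
      using far[OF k(1)] k(2) by (intro mult_strict_right_mono) auto
    also have "\<dots> \<le> bound * norm (A x - \<mu> *\<^sub>R x)" by (rule coord_residual[OF k(1)])
    also have "\<dots> \<le> bound * (\<epsilon> * norm x)" using assms(2) B by (intro mult_left_mono) auto
    finally show ?thesis .
  qed
  have "(p * bound * \<epsilon>) * norm x \<le> (p * bound * \<epsilon>) * (\<Sum>i\<in>idx. \<bar>coord i x\<bar>)"
    using norm_le_sum_coord[of x] e B by (intro mult_left_mono) auto
  also have "\<dots> = (\<Sum>i\<in>idx. (p * bound * \<epsilon>) * \<bar>coord i x\<bar>)" by (rule sum_distrib_left)
  also have "\<dots> < (\<Sum>i\<in>idx. bound * (\<epsilon> * norm x))"
    using ge strict k(1) by (intro sum_strict_mono_ex1 ballI bexI[of _ k]) auto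
  also have "\<dots> = (p * bound * \<epsilon>) * norm x" by simp
  finally show False by simp
qed

end

locale frozen_system =
  fixes F :: "'v::euclidean_space \<Rightarrow> 'v" and DF :: "'v \<Rightarrow> 'v \<Rightarrow> 'v"
    and lam :: "nat \<Rightarrow> 'v \<Rightarrow> real" and ev :: "nat \<Rightarrow> 'v \<Rightarrow> 'v" and M c \<delta> :: real and n :: nat
  assumes n: "n = DIM('v)"
    and F_deriv: "\<And>u. u \<in> cball 0 \<delta> \<Longrightarrow> (F has_derivative DF u) (at u within cball 0 \<delta>)"
    and DF_bound: "\<And>u w. u \<in> cball 0 \<delta> \<Longrightarrow> norm (DF u w) \<le> M * norm w"
    and DF_lip: "\<And>u v w. u \<in> cball 0 \<delta> \<Longrightarrow> v \<in> cball 0 \<delta> \<Longrightarrow>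
      norm (DF u w - DF v w) \<le> M * norm (u - v) * norm w"
    and eigen: "\<And>i u. i \<in> {1..n} \<Longrightarrow> u \<in> cball 0 \<delta> \<Longrightarrow> DF u (ev i u) = lam i u *\<^sub>R ev i u"
    and ev_nonzero: "\<And>i u. i \<in> {1..n} \<Longrightarrow> u \<in> cball 0 \<delta> \<Longrightarrow> ev i u \<noteq> 0"
    and lam_gap: "\<And>i u. i \<in> {1..<n} \<Longrightarrow> u \<in> cball 0 \<delta> \<Longrightarrow> c \<le> lam (Suc i) u - lam i u"
    and c_pos: "0 < c"
    and c_le: "c \<le> 2 * M"
    and \<delta>_nonneg: "0 \<le> \<delta>"
    and small: "4 * n * (2 * M / c) ^ (n - 1) * M * \<delta>
      * (1 + n * (2 * M / c) ^ (n - 1)) \<le> c"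
begin

declare One_nat_def [simp del]

abbreviation B :: "'v set" where
  "B \<equiv> cball 0 \<delta>"

lemma zero_in: "0 \<in> B"
  using \<delta>_nonneg by simp

lemma DF_linear: "u \<in> B \<Longrightarrow> linear (DF u)"
  using F_deriv by (blast intro: has_derivative_linear)

lemma M_pos: "0 < M"
  using c_pos c_le by simp

lemma lam_mono: "i \<in> {1..n} \<Longrightarrow> j \<in> {1..n} \<Longrightarrow> i < j \<Longrightarrow> u \<in> B \<Longrightarrow> c \<le> lam j u - lam i u"
proof (induction j)
  case (Suc j)
  have "c \<le> lam (Suc j) u - lam j u" using Suc.prems by (intro lam_gap) auto
  then show ?case using Suc c_pos by (cases "i = j") force+
qed simp

sublocale eigenbasis "DF 0" "\<lambda>i. lam i 0" "\<lambda>i. ev i 0 /\<^sub>R norm (ev i 0)" M c "{1..n}"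
proof
  show "DF 0 (ev i 0 /\<^sub>R norm (ev i 0)) = lam i 0 *\<^sub>R (ev i 0 /\<^sub>R norm (ev i 0))"
    if "i \<in> {1..n}" for i
    using eigen[OF that zero_in] by (simp add: linear_scale[OF DF_linear[OF zero_in]])
  show "norm (ev i 0 /\<^sub>R norm (ev i 0)) = 1" if "i \<in> {1..n}" for i
    using ev_nonzero[OF that zero_in] by simp
qed (use DF_bound[OF zero_in] lam_mono zero_in c_pos c_le n in
    \<open>auto simp: linear_add[OF DF_linear[OF zero_in]] linear_scale[OF DF_linear[OF zero_in]]\<close>)

abbreviation dim :: real where
  "dim \<equiv> real n"

text \<open>How far an eigenvalue can drift over the ball: \<open>DF u\<close> differs from
  \<open>DF 0\<close> by at most \<open>M * \<delta>\<close>, amplified by the factor in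
  \<open>approx_eigenvalue\<close>.\<close>

definition \<eta> :: real where
  "\<eta> = dim * bound * (M * \<delta>)"

text \<open>The relative residual of a wave direction as an eigenvector at the origin:
  \<open>M * \<delta>\<close> for replacing the flux by its linearization at 0,
  \<open>\<eta>\<close> for replacing the speed by \<open>lam i 0\<close>.\<close>

definition \<epsilon> :: real where
  "\<epsilon> = M * \<delta> + \<eta>"

text \<open>The aperture of the cone: the gap and \<open>coord_residual\<close> bound a transversal
  coordinate by \<open>bound * \<epsilon> / c\<close> times the norm, and the norm is at most twice
  the principal coordinate.\<close>

definition \<kappa> :: real where
  "\<kappa> = 2 * bound * \<epsilon> / c"

lemma bound_eq: "bound = (2 * M / c) ^ (n - 1)"
  by (simp add: bound_def)

lemma \<epsilon>_eq: "\<epsilon> = M * \<delta> * (1 + dim * bound)"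
  by (simp add: \<epsilon>_def \<eta>_def algebra_simps)

lemma dim_ge_1: "1 \<le> dim"
  using DIM_positive[where 'a = 'v] n by linarith

lemma \<eta>_nonneg: "0 \<le> \<eta>"
  using bound_ge_1 M_pos \<delta>_nonneg by (simp add: \<eta>_def)

lemma \<epsilon>_nonneg: "0 \<le> \<epsilon>"
  using \<eta>_nonneg M_pos \<delta>_nonneg by (simp add: \<epsilon>_def)

lemma \<kappa>_nonneg: "0 \<le> \<kappa>"
  using \<epsilon>_nonneg bound_ge_1 c_pos by (simp add: \<kappa>_def)

lemma small': "4 * dim * bound * \<epsilon> \<le> c"
  using small by (simp add: bound_eq \<epsilon>_eq mult.assoc)

text \<open>This is the diagonal dominance for which the assumption \<open>small\<close> was written
  down; that assumption is this inequality multiplied out.\<close>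

lemma dim_\<kappa>: "dim * \<kappa> \<le> 1 / 2"
  using small' c_pos by (simp add: \<kappa>_def field_simps)

lemma \<eta>_small: "2 * \<eta> < c"
proof -
  have d: "1 \<le> dim * bound" using dim_ge_1 bound_ge_1 by (metis mult_mono' mult_1 zero_le_one)
  have e: "\<eta> \<le> \<epsilon>" using M_pos \<delta>_nonneg by (simp add: \<epsilon>_def)
  have "4 * \<eta> \<le> 4 * (dim * bound * \<epsilon>)"
    using mult_right_mono[OF d \<epsilon>_nonneg] e by simp
  then have "4 * \<eta> \<le> c" using small' by (simp add: mult.assoc)
  then show ?thesis using c_pos \<eta>_nonneg by linarith
qed

text \<open>The vector \<open>ev i u\<close> is nearly an eigenvector of \<open>DF 0\<close>, so
  \<open>lam i u\<close> is within \<open>\<eta>\<close> of some eigenvalue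
  \<open>lam (j i) 0\<close>. As the gaps exceed \<open>2 * \<eta>\<close>, the map \<open>j\<close>
  is strictly increasing on \<open>{1..n}\<close>, and such a self-map is the identity.\<close>

lemma lam_close:
  assumes i: "i \<in> {1..n}" and u: "u \<in> B"
  shows "\<bar>lam i u - lam i 0\<bar> \<le> \<eta>"
proof -
  have "\<exists>j\<in>{1..n}. \<bar>lam j 0 - lam i u\<bar> \<le> \<eta>" if i: "i \<in> {1..n}" for i
  proof -
    have "norm (DF 0 (ev i u) - lam i u *\<^sub>R ev i u) = norm (DF 0 (ev i u) - DF u (ev i u))"
      using eigen[OF i u] by simp
    also have "\<dots> \<le> M * norm (0 - u) * norm (ev i u)" by (rule DF_lip[OF zero_in u])
    also have "\<dots> \<le> M * \<delta> * norm (ev i u)"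
      using u M_pos by (intro mult_right_mono mult_left_mono) auto
    finally show ?thesis
      using approx_eigenvalue[OF ev_nonzero[OF i u]] by (simp add: \<eta>_def)
  qed
  then obtain j where j: "\<And>i. i \<in> {1..n} \<Longrightarrow> j i \<in> {1..n}"
    and jl: "\<And>i. i \<in> {1..n} \<Longrightarrow> \<bar>lam (j i) 0 - lam i u\<bar> \<le> \<eta>"
    by metis
  have step: "j i < j (Suc i)" if "i \<in> {1..<n}" for i
  proof (rule ccontr)
    assume "\<not> ?thesis"
    then have "lam (j (Suc i)) 0 \<le> lam (j i) 0"
      using lam_mono[OF j j _ zero_in, of "Suc i" i] that c_pos
      by (cases "j i = j (Suc i)") auto
    moreover have "c \<le> lam (Suc i) u - lam i u" using that u by (intro lam_gap) auto
    ultimately show False using jl[of i] jl[of "Suc i"] that \<eta>_small by auto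
  qed
  have up: "i \<in> {1..n} \<Longrightarrow> i \<le> j i" for i
  proof (induction i)
    case (Suc i)
    show ?case
    proof (cases "i = 0")
      case True
      then show ?thesis using j[OF Suc.prems] by simp
    next
      case False
      then show ?thesis using Suc step[of i] by auto
    qed
  qed simp
  \<comment> \<open>The mirror image of \<open>up\<close>, as an induction downwards from the last
    index.\<close>
  have down: "k \<le> n - 1 \<Longrightarrow> j (n - k) \<le> n - k" for k
  proof (induction k)
    case 0
    show ?case using j[of "n"] DIM_positive[where 'a = 'v] n by (simp add: Suc_leI)
  next
    case (Suc k)
    have "Suc (n - Suc k) = n - k" using Suc.prems by simp
    then have "j (n - Suc k) < j (n - k)"
      using step[of "n - Suc k"] Suc.prems by auto
    then show ?case using Suc by simp
  qed
  have "j i = i" using up[OF i] down[of "n - i"] i by auto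
  then show ?thesis using jl[OF i] by (simp add: abs_minus_commute)
qed

text \<open>The mean value inequality for \<open>F - DF 0\<close>, whose derivative has size at most
  \<open>M * \<delta>\<close> in the ball.\<close>

lemma F_linearized:
  assumes "u \<in> B" "v \<in> B"
  shows "norm (F v - F u - DF 0 (v - u)) \<le> M * \<delta> * norm (v - u)"
proof -
  have "norm ((F v - DF 0 v) - (F u - DF 0 u)) \<le> M * \<delta> * norm (v - u)"
  proof (rule differentiable_bound[where S = B and f' = "\<lambda>u h. DF u h - DF 0 h"])
    show "((\<lambda>x. F x - DF 0 x) has_derivative (\<lambda>h. DF x h - DF 0 h)) (at x within B)" if "x \<in> B" for x
      by (intro has_derivative_diff F_deriv that linear_imp_has_derivative DF_linear zero_in)
    show "onorm (\<lambda>h. DF x h - DF 0 h) \<le> M * \<delta>" if "x \<in> B" for x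
    proof (rule onorm_le)
      fix h
      have "norm (DF x h - DF 0 h) \<le> M * norm (x - 0) * norm h" by (rule DF_lip[OF that zero_in])
      also have "\<dots> \<le> M * \<delta> * norm h" using that M_pos by (intro mult_right_mono mult_left_mono) auto
      finally show "norm (DF x h - DF 0 h) \<le> M * \<delta> * norm h" .
    qed
  qed (use assms in auto)
  then show ?thesis by (simp add: linear_diff[OF DF_linear[OF zero_in]] algebra_simps)
qed

text \<open>The directions of \<open>i\<close>-waves form a narrow cone around the \<open>i\<close>-th eigenvector at the origin.\<close>

definition in_cone :: "nat \<Rightarrow> 'v \<Rightarrow> bool" where
  "in_cone i w \<longleftrightarrow> norm w \<le> 2 * \<bar>coord i w\<bar> \<and>
     (\<forall>j\<in>{1..n} - {i}. \<bar>coord j w\<bar> \<le> \<kappa> * \<bar>coord i w\<bar>)"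

text \<open>By the gaps, the residual bounds every transversal coordinate by
  \<open>\<kappa> / 2\<close> times the norm. Their sum is at most half of the norm, so the
  principal coordinate carries the other half.\<close>

lemma in_coneI:
  assumes i: "i \<in> {1..n}" and w: "norm (DF 0 w - lam i 0 *\<^sub>R w) \<le> \<epsilon> * norm w"
  shows "in_cone i w"
proof -
  have off: "\<bar>coord j w\<bar> \<le> bound * \<epsilon> / c * norm w" if j: "j \<in> {1..n} - {i}" for j
  proof -
    have "c * \<bar>coord j w\<bar> \<le> \<bar>lam j 0 - lam i 0\<bar> * \<bar>coord j w\<bar>"
      using sep[of j i] i j by (intro mult_right_mono) auto
    also have "\<dots> \<le> bound * norm (DF 0 w - lam i 0 *\<^sub>R w)" using j by (intro coord_residual) auto
    also have "\<dots> \<le> bound * (\<epsilon> * norm w)" using w bound_ge_1 by (intro mult_left_mono) auto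
    finally show ?thesis using c_pos by (simp add: field_simps)
  qed
  have half: "bound * \<epsilon> / c * norm w = \<kappa> / 2 * norm w" by (simp add: \<kappa>_def)
  have off': "\<bar>coord j w\<bar> \<le> \<kappa> / 2 * norm w" if "j \<in> {1..n} - {i}" for j
    using off[OF that] half by linarith
  have "norm w \<le> (\<Sum>j\<in>{1..n}. \<bar>coord j w\<bar>)" by (rule norm_le_sum_coord)
  also have "\<dots> = \<bar>coord i w\<bar> + (\<Sum>j\<in>{1..n} - {i}. \<bar>coord j w\<bar>)"
    using i by (intro sum.remove) auto
  also have "\<dots> \<le> \<bar>coord i w\<bar> + (\<Sum>j\<in>{1..n} - {i}. \<kappa> / 2 * norm w)"
    using off' by (intro add_left_mono sum_mono) auto
  also have "\<dots> \<le> \<bar>coord i w\<bar> + dim * (\<kappa> / 2 * norm w)"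
    using \<kappa>_nonneg i by (intro add_left_mono) (auto intro!: mult_right_mono)
  also have "\<dots> \<le> \<bar>coord i w\<bar> + norm w / 2"
  proof -
    have "dim * (\<kappa> / 2 * norm w) = dim * \<kappa> * norm w / 2" by simp
    with mult_right_mono[OF dim_\<kappa> norm_ge_zero[of w]] norm_ge_zero[of w] show ?thesis by linarith
  qed
  finally have nw: "norm w \<le> 2 * \<bar>coord i w\<bar>" by simp
  moreover have "\<bar>coord j w\<bar> \<le> \<kappa> * \<bar>coord i w\<bar>" if "j \<in> {1..n} - {i}" for j
    using off'[OF that] mult_left_mono[OF nw, of "\<kappa> / 2"] \<kappa>_nonneg by simp
  ultimately show ?thesis by (simp add: in_cone_def)
qed

text \<open>Rankine-Hugoniot says that \<open>v - u\<close> is an eigenvector of an averaged matrix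
  with eigenvalue \<open>\<sigma>\<close>. Lax shocks and contacts alike have
  \<open>\<sigma>\<close> between the two characteristic speeds, hence within \<open>\<eta>\<close>
  of \<open>lam i 0\<close>.\<close>

lemma jump_in_cone:
  assumes i: "i \<in> {1..n}" and uv: "u \<in> B" "v \<in> B"
    and rh: "F v - F u = \<sigma> *\<^sub>R (v - u)"
    and \<sigma>: "min (lam i u) (lam i v) \<le> \<sigma>" "\<sigma> \<le> max (lam i u) (lam i v)"
  shows "in_cone i (v - u)"
proof (rule in_coneI[OF i])
  have "\<bar>\<sigma> - lam i 0\<bar> \<le> \<eta>"
    using lam_close[OF i uv(1)] lam_close[OF i uv(2)] \<sigma> by linarith
  then have "norm ((\<sigma> - lam i 0) *\<^sub>R (v - u)) \<le> \<eta> * norm (v - u)"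
    by (simp add: mult_right_mono)
  then have "norm ((\<sigma> - lam i 0) *\<^sub>R (v - u) - (F v - F u - DF 0 (v - u))) \<le> \<epsilon> * norm (v - u)"
    using F_linearized[OF uv] norm_triangle_ineq4[of "(\<sigma> - lam i 0) *\<^sub>R (v - u)" "F v - F u - DF 0 (v - u)"]
    unfolding \<epsilon>_def distrib_right by linarith
  then show "norm (DF 0 (v - u) - lam i 0 *\<^sub>R (v - u)) \<le> \<epsilon> * norm (v - u)"
    unfolding rh by (simp add: scaleR_left_diff_distrib)
qed

text \<open>
  Along a rarefaction the \<open>i\<close>-th coordinate has a nonvanishing derivative, hence is monotone;
  this excludes cancellations and bounds the variation by the increment.
\<close>

lemma rarefaction_cone:
  assumes i: "i \<in> {1..n}" and ab: "a < b"
    and WB: "\<And>\<xi>. \<xi> \<in> {a..b} \<Longrightarrow> W \<xi> \<in> B"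
    and W': "\<And>\<xi>. \<xi> \<in> {a..b} \<Longrightarrow> (W has_vector_derivative W' \<xi>) (at \<xi> within {a..b})"
    and nz: "\<And>\<xi>. \<xi> \<in> {a..b} \<Longrightarrow> W' \<xi> \<noteq> 0"
    and ode: "\<And>\<xi>. \<xi> \<in> {a..b} \<Longrightarrow> DF (W \<xi>) (W' \<xi>) = \<xi> *\<^sub>R W' \<xi>"
    and speed: "\<And>\<xi>. \<xi> \<in> {a..b} \<Longrightarrow> lam i (W \<xi>) = \<xi>"
  obtains s :: real where "\<bar>s\<bar> = 1"
    and "\<And>x y. a \<le> x \<Longrightarrow> x \<le> y \<Longrightarrow> y \<le> b \<Longrightarrow>
      norm (W y - W x) \<le> 2 * (s * (coord i (W y) - coord i (W x)))"
    and "\<And>x y j. a \<le> x \<Longrightarrow> x \<le> y \<Longrightarrow> y \<le> b \<Longrightarrow> j \<in> {1..n} - {i} \<Longrightarrow>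
      \<bar>coord j (W y) - coord j (W x)\<bar> \<le> \<kappa> * (s * (coord i (W y) - coord i (W x)))"
    and "\<And>x y. a \<le> x \<Longrightarrow> x \<le> y \<Longrightarrow> y \<le> b \<Longrightarrow>
      norm (F (W y) - F (W x) - y *\<^sub>R (W y - W x)) \<le> (y - x) * (2 * (s * (coord i (W y) - coord i (W x))))"
proof -
  let ?g = "\<lambda>\<xi>. coord i (W \<xi>)"
  have coord': "((\<lambda>\<xi>. coord j (W \<xi>)) has_vector_derivative coord j (W' \<xi>)) (at \<xi> within {a..b})"
    if "\<xi> \<in> {a..b}" for j \<xi>
    by (rule bounded_linear.has_vector_derivative[OF _ W'[OF that]])
      (rule linear_coord[unfolded linear_conv_bounded_linear])
  have FW': "((\<lambda>\<xi>. F (W \<xi>)) has_vector_derivative \<xi> *\<^sub>R W' \<xi>) (at \<xi> within {a..b})"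
    if \<xi>: "\<xi> \<in> {a..b}" for \<xi>
  proof -
    have "(F has_derivative DF (W \<xi>)) (at (W \<xi>) within W ` {a..b})"
      by (rule has_derivative_subset[OF F_deriv]) (use WB \<xi> in auto)
    from has_derivative_in_compose[OF W'[OF \<xi>, unfolded has_vector_derivative_def] this]
    show ?thesis
      using WB[OF \<xi>] by (simp add: has_vector_derivative_def linear_scale[OF DF_linear] ode[OF \<xi>])
  qed
  have cone: "in_cone i (W' \<xi>)" if \<xi>: "\<xi> \<in> {a..b}" for \<xi>
  proof (rule in_coneI[OF i])
    have "norm (DF (W \<xi>) (W' \<xi>) - DF 0 (W' \<xi>)) \<le> M * norm (W \<xi> - 0) * norm (W' \<xi>)"
      by (rule DF_lip[OF WB[OF \<xi>] zero_in])
    also have "\<dots> \<le> M * \<delta> * norm (W' \<xi>)"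
      using WB[OF \<xi>] M_pos by (intro mult_right_mono mult_left_mono) auto
    finally have "norm (DF (W \<xi>) (W' \<xi>) - DF 0 (W' \<xi>)) \<le> M * \<delta> * norm (W' \<xi>)" .
    moreover have "norm ((\<xi> - lam i 0) *\<^sub>R W' \<xi>) \<le> \<eta> * norm (W' \<xi>)"
      using lam_close[OF i WB[OF \<xi>]] speed[OF \<xi>] by (simp add: mult_right_mono)
    ultimately have "norm ((\<xi> - lam i 0) *\<^sub>R W' \<xi> - (DF (W \<xi>) (W' \<xi>) - DF 0 (W' \<xi>))) \<le> \<epsilon> * norm (W' \<xi>)"
      using norm_triangle_ineq4[of "(\<xi> - lam i 0) *\<^sub>R W' \<xi>" "DF (W \<xi>) (W' \<xi>) - DF 0 (W' \<xi>)"]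
      unfolding \<epsilon>_def distrib_right by linarith
    then show "norm (DF 0 (W' \<xi>) - lam i 0 *\<^sub>R W' \<xi>) \<le> \<epsilon> * norm (W' \<xi>)"
      unfolding ode[OF \<xi>] by (simp add: scaleR_left_diff_distrib)
  qed
  have g_nz: "coord i (W' \<xi>) \<noteq> 0" if "\<xi> \<in> {a..b}" for \<xi>
    using cone[OF that] nz[OF that] by (auto simp: in_cone_def)
  have cont: "continuous_on {a..b} ?g"
    by (rule continuous_on_vector_derivative[OF coord'])
  have at: "at \<xi> within {a..b} = at \<xi>" if "a < \<xi>" "\<xi> < b" for \<xi>
    using that by (rule at_within_Icc_at)
  have g_deriv: "(?g has_real_derivative coord i (W' \<xi>)) (at \<xi>)" if "a < \<xi>" "\<xi> < b" for \<xi>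
    using coord'[of \<xi> i] that by (simp add: at has_real_derivative_iff_has_vector_derivative)
  \<comment> \<open>The derivative is nonzero but not known to be continuous, so its sign cannot be
    followed directly. Rolle's theorem gives injectivity, and a continuous injective function on an
    interval is strictly monotone.\<close>
  have "inj_on ?g {a..b}"
  proof (rule linorder_inj_onI')
    fix x y assume xy: "x \<in> {a..b}" "y \<in> {a..b}" "x < y"
    show "?g x \<noteq> ?g y"
    proof
      assume "?g x = ?g y"
      then obtain z where "x < z" "z < y" "(\<lambda>h. coord i (W' z) * h) = (\<lambda>h. 0)"
        using Rolle_deriv[of x y ?g "\<lambda>z h. coord i (W' z) * h"] xy
          continuous_on_subset[OF cont, of "{x..y}"] g_deriv
        by (fastforce simp: has_field_derivative_def)
      then show False using g_nz[of z] xy by (auto dest: fun_cong[of _ _ 1])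
    qed
  qed
  then have mono: "strict_mono_on {a..b} ?g \<or> strict_antimono_on {a..b} ?g"
    using injective_eq_monotone_map[of "{a..b}" ?g] cont by (simp add: is_interval_cc)
  obtain s :: real where s: "\<bar>s\<bar> = 1"
    and pos: "\<And>\<xi>. a < \<xi> \<Longrightarrow> \<xi> < b \<Longrightarrow> \<bar>coord i (W' \<xi>)\<bar> = s * coord i (W' \<xi>)"
  proof (cases "strict_mono_on {a..b} ?g")
    case True
    have "0 \<le> coord i (W' \<xi>)" if "a < \<xi>" "\<xi> < b" for \<xi>
      using mono_on_imp_deriv_nonneg[OF strict_mono_on_imp_mono_on[OF True] g_deriv[OF that]] that
      by (simp add: interior_atLeastAtMost_real)
    then show ?thesis by (intro that[of 1]) auto
  next
    case False
    with mono have "mono_on {a..b} (\<lambda>\<xi>. - ?g \<xi>)"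
      by (auto simp: monotone_on_def le_less)
    from mono_on_imp_deriv_nonneg[OF this DERIV_minus[OF g_deriv]]
    have "0 \<le> - coord i (W' \<xi>)" if "a < \<xi>" "\<xi> < b" for \<xi>
      using that by (simp add: interior_atLeastAtMost_real)
    then show ?thesis by (intro that[of "- 1"]) auto
  qed
  \<comment> \<open>The comparison function \<open>C * (s * ?g)\<close> has derivative
    \<open>C * \<bar>coord i (W' \<xi>)\<bar>\<close>, so a pointwise bound by the principal
    coordinate integrates to a bound by its increment.\<close>
  have bound: "norm (f y - f x) \<le> C * (s * (?g y - ?g x))"
    if xy: "a \<le> x" "x \<le> y" "y \<le> b"
      and f: "\<And>\<xi>. \<xi> \<in> {a..b} \<Longrightarrow> (f has_vector_derivative f' \<xi>) (at \<xi> within {a..b})"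
      and le: "\<And>\<xi>. x < \<xi> \<Longrightarrow> \<xi> < y \<Longrightarrow> norm (f' \<xi>) \<le> C * \<bar>coord i (W' \<xi>)\<bar>"
    for f f' :: "real \<Rightarrow> 'c::real_normed_vector" and C x y
  proof (cases "x = y")
    case False
    have "norm (f y - f x) \<le> C * (s * ?g y) - C * (s * ?g x)"
    proof (rule differentiable_bound_general[where f' = f' and \<phi>' = "\<lambda>\<xi>. C * (s * coord i (W' \<xi>))"])
      show "continuous_on {x..y} f"
        by (rule continuous_on_subset[OF continuous_on_vector_derivative[OF f]]) (use xy in auto)
      show "continuous_on {x..y} (\<lambda>y. C * (s * ?g y))"
        using xy by (intro continuous_intros continuous_on_subset[OF cont]) auto
      fix \<xi> assume \<xi>: "x < \<xi>" "\<xi> < y"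
      show "(f has_vector_derivative f' \<xi>) (at \<xi>)"
        using f[of \<xi>] \<xi> xy by (simp add: at)
      show "((\<lambda>y. C * (s * ?g y)) has_vector_derivative C * (s * coord i (W' \<xi>))) (at \<xi>)"
        using g_deriv[of \<xi>] \<xi> xy
        by (auto simp: has_real_derivative_iff_has_vector_derivative[symmetric] intro!: DERIV_cmult)
      show "norm (f' \<xi>) \<le> C * (s * coord i (W' \<xi>))"
        using le[OF \<xi>] pos[of \<xi>] \<xi> xy by simp
    qed (use xy False in auto)
    then show ?thesis by (simp add: algebra_simps)
  qed simp
  show ?thesis
  proof (rule that[OF s])
    fix x y assume xy: "a \<le> x" "x \<le> y" "y \<le> b"
    show "norm (W y - W x) \<le> 2 * (s * (?g y - ?g x))"
      by (rule bound[OF xy W']) (use cone xy in \<open>auto simp: in_cone_def\<close>)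
    show "\<bar>coord j (W y) - coord j (W x)\<bar> \<le> \<kappa> * (s * (?g y - ?g x))" if "j \<in> {1..n} - {i}" for j
      using bound[OF xy coord', of j \<kappa>] cone that xy by (auto simp: in_cone_def)
    \<comment> \<open>With the speed fixed at the right end \<open>y\<close>, the derivative of
      \<open>q\<close> is \<open>(\<xi> - y)\<close> times \<open>W'\<close>. The defect of a single
      jump thus gains the factor \<open>y - x\<close>, which vanishes under refinement.\<close>
    define q where "q \<xi> = F (W \<xi>) - y *\<^sub>R W \<xi>" for \<xi>
    define q' where "q' \<xi> = \<xi> *\<^sub>R W' \<xi> - y *\<^sub>R W' \<xi>" for \<xi>
    have "norm (q y - q x) \<le> (2 * (y - x)) * (s * (?g y - ?g x))"
    proof (rule bound[OF xy])
      show "(q has_vector_derivative q' \<xi>) (at \<xi> within {a..b})" if "\<xi> \<in> {a..b}" for \<xi>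
        unfolding q_def[abs_def] q'_def
        by (intro has_vector_derivative_diff FW'[OF that]
            bounded_linear.has_vector_derivative[OF bounded_linear_scaleR_right W'[OF that]])
      show "norm (q' \<xi>) \<le> 2 * (y - x) * \<bar>coord i (W' \<xi>)\<bar>" if "x < \<xi>" "\<xi> < y" for \<xi>
      proof -
        have "norm (\<xi> *\<^sub>R W' \<xi> - y *\<^sub>R W' \<xi>) = (y - \<xi>) * norm (W' \<xi>)"
          using that by (simp add: scaleR_left_diff_distrib[symmetric])
        also have "\<dots> \<le> (y - x) * (2 * \<bar>coord i (W' \<xi>)\<bar>)"
          using that cone[of \<xi>] xy by (intro mult_mono) (auto simp: in_cone_def)
        finally show ?thesis unfolding q'_def mult.assoc by (simp only: mult_ac)
      qed
    qed
    then show "norm (F (W y) - F (W x) - y *\<^sub>R (W y - W x)) \<le> (y - x) * (2 * (s * (?g y - ?g x)))"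
      by (simp add: q_def algebra_simps)
  qed
qed

text \<open>The \<open>j\<close>-th coordinate of the sum is that of \<open>w j\<close> up to
  \<open>\<kappa>\<close> times the total strength. Summation over \<open>j\<close> costs
  \<open>dim * \<kappa>\<close>, at most one half, which is absorbed on the left.\<close>

lemma sum_in_cone:
  assumes w: "\<And>i. i \<in> {1..n} \<Longrightarrow> in_cone i (w i)"
  shows "(\<Sum>i\<in>{1..n}. \<bar>coord i (w i)\<bar>) \<le> 2 * dim * bound * norm (\<Sum>i\<in>{1..n}. w i)"
proof -
  let ?I = "{1..n}" and ?d = "\<Sum>i\<in>{1..n}. w i"
  let ?Z = "\<Sum>i\<in>{1..n}. \<bar>coord i (w i)\<bar>"
  have row: "\<bar>coord j (w j)\<bar> \<le> bound * norm ?d + \<kappa> * ?Z" if j: "j \<in> ?I" for j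
  proof -
    have "coord j ?d = (\<Sum>i\<in>?I. coord j (w i))" by (rule linear_sum[OF linear_coord])
    also have "\<dots> = coord j (w j) + (\<Sum>i\<in>?I - {j}. coord j (w i))"
      using j by (intro sum.remove) auto
    finally have "\<bar>coord j (w j)\<bar> \<le> \<bar>coord j ?d\<bar> + \<bar>\<Sum>i\<in>?I - {j}. coord j (w i)\<bar>" by linarith
    also have "\<dots> \<le> bound * norm ?d + (\<Sum>i\<in>?I - {j}. \<bar>coord j (w i)\<bar>)"
      using j by (intro add_mono coord_bound sum_abs) auto
    also have "\<dots> \<le> bound * norm ?d + (\<Sum>i\<in>?I - {j}. \<kappa> * \<bar>coord i (w i)\<bar>)"
      using w j by (intro add_left_mono sum_mono) (auto simp: in_cone_def)
    also have "\<dots> \<le> bound * norm ?d + (\<Sum>i\<in>?I. \<kappa> * \<bar>coord i (w i)\<bar>)"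
      using \<kappa>_nonneg by (intro add_left_mono sum_mono2) auto
    finally show ?thesis by (simp add: sum_distrib_left)
  qed
  have "?Z \<le> (\<Sum>j\<in>?I. bound * norm ?d + \<kappa> * ?Z)" by (rule sum_mono[OF row])
  also have "\<dots> = dim * bound * norm ?d + (dim * \<kappa>) * ?Z" by (simp add: algebra_simps)
  also have "\<dots> \<le> dim * bound * norm ?d + 1 / 2 * ?Z"
    using dim_\<kappa> by (intro add_left_mono mult_right_mono sum_nonneg) auto
  finally show ?thesis by simp
qed

end

section \<open>Gluing step approximations of consecutive waves\<close>

lemma last_val_append: "last_val u (xs @ ys) = last_val (last_val u xs) ys"
  by (induction u xs rule: last_val.induct) auto

lemma variation_append: "variation u (xs @ ys) = variation u xs + variation (last_val u xs) ys"
  by (induction u xs rule: last_val.induct) auto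

lemma rh_defect_append: "rh_defect F u (xs @ ys) = rh_defect F u xs + rh_defect F (last_val u xs) ys"
  by (induction u xs rule: last_val.induct) auto

lemma step_val_append:
  "step_val u (xs @ ys) \<tau> y =
    (if \<exists>\<sigma>\<in>fst ` set xs. y \<le> \<sigma> * \<tau> then step_val u xs \<tau> y else step_val (last_val u xs) ys \<tau> y)"
  by (induction u xs rule: last_val.induct) auto

text \<open>The profile is compared at unit time, where position and speed coincide. Bounding the
  defect by \<open>e * V\<close> lets both budgets add up under concatenation, with the same
  \<open>e\<close> for any number of pieces.\<close>

definition fan_approx ::
  "(real \<Rightarrow> 'v::real_normed_vector) \<Rightarrow> ('v \<Rightarrow> 'v) \<Rightarrow> 'v set \<Rightarrow> real \<Rightarrow> real \<Rightarrow> 'v \<Rightarrow> real \<Rightarrow> 'v \<Rightarrow> real \<Rightarrow> bool" where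
  "fan_approx W F G e a um b up V \<longleftrightarrow>
     (\<exists>xs. um \<in> G \<and> snd ` set xs \<subseteq> G \<and> sorted (map fst xs) \<and> fst ` set xs \<subseteq> {a..b} \<and>
       last_val um xs = up \<and> variation um xs \<le> V \<and> rh_defect F um xs \<le> e * V \<and>
       (\<exists>E. finite E \<and> (\<forall>\<xi>\<in>{a..b} - E. norm (W \<xi> - step_val um xs 1 \<xi>) \<le> e)))"

lemma fan_approx_mono:
  assumes "fan_approx W F G e a um b up V" "V \<le> V'" "0 \<le> e"
  shows "fan_approx W F G e a um b up V'"
proof -
  have "e * V \<le> e * V'" using assms by (intro mult_left_mono)
  moreover obtain xs where xs: "um \<in> G" "snd ` set xs \<subseteq> G" "sorted (map fst xs)"
    "fst ` set xs \<subseteq> {a..b}" "last_val um xs = up" "variation um xs \<le> V" "rh_defect F um xs \<le> e * V"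
    "\<exists>E. finite E \<and> (\<forall>\<xi>\<in>{a..b} - E. norm (W \<xi> - step_val um xs 1 \<xi>) \<le> e)"
    using assms(1) unfolding fan_approx_def by blast
  ultimately have "variation um xs \<le> V'" "rh_defect F um xs \<le> e * V'" using assms(2) by linarith+
  with xs show ?thesis unfolding fan_approx_def by blast
qed

text \<open>The endpoints are excepted because the values of \<open>W\<close> there belong to the
  adjacent waves.\<close>

lemma fan_approx_constant:
  assumes "u \<in> G" "\<And>\<xi>. \<xi> \<in> {a<..<b} \<Longrightarrow> W \<xi> = u" "0 \<le> e"
  shows "fan_approx W F G e a u b u 0"
proof -
  have "W \<xi> = u" if "\<xi> \<in> {a..b} - {a, b}" for \<xi>
    using that by (intro assms(2)) auto
  then show ?thesis
    unfolding fan_approx_def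
    by (intro exI[of _ "[]"] conjI exI[of _ "{a, b}"]) (use assms(1,3) in auto)
qed

text \<open>The interval degenerates to the speed of the jump, and this one point is exceptional, so
  nothing is asked of \<open>W\<close>; the defect is 0.\<close>

lemma fan_approx_jump:
  assumes "um \<in> G" "up \<in> G" "F up - F um = \<sigma> *\<^sub>R (up - um)" "0 \<le> e"
  shows "fan_approx W F G e \<sigma> um \<sigma> up (norm (up - um))"
  unfolding fan_approx_def
  by (rule exI[of _ "[(\<sigma>, up)]"], safe intro!: exI[of _ "{\<sigma>}"]) (use assms in auto)

lemma fan_approx_trans:
  assumes 1: "fan_approx W F G e a u b v V1" and 2: "fan_approx W F G e b v c w V2"
    and "a \<le> b" "b \<le> c"
  shows "fan_approx W F G e a u c w (V1 + V2)"
proof -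
  obtain xs E where xs: "u \<in> G" "snd ` set xs \<subseteq> G" "sorted (map fst xs)" "fst ` set xs \<subseteq> {a..b}"
    "last_val u xs = v" "variation u xs \<le> V1" "rh_defect F u xs \<le> e * V1"
    and E: "finite E" "\<forall>\<xi>\<in>{a..b} - E. norm (W \<xi> - step_val u xs 1 \<xi>) \<le> e"
    using 1 unfolding fan_approx_def by blast
  obtain ys E' where ys: "v \<in> G" "snd ` set ys \<subseteq> G" "sorted (map fst ys)" "fst ` set ys \<subseteq> {b..c}"
    "last_val v ys = w" "variation v ys \<le> V2" "rh_defect F v ys \<le> e * V2"
    and E': "finite E'" "\<forall>\<xi>\<in>{b..c} - E'. norm (W \<xi> - step_val v ys 1 \<xi>) \<le> e"
    using 2 unfolding fan_approx_def by blast
  \<comment> \<open>A ray is counted with its left side, so the second list still shows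
    \<open>v\<close> at \<open>b\<close>, even if it jumps there.\<close>
  have left: "step_val u (xs @ ys) 1 \<xi> = step_val u xs 1 \<xi>" if "\<xi> \<le> b" for \<xi>
  proof (cases "\<exists>\<sigma>\<in>fst ` set xs. \<xi> \<le> \<sigma>")
    case False
    have "step_val v ys 1 \<xi> = v"
      using ys(4) that by (intro step_val_left[where \<sigma> = b]) auto
    moreover have "step_val u xs 1 \<xi> = v"
      using False by (subst step_val_right) (auto simp: xs(5) not_le)
    ultimately show ?thesis using False by (simp add: step_val_append xs(5))
  qed (simp add: step_val_append)
  have right: "step_val u (xs @ ys) 1 \<xi> = step_val v ys 1 \<xi>" if "b < \<xi>" for \<xi>
  proof -
    have "\<not> (\<exists>\<sigma>\<in>fst ` set xs. \<xi> \<le> \<sigma> * 1)" using xs(4) that by force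
    then show ?thesis by (simp only: step_val_append xs(5) if_False)
  qed
  have srt: "sorted (map fst (xs @ ys))"
    using xs(3,4) ys(3,4) by (fastforce simp: sorted_append)
  have close: "norm (W \<xi> - step_val u (xs @ ys) 1 \<xi>) \<le> e" if "\<xi> \<in> {a..c} - (E \<union> E')" for \<xi>
    using that E(2) E'(2) by (cases "\<xi> \<le> b") (auto simp: left right)
  show ?thesis
    unfolding fan_approx_def
  proof (intro exI[of _ "xs @ ys"] conjI exI[of _ "E \<union> E'"] ballI)
    show "fst ` set (xs @ ys) \<subseteq> {a..c}" using xs(4) ys(4) assms(3,4) by force
  qed (use xs ys E(1) E'(1) srt close in
      \<open>auto simp: last_val_append variation_append rh_defect_append distrib_left intro: add_mono\<close>)
qed

text \<open>By bisection it suffices to approximate a rarefaction on short intervals, where one jump does.\<close>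

lemma fan_approx_continuous:
  fixes W :: "real \<Rightarrow> 'v::real_normed_vector" and g :: "real \<Rightarrow> real"
  assumes ab: "a \<le> b" and e: "0 < e" and cont: "continuous_on {a..b} W"
    and WG: "\<And>\<xi>. \<xi> \<in> {a..b} \<Longrightarrow> W \<xi> \<in> G"
    and var: "\<And>x y. a \<le> x \<Longrightarrow> x \<le> y \<Longrightarrow> y \<le> b \<Longrightarrow> norm (W y - W x) \<le> g y - g x"
    and rh: "\<And>x y. a \<le> x \<Longrightarrow> x \<le> y \<Longrightarrow> y \<le> b \<Longrightarrow>
      norm (F (W y) - F (W x) - y *\<^sub>R (W y - W x)) \<le> (y - x) * (g y - g x)"
  shows "fan_approx W F G e a (W a) b (W b) (g b - g a)"
proof -
  have "a \<le> a \<and> a \<le> b \<and> b \<le> b \<longrightarrow> fan_approx W F G e a (W a) b (W b) (g b - g a)"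
  proof (rule Bolzano[OF ab, where
        P = "\<lambda>x y. a \<le> x \<and> x \<le> y \<and> y \<le> b \<longrightarrow> fan_approx W F G e x (W x) y (W y) (g y - g x)"])
    fix x y z
    assume xy: "a \<le> x \<and> x \<le> y \<and> y \<le> b \<longrightarrow> fan_approx W F G e x (W x) y (W y) (g y - g x)"
      and yz: "a \<le> y \<and> y \<le> z \<and> z \<le> b \<longrightarrow> fan_approx W F G e y (W y) z (W z) (g z - g y)"
      and le: "x \<le> y" "y \<le> z"
    show "a \<le> x \<and> x \<le> z \<and> z \<le> b \<longrightarrow> fan_approx W F G e x (W x) z (W z) (g z - g x)"
    proof
      assume "a \<le> x \<and> x \<le> z \<and> z \<le> b"
      with xy yz le show "fan_approx W F G e x (W x) z (W z) (g z - g x)"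
        using fan_approx_trans[of W F G e x "W x" y "W y" "g y - g x" z "W z" "g z - g y"] by simp
    qed
  next
    fix x assume x: "a \<le> x" "x \<le> b"
    obtain d where d: "0 < d" "\<And>\<xi>. \<xi> \<in> {a..b} \<Longrightarrow> dist \<xi> x < d \<Longrightarrow> dist (W \<xi>) (W x) < e / 2"
      using cont[unfolded continuous_on_iff, rule_format, of x "e / 2"] x e by auto
    have "fan_approx W F G e l (W l) u (W u) (g u - g l)"
      if lu: "l \<le> x" "x \<le> u" "u - l < min d e" "a \<le> l" "u \<le> b" for l u
    proof -
      have close: "norm (W \<xi> - W l) \<le> e" if "\<xi> \<in> {l..u}" for \<xi>
      proof -
        have "\<xi> \<in> {a..b}" "dist \<xi> x < d" "l \<in> {a..b}" "dist l x < d"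
          using that lu x by (auto simp: dist_real_def)
        then have "dist (W \<xi>) (W x) < e / 2" "dist (W l) (W x) < e / 2"
          using d(2) by auto
        then have "dist (W \<xi>) (W l) < e"
          using dist_triangle_half_r[of "W x" "W \<xi>" e "W l"] by (simp add: dist_commute)
        then show ?thesis by (simp add: dist_norm)
      qed
      have "norm (F (W u) - F (W l) - u *\<^sub>R (W u - W l)) \<le> (u - l) * (g u - g l)"
        using rh[of l u] lu by simp
      also have "\<dots> \<le> e * (g u - g l)"
        using lu var[of l u] norm_ge_zero[of "W u - W l"] by (intro mult_right_mono) linarith+
      finally have rh': "norm (F (W u) - F (W l) - u *\<^sub>R (W u - W l)) \<le> e * (g u - g l)" .
      \<comment> \<open>The jump sits at the right end \<open>u\<close>, with speed
        \<open>u\<close>: the step function is then \<open>W l\<close> on all of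
        \<open>{l..u}\<close>, and \<open>rh\<close> is stated for exactly this speed.\<close>
      show ?thesis
        unfolding fan_approx_def
        by (rule exI[of _ "[(u, W u)]"], safe intro!: exI[of _ "{}"])
          (use WG lu rh' close var[of l u] in auto)
    qed
    then show "\<exists>d>0. \<forall>l u. l \<le> x \<and> x \<le> u \<and> u - l < d \<longrightarrow>
        (a \<le> l \<and> l \<le> u \<and> u \<le> b \<longrightarrow> fan_approx W F G e l (W l) u (W u) (g u - g l))"
      using d(1) e by (intro exI[of _ "min d e"]) auto
  qed
  then show ?thesis using ab by simp
qed

section \<open>Variation of a whole Riemann fan\<close>

context frozen_system
begin

text \<open>Waves of zero strength, shocks and contacts share the first alternative. A rarefaction
  is kept only as a curve of nonzero eigenvectors, independent of the normalization of
  \<open>rv\<close>.\<close>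

definition wave :: "(real \<Rightarrow> 'v) \<Rightarrow> nat \<Rightarrow> 'v \<Rightarrow> 'v \<Rightarrow> real \<Rightarrow> real \<Rightarrow> bool" where
  "wave W i um up a b \<longleftrightarrow>
    (a = b \<and> F up - F um = a *\<^sub>R (up - um) \<and>
      min (lam i um) (lam i up) \<le> a \<and> a \<le> max (lam i um) (lam i up)) \<or>
    (a < b \<and> W a = um \<and> W b = up \<and>
      (\<exists>W'. \<forall>\<xi>\<in>{a..b}. (W has_vector_derivative W' \<xi>) (at \<xi> within {a..b}) \<and> W' \<xi> \<noteq> 0 \<and>
        DF (W \<xi>) (W' \<xi>) = \<xi> *\<^sub>R W' \<xi> \<and> lam i (W \<xi>) = \<xi>))"

text \<open>The budget is expressed by the principal coordinate and not by the norm, because this is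
  the quantity that \<open>sum_in_cone\<close> controls.\<close>

lemma wave_fan:
  assumes i: "i \<in> {1..n}" and w: "wave W i um up a b" and W: "\<And>\<xi>. W \<xi> \<in> G"
    and G: "G \<subseteq> B" "um \<in> G" "up \<in> G" and e: "0 < e"
  shows "in_cone i (up - um)" and "a \<le> b"
    and "fan_approx W F G e a um b up (2 * \<bar>coord i (up - um)\<bar>)"
proof -
  have "in_cone i (up - um) \<and> a \<le> b \<and> fan_approx W F G e a um b up (2 * \<bar>coord i (up - um)\<bar>)"
    using w unfolding wave_def
  proof (elim disjE conjE exE)
    assume jmp: "a = b" "F up - F um = a *\<^sub>R (up - um)"
      "min (lam i um) (lam i up) \<le> a" "a \<le> max (lam i um) (lam i up)"
    have cone: "in_cone i (up - um)"
      using G by (intro jump_in_cone[OF i _ _ jmp(2-4)]) auto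
    moreover have "fan_approx W F G e a um b up (2 * \<bar>coord i (up - um)\<bar>)"
    proof (rule fan_approx_mono)
      show "fan_approx W F G e a um b up (norm (up - um))"
        using fan_approx_jump[OF G(2,3) jmp(2) less_imp_le[OF e]] unfolding jmp(1) .
      show "norm (up - um) \<le> 2 * \<bar>coord i (up - um)\<bar>" using cone unfolding in_cone_def by blast
    qed (use e in simp)
    ultimately show ?thesis using jmp(1) by simp
  next
    fix W'
    assume ab: "a < b" and ends: "W a = um" "W b = up"
      and W': "\<forall>\<xi>\<in>{a..b}. (W has_vector_derivative W' \<xi>) (at \<xi> within {a..b}) \<and> W' \<xi> \<noteq> 0 \<and>
        DF (W \<xi>) (W' \<xi>) = \<xi> *\<^sub>R W' \<xi> \<and> lam i (W \<xi>) = \<xi>"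
    obtain s :: real where s: "\<bar>s\<bar> = 1"
      and var: "\<And>x y. a \<le> x \<Longrightarrow> x \<le> y \<Longrightarrow> y \<le> b \<Longrightarrow>
        norm (W y - W x) \<le> 2 * (s * (coord i (W y) - coord i (W x)))"
      and cone: "\<And>x y j. a \<le> x \<Longrightarrow> x \<le> y \<Longrightarrow> y \<le> b \<Longrightarrow> j \<in> {1..n} - {i} \<Longrightarrow>
        \<bar>coord j (W y) - coord j (W x)\<bar> \<le> \<kappa> * (s * (coord i (W y) - coord i (W x)))"
      and rh: "\<And>x y. a \<le> x \<Longrightarrow> x \<le> y \<Longrightarrow> y \<le> b \<Longrightarrow>
        norm (F (W y) - F (W x) - y *\<^sub>R (W y - W x)) \<le> (y - x) * (2 * (s * (coord i (W y) - coord i (W x))))"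
    proof (rule rarefaction_cone[OF i ab, of W W'])
      show "W \<xi> \<in> B" for \<xi> using W G(1) by blast
    qed (use W' in blast)+
    \<comment> \<open>The sign found along the curve is that of the total increment, so the budget
      depends on the end states only.\<close>
    have "0 \<le> s * (coord i up - coord i um)"
      using order_trans[OF norm_ge_zero var[of a b]] ends ab by simp
    then have "s * (coord i up - coord i um) = \<bar>s * (coord i up - coord i um)\<bar>" by (rule abs_of_nonneg[symmetric])
    also have "\<dots> = \<bar>coord i (up - um)\<bar>"
      using s by (simp add: abs_mult linear_diff[OF linear_coord])
    finally have abs: "s * (coord i up - coord i um) = \<bar>coord i (up - um)\<bar>" .
    have "in_cone i (up - um)"
      using var[of a b] cone[of a b] ends ab abs
      by (simp add: in_cone_def linear_diff[OF linear_coord])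
    moreover have "fan_approx W F G e a um b up (2 * \<bar>coord i (up - um)\<bar>)"
    proof -
      have "continuous_on {a..b} W"
        using W' by (intro continuous_on_vector_derivative[of _ _ W']) auto
      from fan_approx_continuous[of a b e W G "\<lambda>\<xi>. 2 * (s * coord i (W \<xi>))" F, OF _ e this W] ab var rh
      have "fan_approx W F G e a (W a) b (W b) (2 * (s * coord i (W b)) - 2 * (s * coord i (W a)))"
        by (simp add: right_diff_distrib)
      moreover have "2 * (s * coord i (W b)) - 2 * (s * coord i (W a)) = 2 * \<bar>coord i (up - um)\<bar>"
        using abs ends by (simp add: right_diff_distrib)
      ultimately show ?thesis using ends by simp
    qed
    ultimately show ?thesis using ab by simp
  qed
  then show "in_cone i (up - um)" "a \<le> b"
    "fan_approx W F G e a um b up (2 * \<bar>coord i (up - um)\<bar>)" by auto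
qed

text \<open>The factor \<open>4 * n * bound\<close> is 2 from \<open>wave_fan\<close> times
  \<open>2 * n * bound\<close> from \<open>sum_in_cone\<close>, applied to the increments, which
  telescope.\<close>

lemma riemann_fan:
  assumes wave: "\<And>i. i \<in> {1..n} \<Longrightarrow> wave W i (v (i - 1)) (v i) (a i) (b i)"
    and order: "\<And>i. i \<in> {1..<n} \<Longrightarrow> b i < a (Suc i)"
    and const: "\<And>i \<xi>. i \<in> {1..<n} \<Longrightarrow> \<xi> \<in> {b i<..<a (Suc i)} \<Longrightarrow> W \<xi> = v i"
    and W: "\<And>\<xi>. W \<xi> \<in> G" and G: "G \<subseteq> B" and v: "\<And>i. i \<le> n \<Longrightarrow> v i \<in> G" and e: "0 < e"
  shows "a 1 \<le> b n" and "fan_approx W F G e (a 1) (v 0) (b n) (v n) (4 * n * bound * norm (v n - v 0))"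
proof -
  let ?s = "\<lambda>i. 2 * \<bar>coord i (v i - v (i - 1))\<bar>"
  have fan: "a i \<le> b i" "fan_approx W F G e (a i) (v (i - 1)) (b i) (v i) (?s i)"
    and cone: "in_cone i (v i - v (i - 1))" if "i \<in> {1..n}" for i
  proof -
    have "v (i - 1) \<in> G" "v i \<in> G" using that by (auto intro!: v)
    note wf = wave_fan[OF that wave[OF that] W G this e]
    show "a i \<le> b i" "fan_approx W F G e (a i) (v (i - 1)) (b i) (v i) (?s i)"
      "in_cone i (v i - v (i - 1))"
      by (fact wf)+
  qed
  \<comment> \<open>Each new wave is preceded by a constant sector, which costs nothing.\<close>
  have main: "1 \<le> k \<Longrightarrow> k \<le> n \<Longrightarrow> a 1 \<le> b k \<and> fan_approx W F G e (a 1) (v 0) (b k) (v k) (\<Sum>i\<in>{1..k}. ?s i)" for k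
  proof (induction k rule: nat_induct_at_least)
    case base
    then show ?case using fan[of 1] by simp
  next
    case (Suc k)
    then have IH: "a 1 \<le> b k" "fan_approx W F G e (a 1) (v 0) (b k) (v k) (\<Sum>i\<in>{1..k}. ?s i)"
      and k: "k \<in> {1..<n}" "Suc k \<in> {1..n}" by auto
    have "fan_approx W F G e (b k) (v k) (a (Suc k)) (v k) 0"
      using k e by (intro fan_approx_constant const v) auto
    with IH have 1: "fan_approx W F G e (a 1) (v 0) (a (Suc k)) (v k) ((\<Sum>i\<in>{1..k}. ?s i) + 0)"
      using order[OF k(1)] by (intro fan_approx_trans[of W F G e _ _ "b k"]) auto
    have 2: "fan_approx W F G e (a (Suc k)) (v k) (b (Suc k)) (v (Suc k)) (?s (Suc k))"
      using fan(2)[OF k(2)] by simp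
    have le: "a 1 \<le> a (Suc k)" using IH(1) order[OF k(1)] by simp
    have "(\<Sum>i\<in>{1..k}. ?s i) + 0 + ?s (Suc k) = (\<Sum>i\<in>{1..Suc k}. ?s i)" by simp
    with fan_approx_trans[OF 1 2 le fan(1)[OF k(2)]]
    have "fan_approx W F G e (a 1) (v 0) (b (Suc k)) (v (Suc k)) (\<Sum>i\<in>{1..Suc k}. ?s i)"
      by (simp only:)
    then show ?case using le fan(1)[OF k(2)] by (meson order_trans)
  qed
  have n1: "1 \<le> n" using DIM_positive[where 'a = 'v] n by (simp add: Suc_leI One_nat_def)
  show "a 1 \<le> b n" using main[OF n1] by simp
  have telescope: "(\<Sum>i\<in>{1..n}. v i - v (i - 1)) = v n - v 0"
    using sum_telescope''[of 0 n v] n1 by (simp add: One_nat_def)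
  have "(\<Sum>i\<in>{1..n}. \<bar>coord i (v i - v (i - 1))\<bar>) \<le> 2 * dim * bound * norm (v n - v 0)"
    using sum_in_cone[of "\<lambda>i. v i - v (i - 1)"] cone unfolding telescope by blast
  then have "2 * (\<Sum>i\<in>{1..n}. \<bar>coord i (v i - v (i - 1))\<bar>) \<le> 2 * (2 * dim * bound * norm (v n - v 0))"
    by (rule mult_left_mono) simp
  also have "\<dots> = 4 * n * bound * norm (v n - v 0)" by simp
  also have "2 * (\<Sum>i\<in>{1..n}. \<bar>coord i (v i - v (i - 1))\<bar>) = (\<Sum>i\<in>{1..n}. ?s i)"
    by (rule sum_distrib_left)
  finally have "(\<Sum>i\<in>{1..n}. ?s i) \<le> 4 * n * bound * norm (v n - v 0)" .
  from fan_approx_mono[OF conjunct2[OF main[OF n1 order_refl]] this less_imp_le[OF e]]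
  show "fan_approx W F G e (a 1) (v 0) (b n) (v n) (4 * n * bound * norm (v n - v 0))" .
qed

end

section \<open>The weak form in a cell\<close>

lemma norm_triple_le: "norm (a, b, c) \<le> norm a + norm b + norm c"
  using norm_Pair_le[of a "(b, c)"] norm_Pair_le[of b c] by linarith

lemma norm_triple_third [simp]: "norm (0, 0, c) = norm c"
  by (simp add: norm_Pair)

locale balance_cell =
  fixes f g :: "real \<Rightarrow> real \<Rightarrow> 'v::euclidean_space \<Rightarrow> 'v"
    and Df :: "real \<times> real \<times> 'v \<Rightarrow> real \<times> real \<times> 'v \<Rightarrow> 'v"
    and M \<delta> t0 x0 s r :: real
  assumes s: "0 < s" and r: "0 < r" and M: "1 \<le> M"
    and f_deriv: "\<And>z. z \<in> {t0..t0 + s} \<times> {x0 - r..x0 + r} \<times> cball 0 \<delta> \<Longrightarrow>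
      (uncurry3 f has_derivative Df z) (at z within {t0..t0 + s} \<times> {x0 - r..x0 + r} \<times> cball 0 \<delta>)"
    and Df_bound: "\<And>z v. z \<in> {t0..t0 + s} \<times> {x0 - r..x0 + r} \<times> cball 0 \<delta> \<Longrightarrow> norm (Df z v) \<le> M * norm v"
    and Df_lip: "\<And>z z' v. z \<in> {t0..t0 + s} \<times> {x0 - r..x0 + r} \<times> cball 0 \<delta> \<Longrightarrow>
      z' \<in> {t0..t0 + s} \<times> {x0 - r..x0 + r} \<times> cball 0 \<delta> \<Longrightarrow>
      norm (Df z v - Df z' v) \<le> M * norm (z - z') * norm v"
    and g_bound: "\<And>t x u. t \<in> {t0..t0 + s} \<Longrightarrow> x \<in> {x0 - r..x0 + r} \<Longrightarrow> u \<in> cball 0 \<delta> \<Longrightarrow> norm (g t x u) \<le> M"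
    and g_lip: "\<And>z z'. z \<in> {t0..t0 + s} \<times> {x0 - r..x0 + r} \<times> cball 0 \<delta> \<Longrightarrow>
      z' \<in> {t0..t0 + s} \<times> {x0 - r..x0 + r} \<times> cball 0 \<delta> \<Longrightarrow>
      norm (uncurry3 g z - uncurry3 g z') \<le> M * norm (z - z')"
begin

abbreviation "T \<equiv> {t0..t0 + s}"
abbreviation "X \<equiv> {x0 - r..x0 + r}"
abbreviation "B \<equiv> cball (0::'v) \<delta>"
abbreviation "K \<equiv> T \<times> X \<times> B"

lemma convex_K: "convex K"
  by (intro convex_Times convex_cball convex_real_interval)

lemma base: "t0 \<in> T" "x0 \<in> X"
  using s r by auto

lemma f_lip:
  assumes "z \<in> K" "z' \<in> K"
  shows "norm (uncurry3 f z - uncurry3 f z') \<le> M * norm (z - z')"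
  by (rule differentiable_bound[OF convex_K f_deriv])
    (use assms Df_bound in \<open>auto intro!: onorm_le\<close>)

lemma Df_linear: "z \<in> K \<Longrightarrow> linear (Df z)"
  using f_deriv by (blast intro: has_derivative_linear)

lemma lipschitz_imp_continuous:
  fixes F :: "real \<times> real \<times> 'v \<Rightarrow> 'b::real_normed_vector"
  assumes "0 \<le> C" "\<And>z z'. z \<in> K \<Longrightarrow> z' \<in> K \<Longrightarrow> norm (F z - F z') \<le> C * norm (z - z')"
  shows "continuous_on K F"
  by (rule lipschitz_on_continuous_on[of C])
    (use assms in \<open>auto intro!: lipschitz_onI simp: dist_norm\<close>)

lemma f_cont: "continuous_on K (uncurry3 f)"
  using f_lip M by (intro lipschitz_imp_continuous[of M]) auto

lemma g_cont: "continuous_on K (uncurry3 g)"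
  using g_lip M by (intro lipschitz_imp_continuous[of M]) auto

lemma Df_cont: "continuous_on K (\<lambda>z. Df z v)"
  using Df_lip[of _ _ v] M by (intro lipschitz_imp_continuous[of "M * norm v"]) (auto simp: mult_ac)

definition fx :: "real \<Rightarrow> real \<Rightarrow> 'v \<Rightarrow> 'v" where
  "fx t x u = Df (t, x, u) (0, 1, 0)"

definition q :: "'v \<Rightarrow> 'v" where
  "q u = g t0 x0 u - fx t0 x0 u"

definition H :: "real \<Rightarrow> 'v \<Rightarrow> 'v" where
  "H t u = u + (t - t0) *\<^sub>R q u"

text \<open>The states whose correction stays in the ball up to time \<open>s\<close>. Only the end
  point is recorded, since \<open>H t u\<close> moves along a segment and the ball is
  convex.\<close>

definition G :: "'v set" where
  "G = {u \<in> B. u + s *\<^sub>R q u \<in> B}"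

lemma GB: "u \<in> G \<Longrightarrow> u \<in> B"
  by (simp add: G_def)

lemma fx_bound: "(t, x, u) \<in> K \<Longrightarrow> norm (fx t x u) \<le> M"
  using Df_bound[of "(t, x, u)" "(0, 1, 0)"] by (simp add: fx_def norm_Pair)

lemma fx_lip: "(t, x, u) \<in> K \<Longrightarrow> (t', x', u') \<in> K \<Longrightarrow>
    norm (fx t x u - fx t' x' u') \<le> M * norm ((t, x, u) - (t', x', u'))"
  using Df_lip[of "(t, x, u)" "(t', x', u')" "(0, 1, 0)"] by (simp add: fx_def norm_Pair)

lemma source_lip:
  assumes "(t, x, u) \<in> K" "(t', x', u') \<in> K"
  shows "norm ((g t x u - fx t x u) - (g t' x' u' - fx t' x' u')) \<le> 2 * M * norm ((t, x, u) - (t', x', u'))"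
  using g_lip[OF assms] fx_lip[OF assms]
    norm_triangle_ineq4[of "g t x u - g t' x' u'" "fx t x u - fx t' x' u'"]
  by (simp add: algebra_simps)

lemma q_bound: "u \<in> B \<Longrightarrow> norm (q u) \<le> 2 * M"
  using fx_bound[of t0 x0 u] g_bound[of t0 x0 u] base norm_triangle_ineq4[of "g t0 x0 u" "fx t0 x0 u"]
  by (simp add: q_def)

lemma q_lip: "u \<in> B \<Longrightarrow> v \<in> B \<Longrightarrow> norm (q u - q v) \<le> 2 * M * norm (u - v)"
  using source_lip[of t0 x0 u t0 x0 v] base by (simp add: q_def)

lemma H_in: "u \<in> G \<Longrightarrow> t \<in> T \<Longrightarrow> H t u \<in> B"
proof -
  assume u: "u \<in> G" and t: "t \<in> T"
  have "(1 - (t - t0) / s) *\<^sub>R u + ((t - t0) / s) *\<^sub>R (u + s *\<^sub>R q u) \<in> B"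
    using u t s by (intro convexD[OF convex_cball]) (auto simp: G_def field_simps)
  moreover have "(1 - (t - t0) / s) *\<^sub>R u + ((t - t0) / s) *\<^sub>R (u + s *\<^sub>R q u) = H t u"
  proof -
    have "(t - t0) / s * s = t - t0" using s by simp
    then show ?thesis by (simp add: H_def scaleR_add_right scaleR_left_diff_distrib)
  qed
  ultimately show ?thesis by simp
qed

lemma HK: "u \<in> G \<Longrightarrow> t \<in> T \<Longrightarrow> x \<in> X \<Longrightarrow> (t, x, H t u) \<in> K"
  using H_in by simp

lemma H_lip:
  assumes "u \<in> B" "v \<in> B" "t \<in> T"
  shows "norm (H t u - H t v) \<le> (1 + 2 * M * s) * norm (u - v)"
proof -
  have "norm (H t u - H t v) = norm ((u - v) + (t - t0) *\<^sub>R (q u - q v))"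
    by (simp add: H_def algebra_simps)
  also have "\<dots> \<le> norm (u - v) + (t - t0) * norm (q u - q v)"
    using norm_triangle_ineq[of "u - v" "(t - t0) *\<^sub>R (q u - q v)"] assms(3) by simp
  also have "\<dots> \<le> norm (u - v) + s * (2 * M * norm (u - v))"
    using assms s q_lip by (intro add_left_mono mult_mono) auto
  finally show ?thesis by (simp add: algebra_simps)
qed

lemma H_close: "u \<in> B \<Longrightarrow> t \<in> T \<Longrightarrow> norm (H t u - u) \<le> 2 * M * (t - t0)"
  using mult_left_mono[OF q_bound[of u], of "t - t0"] by (simp add: H_def mult.commute)

text \<open>\<open>q u\<close> is the value of the source minus \<open>fx\<close> at
  \<open>(t0, x0, u)\<close>. The point \<open>(t, x, H t u)\<close> is at distance
  \<open>(1 + 2 * M) * (s + r)\<close> at most, where \<open>2 * M\<close> bounds the rate of the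
  correction.\<close>

lemma residual_bound:
  assumes "u \<in> G" "t \<in> T" "x \<in> X"
  shows "norm (g t x (H t u) - fx t x (H t u) - q u) \<le> 2 * M * (1 + 2 * M) * (s + r)"
proof -
  have K0: "(t0, x0, u) \<in> K" using base GB[OF assms(1)] by simp
  have "norm ((t, x, H t u) - (t0, x0, u)) \<le> \<bar>t - t0\<bar> + \<bar>x - x0\<bar> + norm (H t u - u)"
    using norm_triple_le[of "t - t0" "x - x0" "H t u - u"] by simp
  also have "\<dots> \<le> s + r + 2 * M * s"
  proof -
    have "2 * M * (t - t0) \<le> 2 * M * s" using assms(2) M by (intro mult_left_mono) auto
    then have "norm (H t u - u) \<le> 2 * M * s" using H_close[OF GB[OF assms(1)] assms(2)] by linarith
    moreover have "\<bar>t - t0\<bar> \<le> s" "\<bar>x - x0\<bar> \<le> r" using assms(2,3) by auto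
    ultimately show ?thesis by linarith
  qed
  also have "\<dots> \<le> (1 + 2 * M) * (s + r)" using M s r by (simp add: algebra_simps)
  finally have n: "norm ((t, x, H t u) - (t0, x0, u)) \<le> (1 + 2 * M) * (s + r)" .
  have "norm (g t x (H t u) - fx t x (H t u) - q u) \<le> 2 * M * norm ((t, x, H t u) - (t0, x0, u))"
    using source_lip[OF HK[OF assms] K0] by (simp add: q_def)
  also have "\<dots> \<le> 2 * M * ((1 + 2 * M) * (s + r))" using n M by (intro mult_left_mono) auto
  finally show ?thesis by (simp add: mult.assoc)
qed

lemma flux_deriv_u:
  assumes "t \<in> T" "x \<in> X" "u \<in> B"
  shows "(f t x has_derivative (\<lambda>w. Df (t, x, u) (0, 0, w))) (at u within B)"
proof -
  have p: "((\<lambda>u. (t, x, u)) has_derivative (\<lambda>w. (0, 0, w))) (at u within B)"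
    by (auto intro!: derivative_eq_intros)
  have "(uncurry3 f has_derivative Df (t, x, u)) (at (t, x, u) within (\<lambda>u. (t, x, u)) ` B)"
    by (rule has_derivative_subset[OF f_deriv]) (use assms in auto)
  from has_derivative_in_compose[OF p this] show ?thesis by simp
qed

lemma flux_deriv_x:
  assumes "t \<in> T" "x \<in> X" "u \<in> B"
  shows "((\<lambda>x. f t x u) has_vector_derivative fx t x u) (at x within X)"
proof -
  have p: "((\<lambda>x. (t, x, u)) has_derivative (\<lambda>h. (0, h, 0))) (at x within X)"
    by (auto intro!: derivative_eq_intros)
  have "(uncurry3 f has_derivative Df (t, x, u)) (at (t, x, u) within (\<lambda>x. (t, x, u)) ` X)"
    by (rule has_derivative_subset[OF f_deriv]) (use assms in auto)
  from has_derivative_in_compose[OF p this]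
  have "((\<lambda>x. f t x u) has_derivative (\<lambda>h. Df (t, x, u) (0, h, 0))) (at x within X)" by simp
  moreover have "Df (t, x, u) (0, h, 0) = h *\<^sub>R fx t x u" for h
    using linear_scale[OF Df_linear[of "(t, x, u)"], of h "(0, 1, 0)"] assms by (simp add: fx_def)
  ultimately show ?thesis by (simp add: has_vector_derivative_def)
qed

text \<open>The two parts of a mixed second difference of the flux, each controlled by second derivatives.\<close>

lemma flux_jump_move_point:
  assumes "t \<in> T" "x \<in> X" "u \<in> B" "v \<in> B"
  shows "norm ((f t x v - f t x u) - (f t0 x0 v - f t0 x0 u)) \<le> M * (\<bar>t - t0\<bar> + \<bar>x - x0\<bar>) * norm (v - u)"
proof -
  have "norm ((f t x v - f t0 x0 v) - (f t x u - f t0 x0 u)) \<le> M * (\<bar>t - t0\<bar> + \<bar>x - x0\<bar>) * norm (v - u)"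
  proof (rule differentiable_bound[where S = B and f = "\<lambda>u. f t x u - f t0 x0 u"
        and f' = "\<lambda>u w. Df (t, x, u) (0, 0, w) - Df (t0, x0, u) (0, 0, w)"])
    fix u assume u: "u \<in> B"
    show "((\<lambda>u. f t x u - f t0 x0 u) has_derivative
        (\<lambda>w. Df (t, x, u) (0, 0, w) - Df (t0, x0, u) (0, 0, w))) (at u within B)"
      using assms base u by (intro has_derivative_diff flux_deriv_u)
    show "onorm (\<lambda>w. Df (t, x, u) (0, 0, w) - Df (t0, x0, u) (0, 0, w)) \<le> M * (\<bar>t - t0\<bar> + \<bar>x - x0\<bar>)"
    proof (rule onorm_le)
      fix w :: 'v
      have "norm (Df (t, x, u) (0, 0, w) - Df (t0, x0, u) (0, 0, w))
          \<le> M * norm ((t, x, u) - (t0, x0, u)) * norm w"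
        using Df_lip[of "(t, x, u)" "(t0, x0, u)" "(0, 0, w)"] assms base u by simp
      also have "\<dots> \<le> M * (\<bar>t - t0\<bar> + \<bar>x - x0\<bar>) * norm w"
        using norm_triple_le[of "t - t0" "x - x0" "0::'v"] M
        by (intro mult_right_mono mult_left_mono) auto
      finally show "norm (Df (t, x, u) (0, 0, w) - Df (t0, x0, u) (0, 0, w))
          \<le> M * (\<bar>t - t0\<bar> + \<bar>x - x0\<bar>) * norm w" .
    qed
  qed (use assms in auto)
  then show ?thesis by (simp add: algebra_simps)
qed

lemma flux_jump_move_states:
  assumes u: "u \<in> G" and v: "v \<in> G" and t: "t \<in> T"
  shows "norm ((f t0 x0 (H t v) - f t0 x0 (H t u)) - (f t0 x0 v - f t0 x0 u))
    \<le> (t - t0) * (2 * M\<^sup>2 * (2 + 2 * M * s) * norm (v - u))"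
proof -
  define C where "C = 2 * M\<^sup>2 * (2 + 2 * M * s) * norm (v - u)"
  let ?F = "f t0 x0" and ?A = "\<lambda>u w. Df (t0, x0, u) (0, 0, w)"
  have A: "norm (?A u w) \<le> M * norm w" "norm (?A u w - ?A u' w) \<le> M * norm (u - u') * norm w"
    if "u \<in> B" "u' \<in> B" for u u' w
    using Df_bound[of "(t0, x0, u)" "(0, 0, w)"] Df_lip[of "(t0, x0, u)" "(t0, x0, u')" "(0, 0, w)"]
      base that by auto
  have A_lin: "linear (?A u)" if "u \<in> B" for u
    using has_derivative_linear[OF flux_deriv_u[OF base that]] .
  have FH: "((\<lambda>t. ?F (H t u)) has_derivative (\<lambda>h. h *\<^sub>R ?A (H t u) (q u))) (at t within T)"
    if u: "u \<in> G" and t: "t \<in> T" for u t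
  proof -
    have "(H' has_derivative (\<lambda>h. h *\<^sub>R q u)) (at t within T)" if "H' = (\<lambda>t. H t u)" for H'
      unfolding that H_def by (auto intro!: derivative_eq_intros)
    then have 1: "((\<lambda>t. H t u) has_derivative (\<lambda>h. h *\<^sub>R q u)) (at t within T)" by simp
    have "(?F has_derivative ?A (H t u)) (at (H t u) within (\<lambda>t. H t u) ` T)"
      by (rule has_derivative_subset[OF flux_deriv_u[OF base H_in[OF u t]]]) (use H_in[OF u] in auto)
    from has_derivative_in_compose[OF 1 this] show ?thesis
      by (simp add: linear_scale[OF A_lin[OF H_in[OF u t]]])
  qed
  \<comment> \<open>The mean value inequality in time, started at \<open>t0\<close>, where
    \<open>H\<close> is the identity on states.\<close>
  have "norm ((?F (H t v) - ?F (H t u)) - (?F (H t0 v) - ?F (H t0 u))) \<le> C * norm (t - t0)"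
  proof (rule differentiable_bound[where S = T and f = "\<lambda>t. ?F (H t v) - ?F (H t u)"
        and f' = "\<lambda>t h. h *\<^sub>R ?A (H t v) (q v) - h *\<^sub>R ?A (H t u) (q u)"])
    fix t assume t: "t \<in> T"
    show "((\<lambda>t. ?F (H t v) - ?F (H t u)) has_derivative
        (\<lambda>h. h *\<^sub>R ?A (H t v) (q v) - h *\<^sub>R ?A (H t u) (q u))) (at t within T)"
      by (intro has_derivative_diff FH u v t)
    have Hu: "H t u \<in> B" and Hv: "H t v \<in> B" using H_in u v t by auto
    have "?A (H t v) (q v) - ?A (H t u) (q u)
        = ?A (H t v) (q v - q u) + (?A (H t v) (q u) - ?A (H t u) (q u))"
      by (simp add: linear_diff[OF A_lin[OF Hv]])
    then have "norm (?A (H t v) (q v) - ?A (H t u) (q u))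
        \<le> norm (?A (H t v) (q v - q u)) + norm (?A (H t v) (q u) - ?A (H t u) (q u))"
      using norm_triangle_ineq by metis
    also have "\<dots> \<le> M * norm (q v - q u) + M * norm (H t v - H t u) * norm (q u)"
      using A[OF Hv Hu] by (intro add_mono) auto
    also have "\<dots> \<le> M * (2 * M * norm (v - u)) + M * ((1 + 2 * M * s) * norm (v - u)) * (2 * M)"
      using q_lip[OF GB[OF v] GB[OF u]] H_lip[OF GB[OF v] GB[OF u] t] q_bound[OF GB[OF u]] M s
      by (intro add_mono mult_mono mult_nonneg_nonneg) auto
    also have "\<dots> = C" by (simp add: C_def power2_eq_square algebra_simps)
    finally have "norm (?A (H t v) (q v) - ?A (H t u) (q u)) \<le> C" .
    then have "\<bar>h\<bar> * norm (?A (H t v) (q v) - ?A (H t u) (q u)) \<le> C * \<bar>h\<bar>" for h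
      by (subst mult.commute) (rule mult_right_mono, auto)
    then show "onorm (\<lambda>h. h *\<^sub>R ?A (H t v) (q v) - h *\<^sub>R ?A (H t u) (q u)) \<le> C"
      by (intro onorm_le) (simp flip: scaleR_diff_right)
  qed (use t base in auto)
  then show ?thesis using t by (simp add: H_def C_def mult.commute)
qed

text \<open>A common bound for the three error terms of \<open>jump_estimate\<close>, with the time
  elapsed along the ray bounded by \<open>s\<close>. As \<open>1 \<le> M\<close>, all powers of
  \<open>M\<close> are dominated by the third.\<close>

definition jump_const :: real where
  "jump_const = 12 * M ^ 3 * s * (1 + s)"

lemma jump_const_nonneg: "0 \<le> jump_const"
  using s M by (simp add: jump_const_def)

lemma jump_estimate:
  assumes u: "u \<in> G" and v: "v \<in> G" and t: "t \<in> T" and \<sigma>: "\<bar>\<sigma>\<bar> \<le> M"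
    and x: "x = x0 + \<sigma> * (t - t0)" "x \<in> X"
  shows "norm ((f t x (H t v) - f t x (H t u)) - \<sigma> *\<^sub>R (H t v - H t u))
    \<le> jump_const * norm (v - u) + norm (f t0 x0 v - f t0 x0 u - \<sigma> *\<^sub>R (v - u))"
proof -
  define \<tau> where "\<tau> = t - t0"
  have \<tau>: "0 \<le> \<tau>" "\<tau> \<le> s" using t by (auto simp: \<tau>_def)
  let ?d = "norm (v - u)"
  define E1 where "E1 = (f t x (H t v) - f t x (H t u)) - (f t0 x0 (H t v) - f t0 x0 (H t u))"
  define E2 where "E2 = (f t0 x0 (H t v) - f t0 x0 (H t u)) - (f t0 x0 v - f t0 x0 u)"
  define E3 where "E3 = (\<sigma> * \<tau>) *\<^sub>R (q v - q u)"
  define R where "R = f t0 x0 v - f t0 x0 u - \<sigma> *\<^sub>R (v - u)"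
  have "\<bar>x - x0\<bar> = \<bar>\<sigma>\<bar> * \<tau>" using x(1) \<tau>(1) by (simp add: \<tau>_def abs_mult)
  then have dx: "\<bar>x - x0\<bar> \<le> M * \<tau>" using \<sigma> \<tau>(1) by (simp add: mult_right_mono)
  have "norm E1 \<le> M * (\<bar>t - t0\<bar> + \<bar>x - x0\<bar>) * norm (H t v - H t u)"
    unfolding E1_def by (rule flux_jump_move_point[OF t x(2) H_in[OF u t] H_in[OF v t]])
  also have "\<dots> \<le> M * (\<tau> + M * \<tau>) * ((1 + 2 * M * s) * ?d)"
    using dx \<tau> M s H_lip[OF GB[OF v] GB[OF u] t]
    by (intro mult_mono mult_left_mono add_mono mult_nonneg_nonneg) (auto simp: \<tau>_def)
  finally have 1: "norm E1 \<le> \<tau> * (M * (1 + M) * (1 + 2 * M * s) * ?d)" by (simp add: algebra_simps)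
  have 2: "norm E2 \<le> \<tau> * (2 * M\<^sup>2 * (2 + 2 * M * s) * ?d)"
    unfolding E2_def \<tau>_def by (rule flux_jump_move_states[OF u v t])
  have "norm E3 = \<tau> * (\<bar>\<sigma>\<bar> * norm (q v - q u))" using \<tau> by (simp add: E3_def abs_mult mult_ac)
  also have "\<dots> \<le> \<tau> * (M * (2 * M * ?d))"
    using \<sigma> \<tau> M q_lip[OF GB[OF v] GB[OF u]] by (intro mult_left_mono mult_mono) auto
  finally have 3: "norm E3 \<le> \<tau> * (2 * M\<^sup>2 * ?d)" by (simp add: power2_eq_square mult_ac)
  have "(f t x (H t v) - f t x (H t u)) - \<sigma> *\<^sub>R (H t v - H t u) = E1 + E2 - E3 + R"
    by (simp add: E1_def E2_def E3_def R_def H_def \<tau>_def algebra_simps)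
  then have "norm ((f t x (H t v) - f t x (H t u)) - \<sigma> *\<^sub>R (H t v - H t u))
      \<le> norm E1 + norm E2 + norm E3 + norm R"
    by (smt (verit) norm_triangle_ineq norm_triangle_ineq4)
  also have "\<dots> \<le> \<tau> * ((M * (1 + M) * (1 + 2 * M * s) + 2 * M\<^sup>2 * (2 + 2 * M * s) + 2 * M\<^sup>2) * ?d) + norm R"
    using 1 2 3 by (simp add: algebra_simps)
  also have "\<dots> \<le> s * ((12 * M ^ 3 * (1 + s)) * ?d) + norm R"
  proof -
    have M2: "M\<^sup>2 \<le> M ^ 3" "M \<le> M\<^sup>2" using M power_increasing[of 2 3 M] by (auto simp: power2_eq_square)
    have s2: "M\<^sup>2 * s \<le> M ^ 3 * s" using M2 s by (simp add: mult_right_mono)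
    have "M * (1 + M) * (1 + 2 * M * s) + 2 * M\<^sup>2 * (2 + 2 * M * s) + 2 * M\<^sup>2
        = M + 7 * M\<^sup>2 + 2 * (M\<^sup>2 * s) + 6 * (M ^ 3 * s)"
      by (simp add: power2_eq_square power3_eq_cube algebra_simps)
    also have "\<dots> \<le> 12 * M ^ 3 * (1 + s)"
    proof -
      have "12 * M ^ 3 * (1 + s) = 12 * M ^ 3 + 12 * (M ^ 3 * s)" by (simp add: distrib_left)
      moreover have "0 \<le> M ^ 3 * s" "0 \<le> M ^ 3" using s M by simp_all
      ultimately show ?thesis using M2 s2 by linarith
    qed
    finally show ?thesis
      using \<tau> M s by (intro add_right_mono mult_mono mult_right_mono mult_nonneg_nonneg add_nonneg_nonneg) auto
  qed
  finally show ?thesis by (simp add: jump_const_def R_def mult_ac)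
qed

end

section \<open>The weak form of the corrected profile against a test function\<close>

lemma norm_scaleR_diff_le:
  fixes a b :: "'b::real_normed_vector"
  assumes "\<bar>k\<bar> \<le> N" "norm (a - b) \<le> C"
  shows "norm (k *\<^sub>R a - k *\<^sub>R b) \<le> N * C"
  using assms mult_mono'[of "\<bar>k\<bar>" N "norm (a - b)" C]
  by (simp flip: scaleR_diff_right)

context balance_cell
begin

text \<open>Slopes up to \<open>r / s\<close> keep the rays inside; the additional bound
  \<open>M\<close> is the one that \<open>jump_estimate\<close> requires.\<close>

lemma is_cell: "cell t0 (t0 + s) x0 (x0 - r) (x0 + r) (min (r / s) M)"
proof
  fix \<sigma> t assume \<sigma>: "\<bar>\<sigma>\<bar> \<le> min (r / s) M" and t: "t \<in> {t0..t0 + s}"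
  have "\<bar>\<sigma>\<bar> * (t - t0) \<le> r / s * s"
    using \<sigma> t s r by (intro mult_mono) auto
  then have "\<bar>\<sigma> * (t - t0)\<bar> \<le> r" using s t by (simp add: abs_mult)
  then show "x0 + \<sigma> * (t - t0) \<in> X" by (auto simp: abs_le_iff)
qed (use s r in auto)

lemma continuous_on_along_H:
  fixes F :: "real \<times> real \<times> 'v \<Rightarrow> 'b::topological_space"
  assumes "continuous_on K F" "u \<in> G"
  shows "continuous_on (T \<times> X) (\<lambda>(t, x). F (t, x, H t u))"
  unfolding case_prod_unfold
  by (rule continuous_on_compose2[OF assms(1)])
    (use HK[OF assms(2)] in \<open>auto simp: H_def intro!: continuous_intros\<close>)

lemma
  assumes "u \<in> G" "v \<in> G" "t \<in> T" "x \<in> X"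
  shows f_H_lip: "norm (f t x (H t u) - f t x (H t v)) \<le> M * ((1 + 2 * M * s) * norm (u - v))"
    and g_H_lip: "norm (g t x (H t u) - g t x (H t v)) \<le> M * ((1 + 2 * M * s) * norm (u - v))"
    and fx_H_lip: "norm (fx t x (H t u) - fx t x (H t v)) \<le> M * ((1 + 2 * M * s) * norm (u - v))"
proof -
  note uv = HK[OF assms(1,3,4)] HK[OF assms(2,3,4)]
  have "M * norm (H t u - H t v) \<le> M * ((1 + 2 * M * s) * norm (u - v))"
    using H_lip[OF GB GB, of u v t] assms M by (intro mult_left_mono) auto
  then show "norm (f t x (H t u) - f t x (H t v)) \<le> M * ((1 + 2 * M * s) * norm (u - v))"
    "norm (g t x (H t u) - g t x (H t v)) \<le> M * ((1 + 2 * M * s) * norm (u - v))"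
    "norm (fx t x (H t u) - fx t x (H t v)) \<le> M * ((1 + 2 * M * s) * norm (u - v))"
    using f_lip[OF uv] g_lip[OF uv] fx_lip[OF uv] by simp_all
qed

text \<open>The weak integrand is first exchanged for the divergence \<open>ht + \<phi>x\<close>, at
  the cost of the residual times the area \<open>2 * r * s\<close>; then
  \<open>green_estimate\<close> pays for the jumps.\<close>

lemma weak_form_estimate:
  fixes \<theta> \<theta>t \<theta>x :: "real \<Rightarrow> real \<Rightarrow> real" and w :: "real \<Rightarrow> real \<Rightarrow> 'v"
  assumes \<theta>c: "continuous_on (T \<times> X) (\<lambda>(t, x). \<theta> t x)"
    and \<theta>tc: "continuous_on (T \<times> X) (\<lambda>(t, x). \<theta>t t x)"
    and \<theta>xc: "continuous_on (T \<times> X) (\<lambda>(t, x). \<theta>x t x)"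
    and \<theta>t: "\<And>t x. t \<in> T \<Longrightarrow> x \<in> X \<Longrightarrow> ((\<lambda>t. \<theta> t x) has_real_derivative \<theta>t t x) (at t within T)"
    and \<theta>x: "\<And>t x. t \<in> T \<Longrightarrow> x \<in> X \<Longrightarrow> ((\<lambda>x. \<theta> t x) has_real_derivative \<theta>x t x) (at x within X)"
    and N: "\<And>t x. t \<in> T \<Longrightarrow> x \<in> X \<Longrightarrow> \<bar>\<theta> t x\<bar> \<le> N \<and> \<bar>\<theta>t t x\<bar> \<le> N \<and> \<bar>\<theta>x t x\<bar> \<le> N"
    and wG: "\<And>t x. t \<in> T \<Longrightarrow> x \<in> X \<Longrightarrow> w t x \<in> G"
    and approx: "\<And>e. 0 < e \<Longrightarrow> \<exists>xs. cell.step_approx t0 (t0 + s) x0 (x0 - r) (x0 + r) (min (r / s) M) G w e uL xs \<and>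
      last_val uL xs = uR \<and> variation uL xs \<le> V \<and> rh_defect (f t0 x0) uL xs \<le> e"
  shows "norm (integral T (\<lambda>t. integral X (\<lambda>x.
        \<theta>t t x *\<^sub>R H t (w t x) + \<theta>x t x *\<^sub>R f t x (H t (w t x)) + \<theta> t x *\<^sub>R g t x (H t (w t x))))
      - (integral X (\<lambda>x. \<theta> (t0 + s) x *\<^sub>R H (t0 + s) (w (t0 + s) x))
        - integral X (\<lambda>x. \<theta> t0 x *\<^sub>R H t0 (w t0 x))
        + integral T (\<lambda>t. \<theta> t (x0 + r) *\<^sub>R f t (x0 + r) (H t uR))
        - integral T (\<lambda>t. \<theta> t (x0 - r) *\<^sub>R f t (x0 - r) (H t uL))))
    \<le> N * (s * (jump_const * V) + 2 * M * (1 + 2 * M) * (s + r) * (2 * r * s))"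
proof -
  interpret cell t0 "t0 + s" x0 "x0 - r" "x0 + r" "min (r / s) M" by (rule is_cell)
  have N0: "0 \<le> N" using N[OF base] by auto
  define h where "h t x u = \<theta> t x *\<^sub>R H t u" for t x u
  define ht where "ht t x u = \<theta>t t x *\<^sub>R H t u + \<theta> t x *\<^sub>R q u" for t x u
  define \<phi> where "\<phi> t x u = \<theta> t x *\<^sub>R f t x (H t u)" for t x u
  define \<phi>x where "\<phi>x t x u = \<theta>x t x *\<^sub>R f t x (H t u) + \<theta> t x *\<^sub>R fx t x (H t u)" for t x u
  define \<Phi> where "\<Phi> t x u = \<theta>t t x *\<^sub>R H t u + \<theta>x t x *\<^sub>R f t x (H t u) + \<theta> t x *\<^sub>R g t x (H t u)" for t x u
  define A where "A = 1 + 2 * M * s"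
  \<comment> \<open>One Lipschitz constant in the state for \<open>h\<close>, for the divergence and
    for the weak integrand together.\<close>
  define L where "L = N * A + N * (2 * M) + N * (M * A) + N * (M * A)"
  have A: "1 \<le> A" using M s by (simp add: A_def)
  have L: "0 \<le> L" using N0 M A by (simp add: L_def)
  have Hc: "continuous_on (T \<times> X) (\<lambda>(t, x). H t u)" for u
    by (auto simp: H_def case_prod_unfold intro!: continuous_intros)
  have fc: "continuous_on (T \<times> X) (\<lambda>(t, x). f t x (H t u))"
    and gc: "continuous_on (T \<times> X) (\<lambda>(t, x). g t x (H t u))"
    and fxc: "continuous_on (T \<times> X) (\<lambda>(t, x). fx t x (H t u))" if "u \<in> G" for u
    using continuous_on_along_H[OF f_cont that] continuous_on_along_H[OF g_cont that]
      continuous_on_along_H[OF Df_cont that] by (simp_all add: fx_def)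
  have scale: "continuous_on (T \<times> X) (\<lambda>(t, x). a t x *\<^sub>R b t x)"
    if "continuous_on (T \<times> X) (\<lambda>(t, x). a t x)" "continuous_on (T \<times> X) (\<lambda>(t, x). b t x)"
    for a :: "real \<Rightarrow> real \<Rightarrow> real" and b :: "real \<Rightarrow> real \<Rightarrow> 'v"
    using continuous_on_scaleR[OF that] by (simp add: case_prod_unfold)
  have add: "continuous_on (T \<times> X) (\<lambda>(t, x). a t x + b t x)"
    if "continuous_on (T \<times> X) (\<lambda>(t, x). a t x)" "continuous_on (T \<times> X) (\<lambda>(t, x). b t x)"
    for a b :: "real \<Rightarrow> real \<Rightarrow> 'v"
    using continuous_on_add[OF that] by (simp add: case_prod_unfold)
  have qc: "continuous_on (T \<times> X) (\<lambda>(t, x). q u)" for u by (simp add: case_prod_unfold)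
  have hc: "continuous_on (T \<times> X) (\<lambda>(t, x). h t x u)" for u
    unfolding h_def by (intro scale \<theta>c Hc)
  have htc: "continuous_on (T \<times> X) (\<lambda>(t, x). ht t x u)" for u
    unfolding ht_def by (intro add scale \<theta>c \<theta>tc Hc qc)
  have \<phi>c: "continuous_on (T \<times> X) (\<lambda>(t, x). \<phi> t x u)" if "u \<in> G" for u
    unfolding \<phi>_def by (intro scale \<theta>c fc that)
  have \<phi>xc: "continuous_on (T \<times> X) (\<lambda>(t, x). \<phi>x t x u)" if "u \<in> G" for u
    unfolding \<phi>x_def by (intro add scale \<theta>c \<theta>xc fc fxc that)
  have \<Phi>c: "continuous_on (T \<times> X) (\<lambda>(t, x). \<Phi> t x u)" if "u \<in> G" for u
    unfolding \<Phi>_def by (intro add scale \<theta>c \<theta>tc \<theta>xc Hc fc gc that)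
  have Jc: "continuous_on (T \<times> X) (\<lambda>(t, x). ht t x u + \<phi>x t x u)" if "u \<in> G" for u
    by (intro add htc \<phi>xc that)
  have hd: "((\<lambda>t. h t x u) has_vector_derivative ht t x u) (at t within T)" if "t \<in> T" "x \<in> X" for t x u
  proof -
    have "((\<lambda>t. H t u) has_vector_derivative q u) (at t within T)"
      unfolding H_def has_vector_derivative_def by (auto intro!: derivative_eq_intros)
    from has_vector_derivative_scaleR[OF \<theta>t[OF that] this] show ?thesis
      by (simp add: h_def ht_def add.commute)
  qed
  have \<phi>d: "((\<lambda>x. \<phi> t x u) has_vector_derivative \<phi>x t x u) (at x within X)"
    if "u \<in> G" "t \<in> T" "x \<in> X" for t x u
    using has_vector_derivative_scaleR[OF \<theta>x[OF that(2,3)] flux_deriv_x[OF that(2,3) H_in[OF that(1,2)]]]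
    by (simp add: \<phi>_def \<phi>x_def add.commute)
  have jump: "norm (\<phi> t (x0 + \<sigma> * (t - t0)) v - \<phi> t (x0 + \<sigma> * (t - t0)) u
        - \<sigma> *\<^sub>R (h t (x0 + \<sigma> * (t - t0)) v - h t (x0 + \<sigma> * (t - t0)) u))
      \<le> (N * jump_const) * norm (v - u) + N * norm (f t0 x0 v - f t0 x0 u - \<sigma> *\<^sub>R (v - u))"
    if "u \<in> G" "v \<in> G" "\<bar>\<sigma>\<bar> \<le> min (r / s) M" "t \<in> T" for u v \<sigma> t
  proof -
    define x where "x = x0 + \<sigma> * (t - t0)"
    have x: "x \<in> X" using ray[OF that(3,4)] by (simp add: x_def)
    let ?D = "(f t x (H t v) - f t x (H t u)) - \<sigma> *\<^sub>R (H t v - H t u)"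
    have "\<phi> t x v - \<phi> t x u - \<sigma> *\<^sub>R (h t x v - h t x u) = \<theta> t x *\<^sub>R ?D"
      by (simp add: \<phi>_def h_def algebra_simps)
    then have "norm (\<phi> t x v - \<phi> t x u - \<sigma> *\<^sub>R (h t x v - h t x u)) = \<bar>\<theta> t x\<bar> * norm ?D" by simp
    also have "\<dots> \<le> N * (jump_const * norm (v - u) + norm (f t0 x0 v - f t0 x0 u - \<sigma> *\<^sub>R (v - u)))"
      using jump_estimate[OF that(1,2,4) _ x_def x] that(3) N[OF that(4) x] N0 by (intro mult_mono) auto
    finally show ?thesis by (simp add: x_def distrib_left mult.assoc)
  qed
  have lip_parts: "norm (\<theta> t x *\<^sub>R H t u - \<theta> t x *\<^sub>R H t v) \<le> N * A * d"
      "norm (\<theta>t t x *\<^sub>R H t u - \<theta>t t x *\<^sub>R H t v) \<le> N * A * d"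
      "norm (\<theta> t x *\<^sub>R q u - \<theta> t x *\<^sub>R q v) \<le> N * (2 * M) * d"
      "norm (\<theta>x t x *\<^sub>R f t x (H t u) - \<theta>x t x *\<^sub>R f t x (H t v)) \<le> N * (M * A) * d"
      "norm (\<theta> t x *\<^sub>R fx t x (H t u) - \<theta> t x *\<^sub>R fx t x (H t v)) \<le> N * (M * A) * d"
      "norm (\<theta> t x *\<^sub>R g t x (H t u) - \<theta> t x *\<^sub>R g t x (H t v)) \<le> N * (M * A) * d"
    if "t \<in> T" "x \<in> X" "u \<in> G" "v \<in> G" "d = norm (u - v)" for t x u v d
  proof -
    have n: "\<bar>\<theta> t x\<bar> \<le> N" "\<bar>\<theta>t t x\<bar> \<le> N" "\<bar>\<theta>x t x\<bar> \<le> N" using N[OF that(1,2)] by auto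
    note g = GB[OF that(3)] GB[OF that(4)]
    note lips = H_lip[OF g that(1), folded A_def that(5)] q_lip[OF g, folded that(5)]
      f_H_lip[OF that(3,4,1,2), folded A_def that(5)] fx_H_lip[OF that(3,4,1,2), folded A_def that(5)]
      g_H_lip[OF that(3,4,1,2), folded A_def that(5)]
    show "norm (\<theta> t x *\<^sub>R H t u - \<theta> t x *\<^sub>R H t v) \<le> N * A * d"
      "norm (\<theta>t t x *\<^sub>R H t u - \<theta>t t x *\<^sub>R H t v) \<le> N * A * d"
      "norm (\<theta> t x *\<^sub>R q u - \<theta> t x *\<^sub>R q v) \<le> N * (2 * M) * d"
      "norm (\<theta>x t x *\<^sub>R f t x (H t u) - \<theta>x t x *\<^sub>R f t x (H t v)) \<le> N * (M * A) * d"
      "norm (\<theta> t x *\<^sub>R fx t x (H t u) - \<theta> t x *\<^sub>R fx t x (H t v)) \<le> N * (M * A) * d"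
      "norm (\<theta> t x *\<^sub>R g t x (H t u) - \<theta> t x *\<^sub>R g t x (H t v)) \<le> N * (M * A) * d"
      using norm_scaleR_diff_le[OF n(1) lips(1)] norm_scaleR_diff_le[OF n(2) lips(1)]
        norm_scaleR_diff_le[OF n(1) lips(2)] norm_scaleR_diff_le[OF n(3) lips(3)]
        norm_scaleR_diff_le[OF n(1) lips(4)] norm_scaleR_diff_le[OF n(1) lips(5)]
      by (simp_all only: mult.assoc)
  qed
  have nonneg: "0 \<le> N * A * d" "0 \<le> N * (2 * M) * d" "0 \<le> N * (M * A) * d" if "0 \<le> d" for d
    using N0 A M that by simp_all
  have lip_h: "norm (h t x u - h t x v) \<le> L * norm (u - v)"
    if "t \<in> T" "x \<in> X" "u \<in> G" "v \<in> G" for t x u v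
    using lip_parts(1)[OF that refl] nonneg[OF norm_ge_zero[of "u - v"]]
    unfolding h_def L_def distrib_right by linarith
  have lip_J: "norm ((ht t x u + \<phi>x t x u) - (ht t x v + \<phi>x t x v)) \<le> L * norm (u - v)"
    if "t \<in> T" "x \<in> X" "u \<in> G" "v \<in> G" for t x u v
  proof -
    have "(ht t x u + \<phi>x t x u) - (ht t x v + \<phi>x t x v)
      = (\<theta>t t x *\<^sub>R H t u - \<theta>t t x *\<^sub>R H t v) + (\<theta> t x *\<^sub>R q u - \<theta> t x *\<^sub>R q v)
        + (\<theta>x t x *\<^sub>R f t x (H t u) - \<theta>x t x *\<^sub>R f t x (H t v))
        + (\<theta> t x *\<^sub>R fx t x (H t u) - \<theta> t x *\<^sub>R fx t x (H t v))"
      by (simp add: ht_def \<phi>x_def)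
    then show ?thesis
      unfolding L_def distrib_right
      using lip_parts(2-5)[OF that refl] by (simp only:) (intro norm_triangle_mono)
  qed
  have lip_\<Phi>: "norm (\<Phi> t x u - \<Phi> t x v) \<le> L * norm (u - v)"
    if "t \<in> T" "x \<in> X" "u \<in> G" "v \<in> G" for t x u v
  proof -
    have "\<Phi> t x u - \<Phi> t x v
      = (\<theta>t t x *\<^sub>R H t u - \<theta>t t x *\<^sub>R H t v)
        + (\<theta>x t x *\<^sub>R f t x (H t u) - \<theta>x t x *\<^sub>R f t x (H t v))
        + (\<theta> t x *\<^sub>R g t x (H t u) - \<theta> t x *\<^sub>R g t x (H t v))"
      by (simp add: \<Phi>_def)
    then have "norm (\<Phi> t x u - \<Phi> t x v)
        \<le> N * A * norm (u - v) + N * (M * A) * norm (u - v) + N * (M * A) * norm (u - v)"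
      using lip_parts(2,4,6)[OF that refl] by (simp only:) (intro norm_triangle_mono)
    then show ?thesis using nonneg(2)[OF norm_ge_zero[of "u - v"]] unfolding L_def distrib_right by linarith
  qed
  define \<rho> where "\<rho> = N * (2 * M * (1 + 2 * M) * (s + r))"
  have \<rho>0: "0 \<le> \<rho>" using N0 M s r by (simp add: \<rho>_def)
  have diff: "norm (\<Phi> t x u - (ht t x u + \<phi>x t x u)) \<le> \<rho>" if "t \<in> T" "x \<in> X" "u \<in> G" for t x u
  proof -
    have "\<Phi> t x u - (ht t x u + \<phi>x t x u) = \<theta> t x *\<^sub>R (g t x (H t u) - fx t x (H t u) - q u)"
      by (simp add: \<Phi>_def ht_def \<phi>x_def algebra_simps)
    then have "norm (\<Phi> t x u - (ht t x u + \<phi>x t x u))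
        = \<bar>\<theta> t x\<bar> * norm (g t x (H t u) - fx t x (H t u) - q u)" by simp
    also have "\<dots> \<le> \<rho>"
      unfolding \<rho>_def using N[OF that(1,2)] residual_bound[OF that(3,1,2)] N0 by (intro mult_mono) auto
    finally show ?thesis .
  qed
  have approx': "\<exists>u xs. step_approx G w e u xs" if "0 < e" for e using approx[OF that] by blast
  define I where "I = integral T (\<lambda>t. integral X (\<lambda>x. ht t x (w t x) + \<phi>x t x (w t x)))"
  define P where "P = integral X (\<lambda>x. h (t0 + s) x (w (t0 + s) x)) - integral X (\<lambda>x. h t0 x (w t0 x))
        + integral T (\<lambda>t. \<phi> t (x0 + r) uR) - integral T (\<lambda>t. \<phi> t (x0 - r) uL)"
  have 1: "norm (integral T (\<lambda>t. integral X (\<lambda>x. \<Phi> t x (w t x))) - I) \<le> \<rho> * (x0 + r - (x0 - r)) * (t0 + s - t0)"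
    unfolding I_def
    by (rule double_integral_diff_bound[OF wG approx' L \<rho>0 \<Phi>c lip_\<Phi> Jc lip_J diff])
  have 2: "norm (I - P) \<le> (t0 + s - t0) * (N * jump_const * V)"
    unfolding I_def P_def
    by (rule green_estimate[OF wG L hc htc \<phi>c \<phi>xc hd \<phi>d jump _ _ lip_h lip_J approx])
      (use N0 jump_const_nonneg in auto)
  have "norm (integral T (\<lambda>t. integral X (\<lambda>x. \<Phi> t x (w t x))) - P)
      \<le> \<rho> * (x0 + r - (x0 - r)) * (t0 + s - t0) + (t0 + s - t0) * (N * jump_const * V)"
    using norm_triangle_mono[OF 1 2] by simp
  also have "\<dots> = N * (s * (jump_const * V) + 2 * M * (1 + 2 * M) * (s + r) * (2 * r * s))"
    by (simp add: \<rho>_def algebra_simps)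
  finally show ?thesis by (simp add: P_def \<Phi>_def h_def \<phi>_def)
qed

end

section \<open>The balance law\<close>

text \<open>The bounds on unit directions extend by homogeneity. The Lipschitz estimate for the
  derivative is confined to convex subsets, because the mean value inequality needs segments and the
  region itself may not contain them.\<close>

lemma Ck_bounded_2E:
  fixes F :: "'a::real_normed_vector \<Rightarrow> 'b::real_normed_vector"
  assumes "Ck_bounded 2 M S R F" and RS: "R \<subseteq> S"
  obtains F' where "\<And>z. z \<in> S \<Longrightarrow> (F has_derivative F' z) (at z within S)"
    and "\<And>z. z \<in> R \<Longrightarrow> norm (F z) \<le> M"
    and "\<And>z v. z \<in> R \<Longrightarrow> norm (F' z v) \<le> M * norm v"
    and "\<And>K z z' v. convex K \<Longrightarrow> K \<subseteq> R \<Longrightarrow> z \<in> K \<Longrightarrow> z' \<in> K \<Longrightarrow>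
      norm (F' z v - F' z' v) \<le> M * norm (z - z') * norm v"
proof -
  have "(\<forall>z\<in>R. norm (F z) \<le> M) \<and>
      (\<exists>F'. (\<forall>z\<in>S. (F has_derivative F' z) (at z within S)) \<and>
        (\<forall>v. norm v \<le> 1 \<longrightarrow> (\<forall>z\<in>R. norm (F' z v) \<le> M) \<and>
          (\<exists>F''. (\<forall>z\<in>S. ((\<lambda>z. F' z v) has_derivative F'' z) (at z within S)) \<and>
            (\<forall>w. norm w \<le> 1 \<longrightarrow> (\<forall>z\<in>R. norm (F'' z w) \<le> M)))))"
    using assms(1) by (simp add: numeral_2_eq_2)
  then obtain F' where F: "\<And>z. z \<in> R \<Longrightarrow> norm (F z) \<le> M"
    and F': "\<And>z. z \<in> S \<Longrightarrow> (F has_derivative F' z) (at z within S)"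
    and b1: "\<And>z v. norm v \<le> 1 \<Longrightarrow> z \<in> R \<Longrightarrow> norm (F' z v) \<le> M"
    and F'': "\<And>v. norm v \<le> 1 \<Longrightarrow> \<exists>F''. (\<forall>z\<in>S. ((\<lambda>z. F' z v) has_derivative F'' z) (at z within S)) \<and>
            (\<forall>w. norm w \<le> 1 \<longrightarrow> (\<forall>z\<in>R. norm (F'' z w) \<le> M))"
    by blast
  have unit: "norm (L v) \<le> C * norm v"
    if "\<And>v. norm v \<le> 1 \<Longrightarrow> norm (L v) \<le> C" "\<And>c v. L (c *\<^sub>R v) = c *\<^sub>R L v" for L :: "'a \<Rightarrow> 'b" and C v
  proof (cases "v = 0")
    case True
    then show ?thesis using that(2)[of 0 v] by simp
  next
    case False
    have "L v = norm v *\<^sub>R L (v /\<^sub>R norm v)" using False that(2)[of "norm v" "v /\<^sub>R norm v"] by simp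
    then have "norm (L v) = norm v * norm (L (v /\<^sub>R norm v))"
      by (metis abs_norm_cancel norm_scaleR)
    also have "\<dots> \<le> norm v * C" using that(1)[of "v /\<^sub>R norm v"] False by (intro mult_left_mono) auto
    finally show ?thesis by (simp add: mult.commute)
  qed
  have lin: "F' z (c *\<^sub>R v) = c *\<^sub>R F' z v" if "z \<in> S" for z c v
    using linear_scale[OF has_derivative_linear[OF F'[OF that]]] .
  have lip1: "norm (F' z v - F' z' v) \<le> M * norm (z - z')"
    if K: "convex K" "K \<subseteq> R" "z \<in> K" "z' \<in> K" and v: "norm v \<le> 1" for K z z' v
  proof -
    obtain F2 where F2: "\<And>z. z \<in> S \<Longrightarrow> ((\<lambda>z. F' z v) has_derivative F2 z) (at z within S)"
      and b2: "\<And>z w. norm w \<le> 1 \<Longrightarrow> z \<in> R \<Longrightarrow> norm (F2 z w) \<le> M"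
      using F''[OF v] by blast
    show ?thesis
    proof (rule differentiable_bound[OF K(1), where f' = F2])
      fix x assume x: "x \<in> K"
      then have xS: "x \<in> S" and xR: "x \<in> R" using K(2) RS by auto
      show "((\<lambda>z. F' z v) has_derivative F2 x) (at x within K)"
        by (rule has_derivative_subset[OF F2[OF xS]]) (use K(2) RS in auto)
      show "onorm (F2 x) \<le> M"
      proof (rule onorm_bound)
        show "0 \<le> M" using F[OF xR] norm_ge_zero order_trans by blast
        show "norm (F2 x w) \<le> M * norm w" for w
          using b2 xR linear_scale[OF has_derivative_linear[OF F2[OF xS]]]
          by (intro unit[where L = "F2 x"]) blast+
      qed
    qed (use K in auto)
  qed
  show ?thesis
  proof (rule that[of F'])
    show "norm (F' z v) \<le> M * norm v" if "z \<in> R" for z v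
      using that RS by (intro unit b1 lin) auto
    show "norm (F' z v - F' z' v) \<le> M * norm (z - z') * norm v"
      if "convex K" "K \<subseteq> R" "z \<in> K" "z' \<in> K" for K z z' v
      using that RS by (intro unit lip1[OF that]) (auto simp: lin subset_eq scaleR_diff_right)
  qed (use F F' in auto)
qed

text \<open>\<open>C1_norm\<close> consists of real suprema, which bound the function only if its
  values are bounded; this comes from compact support, which the derivatives have to
  inherit.\<close>

lemma test_functionE:
  assumes "test_function \<theta>"
  obtains "continuous_on ({0..} \<times> UNIV) (\<lambda>(t, x). \<theta> t x)"
    and "continuous_on ({0..} \<times> UNIV) (\<lambda>(t, x). dt \<theta> t x)"
    and "continuous_on ({0..} \<times> UNIV) (\<lambda>(t, x). dx \<theta> t x)"
    and "\<And>t x. 0 \<le> t \<Longrightarrow> ((\<lambda>t. \<theta> t x) has_real_derivative dt \<theta> t x) (at t within {0..})"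
    and "\<And>t x. 0 \<le> t \<Longrightarrow> ((\<lambda>x. \<theta> t x) has_real_derivative dx \<theta> t x) (at x)"
    and "\<And>t x. 0 \<le> t \<Longrightarrow> \<bar>\<theta> t x\<bar> \<le> C1_norm \<theta> \<and> \<bar>dt \<theta> t x\<bar> \<le> C1_norm \<theta> \<and> \<bar>dx \<theta> t x\<bar> \<le> C1_norm \<theta>"
proof -
  let ?S = "{0..} \<times> UNIV :: (real \<times> real) set" and ?\<theta> = "\<lambda>(t, x). \<theta> t x"
  have "Ck_on (Suc 0) ?S ?\<theta>" "\<exists>K. compact K \<and> (\<forall>t\<ge>0. \<forall>x. (t, x) \<notin> K \<longrightarrow> \<theta> t x = 0)"
    using assms unfolding test_function_def One_nat_def by blast+
  then obtain F' K where F': "\<And>z. z \<in> ?S \<Longrightarrow> (?\<theta> has_derivative F' z) (at z within ?S)"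
    and F'c: "\<And>v. continuous_on ?S (\<lambda>z. F' z v)"
    and K: "compact K" "\<And>t x. 0 \<le> t \<Longrightarrow> (t, x) \<notin> K \<Longrightarrow> \<theta> t x = 0"
    unfolding Ck_on.simps by blast
  have part: "((\<lambda>t. \<theta> t x) has_vector_derivative D (1, 0)) (at t within {0..})"
      "((\<lambda>x. \<theta> t x) has_vector_derivative D (0, 1)) (at x)"
      "dt \<theta> t x = D (1, 0)" "dx \<theta> t x = D (0, 1)"
    if t: "0 \<le> t" and D: "(?\<theta> has_derivative D) (at (t, x) within ?S)" for t x D
  proof -
    have sc: "D (c *\<^sub>R v) = c * D v" for c v
      using linear_scale[OF has_derivative_linear[OF D], of c v] by simp
    have "((\<lambda>t. (t, x)) has_derivative (\<lambda>h. (h, 0))) (at t within {0..})"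
      by (auto intro!: derivative_eq_intros)
    from has_derivative_in_compose[OF this has_derivative_subset[OF D], simplified]
    show 1: "((\<lambda>t. \<theta> t x) has_vector_derivative D (1, 0)) (at t within {0..})"
      unfolding has_vector_derivative_def
    proof (rule has_derivative_eq_rhs)
      show "(\<lambda>h. D (h, 0)) = (\<lambda>h. h *\<^sub>R D (1, 0))"
      proof
        show "D (h, 0) = h *\<^sub>R D (1, 0)" for h using sc[of h "(1, 0)"] by simp
      qed
    qed auto
    have "((\<lambda>x. (t, x)) has_derivative (\<lambda>h. (0, h))) (at x)"
      by (auto intro!: derivative_eq_intros)
    from has_derivative_in_compose[OF this has_derivative_subset[OF D], simplified]
    show 2: "((\<lambda>x. \<theta> t x) has_vector_derivative D (0, 1)) (at x)"
      unfolding has_vector_derivative_def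
    proof (rule has_derivative_eq_rhs)
      show "(\<lambda>h. D (0, h)) = (\<lambda>h. h *\<^sub>R D (0, 1))"
      proof
        show "D (0, h) = h *\<^sub>R D (0, 1)" for h using sc[of h "(0, 1)"] by simp
      qed
    qed (use t in auto)
    \<comment> \<open>Also at \<open>t = 0\<close> the one-sided derivative is unique, so
      \<open>dt\<close> has the intended value.\<close>
    have "t islimpt {0..t + 1}" using t by simp
    then have "t islimpt {0..}" by (rule islimpt_subset) auto
    then show "dt \<theta> t x = D (1, 0)" unfolding dt_def
      by (intro vector_derivative_within 1) (simp add: trivial_limit_within)
    show "dx \<theta> t x = D (0, 1)" unfolding dx_def by (rule vector_derivative_at[OF 2])
  qed
  have dt: "dt \<theta> t x = F' (t, x) (1, 0)" and dx: "dx \<theta> t x = F' (t, x) (0, 1)" if "0 \<le> t" for t x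
    using part(3,4)[OF that F'] that by auto
  have c0: "continuous_on ?S ?\<theta>"
    using F' by (auto intro: has_derivative_continuous simp: continuous_on_eq_continuous_within)
  have c1: "continuous_on ?S (\<lambda>(t, x). dt \<theta> t x)"
    using F'c[of "(1, 0)"] by (rule continuous_on_eq) (auto simp: dt)
  have c2: "continuous_on ?S (\<lambda>(t, x). dx \<theta> t x)"
    using F'c[of "(0, 1)"] by (rule continuous_on_eq) (auto simp: dx)
  have zero: "dt \<theta> t x = 0" "dx \<theta> t x = 0" if t: "0 \<le> t" and out: "(t, x) \<notin> K" for t x
  proof -
    have "open (- K)" using K(1) by (simp add: compact_imp_closed open_Compl)
    then obtain d where d: "0 < d" "ball (t, x) d \<subseteq> - K"
      using out by (meson ComplI open_contains_ball)
    \<comment> \<open>Off the closed set \<open>K\<close> the test function vanishes near the point,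
      relative to the half plane, hence so do its derivatives.\<close>
    have "(?\<theta> has_derivative (\<lambda>_. 0)) (at (t, x) within ?S)"
    proof (rule has_derivative_transform_within[OF has_derivative_const d(1)])
      show "(t, x) \<in> ?S" using t by simp
      fix z assume z: "z \<in> ?S" "dist z (t, x) < d"
      then have "z \<in> ball (t, x) d" by (simp add: dist_commute)
      then have "z \<notin> K" using d(2) by blast
      then show "0 = ?\<theta> z" using z(1) K(2) by (cases z) auto
    qed
    from part(3,4)[OF t this] show "dt \<theta> t x = 0" "dx \<theta> t x = 0" by simp_all
  qed
  have sup: "\<bar>F t x\<bar> \<le> C0_norm F" "0 \<le> C0_norm F"
    if c: "continuous_on ?S (\<lambda>(t, x). F t x)" and z: "\<And>t x. 0 \<le> t \<Longrightarrow> (t, x) \<notin> K \<Longrightarrow> F t x = 0"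
      and t: "0 \<le> t" for F :: "real \<Rightarrow> real \<Rightarrow> real" and t x
  proof -
    have "compact (K \<inter> ?S)" using K(1) by (intro compact_Int_closed closed_Times) auto
    moreover have "continuous_on (K \<inter> ?S) (\<lambda>(t, x). F t x)" by (rule continuous_on_subset[OF c]) auto
    ultimately have "bounded ((\<lambda>(t, x). F t x) ` (K \<inter> ?S))"
      by (intro compact_imp_bounded compact_continuous_image)
    then obtain C where C0: "0 < C" "\<forall>y\<in>(\<lambda>(t, x). F t x) ` (K \<inter> ?S). norm y \<le> C"
      unfolding bounded_pos by blast
    have C: "\<bar>(\<lambda>(t, x). F t x) p\<bar> \<le> C" if "p \<in> K \<inter> ?S" for p
      using bspec[OF C0(2) imageI[OF that]] by simp
    have "bdd_above ((\<lambda>(t, x). \<bar>F t x\<bar>) ` ?S)"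
    proof (rule bdd_aboveI2)
      fix p assume "p \<in> ?S"
      then show "(\<lambda>(t, x). \<bar>F t x\<bar>) p \<le> C"
        using C0(1) C[of p] z[of "fst p" "snd p"] by (cases "p \<in> K") auto
    qed
    from cSUP_upper[OF _ this, of "(t, x)"] t show "\<bar>F t x\<bar> \<le> C0_norm F"
      by (simp add: C0_norm_def)
    then show "0 \<le> C0_norm F" using abs_ge_zero order_trans by blast
  qed
  show thesis
  proof (rule that[OF c0 c1 c2])
    fix t x :: real assume t: "0 \<le> t"
    have "(?\<theta> has_derivative F' (t, x)) (at (t, x) within ?S)" using t by (intro F') simp
    from part(1,2)[OF t this]
    show "((\<lambda>t. \<theta> t x) has_real_derivative dt \<theta> t x) (at t within {0..})"
      "((\<lambda>x. \<theta> t x) has_real_derivative dx \<theta> t x) (at x)"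
      by (simp_all add: has_real_derivative_iff_has_vector_derivative dt dx t)
    show "\<bar>\<theta> t x\<bar> \<le> C1_norm \<theta> \<and> \<bar>dt \<theta> t x\<bar> \<le> C1_norm \<theta> \<and> \<bar>dx \<theta> t x\<bar> \<le> C1_norm \<theta>"
      using sup(1)[OF c0 K(2) t, of x] sup(1)[OF c1 zero(1) t, of x] sup(1)[OF c2 zero(2) t, of x]
        sup(2)[OF c0 K(2) t] sup(2)[OF c1 zero(1) t] sup(2)[OF c2 zero(2) t]
      by (auto simp: C1_norm_def)
  qed
qed

section \<open>From profiles in the self-similar variable to functions in the cell\<close>

lemma step_val_scale: "0 < \<tau> \<Longrightarrow> step_val u xs \<tau> y = step_val u xs 1 (y / \<tau>)"
  by (induction u xs \<tau> y rule: step_val.induct) (auto simp: pos_divide_le_eq)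

lemma (in cell) fan_approx_imp_step_approx:
  assumes fan: "\<And>e. 0 < e \<Longrightarrow> fan_approx W F G e a uL b uR V"
    and V: "0 \<le> V" and ab: "- \<Lambda> \<le> a" "b \<le> \<Lambda>"
    and left: "\<And>\<xi>. \<xi> < a \<Longrightarrow> W \<xi> = uL" and right: "\<And>\<xi>. b < \<xi> \<Longrightarrow> W \<xi> = uR"
    and w: "\<And>t x. w t x = (if t0 < t then W ((x - x0) / (t - t0)) else if x < x0 then uL else uR)"
    and e: "0 < e"
  shows "\<exists>xs. step_approx G w e uL xs \<and> last_val uL xs = uR \<and> variation uL xs \<le> V \<and> rh_defect F uL xs \<le> e"
proof -
  \<comment> \<open>Chosen so that both the distance \<open>d\<close> and the defect
    \<open>d * V\<close> are at most \<open>e\<close>.\<close>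
  define d where "d = e / (V + 1)"
  have d: "0 < d" using e V by (simp add: d_def)
  have "d * (V + 1) = e" using V by (simp add: d_def)
  then have "d * V + d = e" by (simp add: distrib_left)
  moreover have "0 \<le> d * V" using d V by simp
  ultimately have de: "d \<le> e" "d * V \<le> e" using d by linarith+
  obtain xs E where xs: "uL \<in> G" "snd ` set xs \<subseteq> G" "sorted (map fst xs)" "fst ` set xs \<subseteq> {a..b}"
    "last_val uL xs = uR" "variation uL xs \<le> V" "rh_defect F uL xs \<le> d * V"
    and E: "finite E" "\<forall>\<xi>\<in>{a..b} - E. norm (W \<xi> - step_val uL xs 1 \<xi>) \<le> d"
    using fan[OF d] unfolding fan_approx_def by blast
  have close: "norm (W \<xi> - step_val uL xs 1 \<xi>) \<le> e" if "\<xi> \<notin> E" for \<xi>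
  proof -
    consider "\<xi> < a" | "\<xi> \<in> {a..b}" | "b < \<xi>" by (meson atLeastAtMost_iff not_le)
    then show ?thesis
    proof cases
      case 1
      have "step_val uL xs 1 \<xi> = uL" using xs(4) 1 by (intro step_val_left[where \<sigma> = a]) auto
      then show ?thesis using left[OF 1] e by simp
    next
      case 2
      then have "norm (W \<xi> - step_val uL xs 1 \<xi>) \<le> d" using E(2) that by blast
      then show ?thesis using de(1) by linarith
    next
      case 3
      have "step_val uL xs 1 \<xi> = uR" using xs(4) 3 by (subst step_val_right) (auto simp: xs(5))
      then show ?thesis using right[OF 3] e by simp
    qed
  qed
  have "\<exists>E. finite E \<and> (\<forall>x\<in>{lo..hi} - E. norm (w t x - step uL xs t x) \<le> e)" if t: "t \<in> {t0..t1}" for t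
  proof (cases "t = t0")
    case True
    \<comment> \<open>At the initial time all rays meet at \<open>x0\<close>, and the step function
      reduces to the Riemann data.\<close>
    have "w t x = step uL xs t x" if "x \<noteq> x0" for x
    proof (cases "x < x0")
      case True
      then show ?thesis using \<open>t = t0\<close> xs(4)
        by (subst step_val_left[where \<sigma> = a]) (auto simp: w)
    next
      case False
      then show ?thesis using \<open>t = t0\<close> that
        by (subst step_val_right) (auto simp: w xs(5))
    qed
    then show ?thesis using e by (intro exI[of _ "{x0}"]) auto
  next
    case False
    then have t: "t0 < t" using t by simp
    let ?E = "(\<lambda>\<xi>. x0 + \<xi> * (t - t0)) ` E"
    have "norm (w t x - step uL xs t x) \<le> e" if "x \<notin> ?E" for x
    proof -
      have "x0 + (x - x0) / (t - t0) * (t - t0) = x" using t by simp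
      with that have "(x - x0) / (t - t0) \<notin> E" by (metis imageI)
      then show ?thesis using close t by (simp add: w step_val_scale[of "t - t0"])
    qed
    then show ?thesis using E(1) by (intro exI[of _ ?E]) auto
  qed
  moreover have "\<bar>\<sigma>\<bar> \<le> \<Lambda>" if "\<sigma> \<in> fst ` set xs" for \<sigma>
    using subsetD[OF xs(4) that] ab by auto
  ultimately have "step_approx G w e uL xs"
    using xs(1-3) by (auto simp: step_approx_def step_data_def)
  then show ?thesis using xs(5-7) de(2) by (intro exI[of _ xs]) auto
qed

section \<open>Wave speeds, and the Lax solution as input for the cell\<close>

lemma (in frozen_system) lam_bound:
  assumes "i \<in> {1..n}" "u \<in> B"
  shows "\<bar>lam i u\<bar> \<le> M"
  using DF_bound[OF assms(2), of "ev i u"] eigen[OF assms] ev_nonzero[OF assms] by simp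

lemma (in frozen_system) wave_speed_bound:
  assumes "wave W i um up a b" and "\<And>u. u \<in> U \<Longrightarrow> \<bar>lam i u\<bar> \<le> \<Lambda>"
    and "um \<in> U" "up \<in> U" "\<And>\<xi>. W \<xi> \<in> U"
  shows "\<bar>a\<bar> \<le> \<Lambda> \<and> \<bar>b\<bar> \<le> \<Lambda>"
  using assms(1) unfolding wave_def
proof (elim disjE conjE exE)
  assume "a = b" "min (lam i um) (lam i up) \<le> a" "a \<le> max (lam i um) (lam i up)"
  then show ?thesis using assms(2)[OF assms(3)] assms(2)[OF assms(4)] by linarith
next
  fix W'
  assume "a < b" and "\<forall>\<xi>\<in>{a..b}. (W has_vector_derivative W' \<xi>) (at \<xi> within {a..b}) \<and> W' \<xi> \<noteq> 0 \<and>
        DF (W \<xi>) (W' \<xi>) = \<xi> *\<^sub>R W' \<xi> \<and> lam i (W \<xi>) = \<xi>"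
  then have "lam i (W a) = a" "lam i (W b) = b" by auto
  then show ?thesis using assms(2)[OF assms(5), of a] assms(2)[OF assms(5), of b] by simp
qed

lemma elementary_wave_imp_wave:
  fixes f :: "'n::finite flux"
  assumes fs: "frozen_system (f t0 x0) DF (\<lambda>i. lam i t0 x0) (\<lambda>i. rv i t0 x0) M c \<delta> CARD('n)"
    and w: "elementary_wave \<Omega> f lam rv i t0 x0 W um up a b"
    and i: "i \<in> {1..CARD('n)}" and t0: "0 \<le> t0"
    and W: "\<And>\<xi>. W \<xi> \<in> cball 0 \<delta>" and \<Omega>: "cball 0 \<delta> \<subseteq> \<Omega>"
  shows "frozen_system.wave (f t0 x0) DF (\<lambda>i. lam i t0 x0) W i um up a b"
  using w unfolding elementary_wave_def frozen_system.wave_def[OF fs]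
proof (elim disjE conjE)
  assume gnl: "genuinely_nonlinear \<Omega> lam rv i" and rw: "rarefaction_wave lam rv i t0 x0 W um up a b"
  interpret fz: frozen_system "f t0 x0" DF "\<lambda>i. lam i t0 x0" "\<lambda>i. rv i t0 x0" M c \<delta> "CARD('n)"
    by (rule fs)
  define W' where "W' \<xi> = (1 / lam_slope lam rv i t0 x0 (W \<xi>)) *\<^sub>R rv i t0 x0 (W \<xi>)" for \<xi>
  \<comment> \<open>A vanishing slope would turn the prescribed derivative into 0, because
    \<open>1 / 0 = 0\<close>; genuine nonlinearity excludes this.\<close>
  have "lam_slope lam rv i t0 x0 (W \<xi>) \<noteq> 0" for \<xi>
    using gnl t0 W \<Omega> unfolding genuinely_nonlinear_def by blast
  then have "W' \<xi> \<noteq> 0" for \<xi>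
    using fz.ev_nonzero[OF i W] by (simp add: W'_def)
  moreover have "DF (W \<xi>) (W' \<xi>) = lam i t0 x0 (W \<xi>) *\<^sub>R W' \<xi>" for \<xi>
    unfolding W'_def linear_scale[OF fz.DF_linear[OF W]] fz.eigen[OF i W] by (simp add: mult.commute)
  ultimately have "\<forall>\<xi>\<in>{a..b}. (W has_vector_derivative W' \<xi>) (at \<xi> within {a..b}) \<and> W' \<xi> \<noteq> 0 \<and>
        DF (W \<xi>) (W' \<xi>) = \<xi> *\<^sub>R W' \<xi> \<and> lam i t0 x0 (W \<xi>) = \<xi>"
    using rw unfolding rarefaction_wave_def W'_def by metis
  then show "(a = b \<and> f t0 x0 up - f t0 x0 um = a *\<^sub>R (up - um) \<and>
      min (lam i t0 x0 um) (lam i t0 x0 up) \<le> a \<and> a \<le> max (lam i t0 x0 um) (lam i t0 x0 up)) \<or>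
    (a < b \<and> W a = um \<and> W b = up \<and>
      (\<exists>W'. \<forall>\<xi>\<in>{a..b}. (W has_vector_derivative W' \<xi>) (at \<xi> within {a..b}) \<and> W' \<xi> \<noteq> 0 \<and>
        DF (W \<xi>) (W' \<xi>) = \<xi> *\<^sub>R W' \<xi> \<and> lam i t0 x0 (W \<xi>) = \<xi>))"
    using rw unfolding rarefaction_wave_def by blast
qed (auto simp: shock_wave_def contact_wave_def rankine_hugoniot_def)

text \<open>The estimate with all constants explicit. \<open>M'\<close> replaces \<open>M\<close>
  because the locales ask for bounds from below, \<open>1 \<le> M'\<close> and
  \<open>c \<le> 2 * M'\<close>.\<close>

lemma cell_estimate:
  fixes f g :: "'n::finite flux"
  assumes \<Omega>: "open \<Omega>" "cball 0 \<delta> \<subseteq> \<Omega>" and \<delta>: "0 \<le> \<delta>" and c: "0 < c"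
    and M': "1 \<le> M'" "c \<le> 2 * M'" "M \<le> M'"
    and small: "4 * CARD('n) * (2 * M' / c) ^ (CARD('n) - 1) * M' * \<delta>
      * (1 + CARD('n) * (2 * M' / c) ^ (CARD('n) - 1)) \<le> c"
    and U: "U \<subseteq> cball 0 \<delta>"
    and law: "balance_law \<Omega> f g lam rv" and \<theta>: "test_function \<theta>"
    and t0: "0 \<le> t0" and uL: "uL \<in> U" and uR: "uR \<in> U" and s: "0 < s" and r: "0 < r"
    and cfl: "ereal (s / r) * sup_speed U lam \<le> 1"
    and bnd: "bounds_on M c ({t0..t0 + s} \<times> {x0 - r..x0 + r}) \<Omega> f g lam"
    and lax: "lax_solution \<Omega> f lam rv uL uR t0 x0 W"
    and WU: "\<And>\<xi>. W \<xi> \<in> U"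
    and WGU: "\<And>t x. t \<in> {t0<..t0 + s} \<Longrightarrow> x \<in> {x0 - r..x0 + r} \<Longrightarrow> approx_sol f g uL uR t0 x0 W t x \<in> U"
  shows "norm (Delta f g (approx_sol f g uL uR t0 x0 W) t0 x0 s r \<theta>
      - boundary_terms f (approx_sol f g uL uR t0 x0 W) t0 x0 s r \<theta>)
    \<le> C1_norm \<theta> * (s * (12 * M' ^ 3 * s * (1 + s) * (4 * CARD('n) * (2 * M' / c) ^ (CARD('n) - 1) * norm (uR - uL)))
        + 2 * M' * (1 + 2 * M') * (s + r) * (2 * r * s))"
proof -
  let ?n = "CARD('n)" and ?S = "{0..} \<times> UNIV \<times> \<Omega>" and ?WG = "approx_sol f g uL uR t0 x0 W"
  let ?T = "{t0..t0 + s}" and ?X = "{x0 - r..x0 + r}" and ?B = "cball (0::real^'n) \<delta>"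
  let ?K = "?T \<times> ?X \<times> ?B" and ?R = "{(t, x, u). (t, x) \<in> ?T \<times> ?X \<and> u \<in> \<Omega>}"
  have RS: "?R \<subseteq> ?S" using t0 by auto
  have KR: "?K \<subseteq> ?R" using \<Omega>(2) by auto
  have KS: "?K \<subseteq> ?S" using KR RS by blast
  have cK: "convex ?K" by (intro convex_Times convex_cball convex_real_interval)
  have bf: "Ck_bounded 2 M ?S ?R (uncurry3 f)" and bg: "Ck_bounded 2 M ?S ?R (uncurry3 g)"
    using bnd by (auto simp: bounds_on_def)
  obtain Df where Df: "\<And>z. z \<in> ?S \<Longrightarrow> (uncurry3 f has_derivative Df z) (at z within ?S)"
    and "\<And>z. z \<in> ?R \<Longrightarrow> norm (uncurry3 f z) \<le> M"
    and Df_b: "\<And>z v. z \<in> ?R \<Longrightarrow> norm (Df z v) \<le> M * norm v"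
    and Df_l: "\<And>K z z' v. convex K \<Longrightarrow> K \<subseteq> ?R \<Longrightarrow> z \<in> K \<Longrightarrow> z' \<in> K \<Longrightarrow>
      norm (Df z v - Df z' v) \<le> M * norm (z - z') * norm v"
    by (rule Ck_bounded_2E[OF bf RS]) (rule that)
  obtain Dg where Dg: "\<And>z. z \<in> ?S \<Longrightarrow> (uncurry3 g has_derivative Dg z) (at z within ?S)"
    and g_b: "\<And>z. z \<in> ?R \<Longrightarrow> norm (uncurry3 g z) \<le> M"
    and Dg_b: "\<And>z v. z \<in> ?R \<Longrightarrow> norm (Dg z v) \<le> M * norm v"
    and "\<And>K z z' v. convex K \<Longrightarrow> K \<subseteq> ?R \<Longrightarrow> z \<in> K \<Longrightarrow> z' \<in> K \<Longrightarrow>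
      norm (Dg z v - Dg z' v) \<le> M * norm (z - z') * norm v"
    by (rule Ck_bounded_2E[OF bg RS]) (rule that)
  have up: "M * a \<le> M' * a" if "0 \<le> a" for a using M'(3) that by (rule mult_right_mono)
  interpret bc: balance_cell f g Df M' \<delta> t0 x0 s r
  proof
    show "(uncurry3 f has_derivative Df z) (at z within ?K)" if "z \<in> ?K" for z
      by (rule has_derivative_subset[OF Df[OF subsetD[OF KS that]] KS])
    show "norm (Df z v) \<le> M' * norm v" if "z \<in> ?K" for z v
      using Df_b[OF subsetD[OF KR that]] up[OF norm_ge_zero] by (rule order_trans)
    show "norm (Df z v - Df z' v) \<le> M' * norm (z - z') * norm v" if "z \<in> ?K" "z' \<in> ?K" for z z' v
      using Df_l[OF cK KR that, of v] up[of "norm (z - z') * norm v"] by (simp add: mult.assoc)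
    show "norm (g t x u) \<le> M'" if "t \<in> ?T" "x \<in> ?X" "u \<in> ?B" for t x u
    proof -
      have "(t, x, u) \<in> ?R" by (rule subsetD[OF KR]) (use that in simp)
      from g_b[OF this] M'(3) show ?thesis by simp
    qed
    show "norm (uncurry3 g z - uncurry3 g z') \<le> M' * norm (z - z')" if "z \<in> ?K" "z' \<in> ?K" for z z'
    proof (rule differentiable_bound[OF cK])
      show "(uncurry3 g has_derivative Dg z) (at z within ?K)" if "z \<in> ?K" for z
        by (rule has_derivative_subset[OF Dg[OF subsetD[OF KS that]] KS])
      show "onorm (Dg z) \<le> M'" if "z \<in> ?K" for z
      proof (rule onorm_le)
        show "norm (Dg z v) \<le> M' * norm v" for v
          using Dg_b[OF subsetD[OF KR that]] up[OF norm_ge_zero] by (rule order_trans)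
      qed
    qed (fact that)+
  qed (use s r M' in auto)
  \<comment> \<open>For frozen time and position the derivative is an ordinary one, even at time 0,
    since \<open>\<Omega>\<close> is open.\<close>
  have f_u: "(f t x has_derivative (\<lambda>w. Df (t, x, u) (0, 0, w))) (at u)"
    if "0 \<le> t" "u \<in> \<Omega>" for t x u
  proof -
    have p: "((\<lambda>u. (t, x, u)) has_derivative (\<lambda>w. (0, 0, w))) (at u within \<Omega>)"
      by (auto intro!: derivative_eq_intros)
    have "(uncurry3 f has_derivative Df (t, x, u)) (at (t, x, u) within (\<lambda>u. (t, x, u)) ` \<Omega>)"
      by (rule has_derivative_subset[OF Df]) (use that in auto)
    from has_derivative_in_compose[OF p this]
    have "(f t x has_derivative (\<lambda>w. Df (t, x, u) (0, 0, w))) (at u within \<Omega>)" by simp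
    then show ?thesis unfolding at_within_open[OF that(2) \<Omega>(1)] .
  qed
  have q_eq: "reduced_source f g t0 x0 u = bc.q u" if "u \<in> ?B" for u
  proof -
    have p: "((\<lambda>y. (t0, y, u)) has_derivative (\<lambda>h. (0, h, 0))) (at x0)"
      by (auto intro!: derivative_eq_intros)
    have D: "(uncurry3 f has_derivative Df (t0, x0, u)) (at (t0, x0, u) within ?S)"
      using that t0 \<Omega>(2) by (intro Df) auto
    then have "(uncurry3 f has_derivative Df (t0, x0, u)) (at (t0, x0, u) within range (\<lambda>y. (t0, y, u)))"
      by (rule has_derivative_subset) (use that t0 \<Omega>(2) in auto)
    from has_derivative_in_compose[OF p this]
    have "((\<lambda>y. f t0 y u) has_derivative (\<lambda>h. Df (t0, x0, u) (0, h, 0))) (at x0)" by simp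
    moreover have "Df (t0, x0, u) (0, h, 0) = h *\<^sub>R bc.fx t0 x0 u" for h
      using linear_scale[OF has_derivative_linear[OF D], of h "(0, 1, 0)"] by (simp add: bc.fx_def)
    ultimately have "((\<lambda>y. f t0 y u) has_vector_derivative bc.fx t0 x0 u) (at x0)"
      by (simp add: has_vector_derivative_def)
    then show ?thesis by (simp add: reduced_source_def bc.q_def vector_derivative_at)
  qed
  have hyp: "strictly_hyperbolic \<Omega> f lam rv" using law by (simp add: balance_law_def)
  let ?DF = "\<lambda>u w. Df (t0, x0, u) (0, 0, w)"
  have fs: "frozen_system (f t0 x0) ?DF (\<lambda>i. lam i t0 x0) (\<lambda>i. rv i t0 x0) M' c \<delta> ?n"
  proof
    show "(f t0 x0 has_derivative ?DF u) (at u within ?B)" if "u \<in> ?B" for u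
      using has_derivative_at_withinI[OF f_u[OF t0]] that \<Omega>(2) by blast
    show "norm (?DF u w) \<le> M' * norm w" if "u \<in> ?B" for u w
      using bc.Df_bound[of "(t0, x0, u)" "(0, 0, w)"] bc.base that by simp
    show "norm (?DF u w - ?DF v w) \<le> M' * norm (u - v) * norm w" if "u \<in> ?B" "v \<in> ?B" for u v w
      using bc.Df_lip[of "(t0, x0, u)" "(t0, x0, v)" "(0, 0, w)"] bc.base that by simp
    show "?DF u (rv i t0 x0 u) = lam i t0 x0 u *\<^sub>R rv i t0 x0 u" if "i \<in> {1..?n}" "u \<in> ?B" for i u
    proof -
      have u: "u \<in> \<Omega>" using that \<Omega>(2) by blast
      have "flux_matrix f t0 x0 u *v rv i t0 x0 u = lam i t0 x0 u *\<^sub>R rv i t0 x0 u"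
        using hyp t0 u that(1) unfolding strictly_hyperbolic_def by blast
      \<comment> \<open>The Jacobian and the derivative taken from \<open>bounds_on\<close> agree by
        uniqueness of derivatives.\<close>
      moreover have "(\<lambda>w. flux_matrix f t0 x0 u *v w) = ?DF u"
      proof (rule has_derivative_unique[OF _ f_u[OF t0 u]])
        show "(f t0 x0 has_derivative (\<lambda>w. flux_matrix f t0 x0 u *v w)) (at u)"
          using f_u[OF t0 u] unfolding flux_matrix_def jacobian_works[symmetric]
          by (rule differentiableI)
      qed
      then have "flux_matrix f t0 x0 u *v w = ?DF u w" for w by (rule fun_cong)
      ultimately show ?thesis by simp
    qed
    show "rv i t0 x0 u \<noteq> 0" if "i \<in> {1..?n}" "u \<in> ?B" for i u
      using hyp t0 that \<Omega>(2) unfolding strictly_hyperbolic_def by blast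
    show "c \<le> lam (Suc i) t0 x0 u - lam i t0 x0 u" if "i \<in> {1..<?n}" "u \<in> ?B" for i u
      using bnd bc.base that \<Omega>(2) unfolding bounds_on_def by blast
  qed (use c M' \<delta> small in auto)
  interpret fz: frozen_system "f t0 x0" ?DF "\<lambda>i. lam i t0 x0" "\<lambda>i. rv i t0 x0" M' c \<delta> ?n
    by (rule fs)
  obtain v a b where v0: "v 0 = uL" and vn: "v ?n = uR"
    and ew: "\<And>i. i \<in> {1..?n} \<Longrightarrow> elementary_wave \<Omega> f lam rv i t0 x0 W (v (i - 1)) (v i) (a i) (b i)"
    and order: "\<And>i. i \<in> {1..<?n} \<Longrightarrow> b i < a (Suc i)"
    and left: "\<And>\<xi>. \<xi> < a 1 \<Longrightarrow> W \<xi> = uL"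
    and const: "\<And>i \<xi>. i \<in> {1..<?n} \<Longrightarrow> \<xi> \<in> {b i<..<a (Suc i)} \<Longrightarrow> W \<xi> = v i"
    and right: "\<And>\<xi>. b ?n < \<xi> \<Longrightarrow> W \<xi> = uR"
    using lax unfolding lax_solution_def by blast
  have n1: "1 \<le> ?n" using fz.dim_ge_1 by linarith
  \<comment> \<open>\<open>lax_solution\<close> does not place the intermediate states in
    \<open>U\<close>; but the sectors between the waves are nonempty, so these states are values of
    \<open>W\<close>.\<close>
  have v_W: "v i = uL \<or> v i = uR \<or> v i \<in> range W" if "i \<le> ?n" for i
  proof -
    have cases: "i = 0 \<or> i = ?n \<or> (1 \<le> i \<and> i < ?n)" using that by linarith
    show ?thesis
    proof (cases "i = 0 \<or> i = ?n")
      case True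
      then show ?thesis using v0 vn by blast
    next
      case False
      with cases have i: "i \<in> {1..<?n}" by simp
      obtain \<xi> where "b i < \<xi>" "\<xi> < a (Suc i)" using dense[OF order[OF i]] by blast
      then have "W \<xi> = v i" by (intro const[OF i]) simp
      then have "v i \<in> range W" by (rule range_eqI[OF sym])
      then show ?thesis by blast
    qed
  qed
  have vU: "v i \<in> U" if "i \<le> ?n" for i
    using v_W[OF that] uL uR WU by auto
  have waves: "fz.wave W i (v (i - 1)) (v i) (a i) (b i)" if "i \<in> {1..?n}" for i
    by (rule elementary_wave_imp_wave[OF fs ew[OF that] that t0 _ \<Omega>(2)]) (use WU U in blast)
  \<comment> \<open>The first bound is the condition on \<open>s\<close> and \<open>r\<close>, the
    second holds for eigenvalues of a matrix of norm at most \<open>M'\<close>.\<close>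
  have lam_cfl: "\<bar>lam i t0 x0 u\<bar> \<le> min (r / s) M'" if i: "i \<in> {1..?n}" and u: "u \<in> U" for i u
  proof -
    have "ereal \<bar>lam i t0 x0 u\<bar> \<le> sup_speed U lam"
      unfolding sup_speed_def
      using SUP_upper[of "(i, t0, x0, u)" "{1..?n} \<times> {0..} \<times> UNIV \<times> U" "\<lambda>(i, t, x, u). ereal \<bar>lam i t x u\<bar>"]
        i u t0 by simp
    then have "ereal (s / r) * ereal \<bar>lam i t0 x0 u\<bar> \<le> ereal (s / r) * sup_speed U lam"
      using s r by (intro ereal_mult_left_mono) auto
    also have "\<dots> \<le> 1" by (rule cfl)
    finally have "s / r * \<bar>lam i t0 x0 u\<bar> \<le> 1" by simp
    then have "\<bar>lam i t0 x0 u\<bar> \<le> r / s" using s r by (simp add: field_simps)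
    moreover have "\<bar>lam i t0 x0 u\<bar> \<le> M'" using fz.lam_bound[OF i] u U by blast
    ultimately show ?thesis by simp
  qed
  have speeds: "\<bar>a i\<bar> \<le> min (r / s) M' \<and> \<bar>b i\<bar> \<le> min (r / s) M'" if "i \<in> {1..?n}" for i
    by (rule fz.wave_speed_bound[OF waves[OF that] lam_cfl[OF that] vU vU WU]) (use that in auto)
  have a1: "- min (r / s) M' \<le> a 1" and bn: "b ?n \<le> min (r / s) M'"
    using speeds[of 1] speeds[of ?n] n1 by auto
  have WB: "W \<xi> \<in> ?B" for \<xi> using WU U by blast
  have WG_eq: "?WG t x = W ((x - x0) / (t - t0)) + (t - t0) *\<^sub>R bc.q (W ((x - x0) / (t - t0)))"
    if "t0 < t" for t x
    using that by (simp add: approx_sol_def Let_def q_eq[OF WB])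
  \<comment> \<open>On a side of the cell the outer state is visible for all times before
    \<open>t0 + s\<close>, but at the end a wave may reach the corner. As the ball is closed, its
    membership condition extends to the final time.\<close>
  have outer_G: "u \<in> bc.G" if u: "u \<in> U" and x: "x \<in> ?X"
      and Wu: "\<And>t. t0 < t \<Longrightarrow> t < t0 + s \<Longrightarrow> W ((x - x0) / (t - t0)) = u" for u x
  proof -
    let ?C = "{\<tau>. u + \<tau> *\<^sub>R bc.q u \<in> ?B}"
    have "closed ?C"
    proof -
      have "closed ((\<lambda>\<tau>. u + \<tau> *\<^sub>R bc.q u) -` ?B)"
        by (intro continuous_closed_vimage continuous_intros) auto
      then show ?thesis by (simp add: vimage_def)
    qed
    moreover have "{0<..<s} \<subseteq> ?C"
    proof
      fix \<tau> assume \<tau>: "\<tau> \<in> {0<..<s}"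
      then have "?WG (t0 + \<tau>) x \<in> U" using x by (intro WGU) auto
      moreover have "?WG (t0 + \<tau>) x = u + \<tau> *\<^sub>R bc.q u"
        using \<tau> WG_eq[of "t0 + \<tau>" x] Wu[of "t0 + \<tau>"] by simp
      ultimately show "\<tau> \<in> ?C" using U by auto
    qed
    ultimately have "closure {0<..<s} \<subseteq> ?C" by (rule closure_minimal[rotated])
    then have "{0..s} \<subseteq> ?C" using s by simp
    then have "s \<in> ?C" by (rule subsetD) (use s in simp)
    then show ?thesis using u U by (auto simp: bc.G_def)
  qed
  have far: "r / s < r / (t - t0)" if "t0 < t" "t < t0 + s" for t
    using that r s by (intro divide_strict_left_mono) auto
  have uLG: "uL \<in> bc.G"
  proof (rule outer_G[OF uL, of "x0 - r"])
    fix t assume "t0 < t" "t < t0 + s"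
    then show "W ((x0 - r - x0) / (t - t0)) = uL" using far[of t] a1 by (intro left) auto
  qed (use r in auto)
  have uRG: "uR \<in> bc.G"
  proof (rule outer_G[OF uR, of "x0 + r"])
    fix t assume "t0 < t" "t < t0 + s"
    then show "W ((x0 + r - x0) / (t - t0)) = uR" using far[of t] bn by (intro right) auto
  qed (use r in auto)
  \<comment> \<open>A speed of modulus at most \<open>r / s\<close> is seen on the top of the cell,
    at \<open>x0 + \<xi> * s\<close>; all others carry an outer state.\<close>
  have WGood: "W \<xi> \<in> bc.G" for \<xi>
  proof -
    consider "\<xi> < - (r / s)" | "r / s < \<xi>" | "\<bar>\<xi>\<bar> \<le> r / s" by linarith
    then show ?thesis
    proof cases
      case 1
      then show ?thesis using left[of \<xi>] a1 uLG by auto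
    next
      case 2
      then show ?thesis using right[of \<xi>] bn uRG by auto
    next
      case 3
      have "\<bar>\<xi> * s\<bar> \<le> r" using 3 s by (simp add: abs_mult field_simps)
      then have "?WG (t0 + s) (x0 + \<xi> * s) \<in> U" using s by (intro WGU) (auto simp: abs_le_iff)
      moreover have "?WG (t0 + s) (x0 + \<xi> * s) = W \<xi> + s *\<^sub>R bc.q (W \<xi>)"
        using s WG_eq[of "t0 + s" "x0 + \<xi> * s"] by simp
      ultimately show ?thesis using U WU[of \<xi>] by (auto simp: bc.G_def)
    qed
  qed
  have vG: "v i \<in> bc.G" if "i \<le> ?n" for i
    using v_W[OF that] uLG uRG WGood by auto
  define V where "V = 4 * ?n * (2 * M' / c) ^ (?n - 1) * norm (uR - uL)"
  have V: "0 \<le> V" using c M' by (simp add: V_def)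
  have fan: "fan_approx W (f t0 x0) bc.G e (a 1) uL (b ?n) uR V" if "0 < e" for e
  proof -
    have "bc.G \<subseteq> ?B" using bc.GB by blast
    from fz.riemann_fan(2)[OF waves order const WGood this vG that] show ?thesis
      by (simp add: V_def fz.bound_eq v0 vn)
  qed
  \<comment> \<open>The profile before the correction; applying \<open>H\<close> to it gives the
    approximate solution, also at \<open>t0\<close>.\<close>
  define w where "w t x = (if t0 < t then W ((x - x0) / (t - t0)) else if x < x0 then uL else uR)" for t x
  have approx: "\<exists>xs. cell.step_approx t0 (t0 + s) x0 (x0 - r) (x0 + r) (min (r / s) M') bc.G w e uL xs \<and>
      last_val uL xs = uR \<and> variation uL xs \<le> V \<and> rh_defect (f t0 x0) uL xs \<le> e" if "0 < e" for e
    by (rule cell.fan_approx_imp_step_approx[OF bc.is_cell fan V a1 bn left right w_def that])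
  have wG: "w t x \<in> bc.G" for t x
    using WGood uLG uRG by (simp add: w_def)
  have WG_w: "?WG t x = bc.H t (w t x)" if "t0 \<le> t" for t x
  proof (cases "t0 < t")
    case True
    then show ?thesis by (simp add: WG_eq w_def bc.H_def)
  next
    case False
    then have t: "t = t0" using that by simp
    show ?thesis unfolding t by (simp add: approx_sol_def w_def bc.H_def)
  qed
  show ?thesis
  proof (rule test_functionE[OF \<theta>])
    let ?N = "C1_norm \<theta>" and ?Z = "{0..} \<times> UNIV :: (real \<times> real) set"
    assume c0: "continuous_on ?Z (\<lambda>(t, x). \<theta> t x)" and c1: "continuous_on ?Z (\<lambda>(t, x). dt \<theta> t x)"
      and c2: "continuous_on ?Z (\<lambda>(t, x). dx \<theta> t x)"
      and d1: "\<And>t x. 0 \<le> t \<Longrightarrow> ((\<lambda>t. \<theta> t x) has_real_derivative dt \<theta> t x) (at t within {0..})"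
      and d2: "\<And>t x. 0 \<le> t \<Longrightarrow> ((\<lambda>x. \<theta> t x) has_real_derivative dx \<theta> t x) (at x)"
      and N: "\<And>t x. 0 \<le> t \<Longrightarrow> \<bar>\<theta> t x\<bar> \<le> ?N \<and> \<bar>dt \<theta> t x\<bar> \<le> ?N \<and> \<bar>dx \<theta> t x\<bar> \<le> ?N"
    have sub: "?T \<times> ?X \<subseteq> ?Z" using t0 by auto
    have main: "norm (integral ?T (\<lambda>t. integral ?X (\<lambda>x. dt \<theta> t x *\<^sub>R bc.H t (w t x)
          + dx \<theta> t x *\<^sub>R f t x (bc.H t (w t x)) + \<theta> t x *\<^sub>R g t x (bc.H t (w t x))))
        - (integral ?X (\<lambda>x. \<theta> (t0 + s) x *\<^sub>R bc.H (t0 + s) (w (t0 + s) x))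
          - integral ?X (\<lambda>x. \<theta> t0 x *\<^sub>R bc.H t0 (w t0 x))
          + integral ?T (\<lambda>t. \<theta> t (x0 + r) *\<^sub>R f t (x0 + r) (bc.H t uR))
          - integral ?T (\<lambda>t. \<theta> t (x0 - r) *\<^sub>R f t (x0 - r) (bc.H t uL))))
      \<le> ?N * (s * (bc.jump_const * V) + 2 * M' * (1 + 2 * M') * (s + r) * (2 * r * s))"
    proof (rule bc.weak_form_estimate[OF _ _ _ _ _ _ _ approx])
      show "continuous_on (?T \<times> ?X) (\<lambda>(t, x). \<theta> t x)" "continuous_on (?T \<times> ?X) (\<lambda>(t, x). dt \<theta> t x)"
        "continuous_on (?T \<times> ?X) (\<lambda>(t, x). dx \<theta> t x)"
        by (rule continuous_on_subset[OF c0 sub] continuous_on_subset[OF c1 sub] continuous_on_subset[OF c2 sub])+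
      show "((\<lambda>t. \<theta> t x) has_real_derivative dt \<theta> t x) (at t within ?T)" if "t \<in> ?T" for t x
        by (rule has_field_derivative_subset[OF d1]) (use t0 that in auto)
      show "((\<lambda>x. \<theta> t x) has_real_derivative dx \<theta> t x) (at x within ?X)" if "t \<in> ?T" for t x
        by (rule has_field_derivative_at_within[OF d2]) (use t0 that in auto)
      show "\<bar>\<theta> t x\<bar> \<le> ?N \<and> \<bar>dt \<theta> t x\<bar> \<le> ?N \<and> \<bar>dx \<theta> t x\<bar> \<le> ?N" if "t \<in> ?T" for t x
        using t0 that by (intro N) auto
    qed (rule wG)
    have side_r: "integral ?T (\<lambda>t. \<theta> t (x0 + r) *\<^sub>R f t (x0 + r) (?WG t (x0 + r)))
        = integral ?T (\<lambda>t. \<theta> t (x0 + r) *\<^sub>R f t (x0 + r) (bc.H t uR))"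
    \<comment> \<open>Only at the final time can a wave of speed \<open>r / s\<close> touch the
      side.\<close>
    proof (rule integral_spike[of "{t0 + s}"])
      fix t assume t: "t \<in> ?T - {t0 + s}"
      have "w t (x0 + r) = uR"
        using t far[of t] bn r right[of "r / (t - t0)"] by (auto simp: w_def)
      then show "\<theta> t (x0 + r) *\<^sub>R f t (x0 + r) (bc.H t uR) = \<theta> t (x0 + r) *\<^sub>R f t (x0 + r) (?WG t (x0 + r))"
        using t WG_w[of t] by simp
    qed simp
    have side_l: "integral ?T (\<lambda>t. \<theta> t (x0 - r) *\<^sub>R f t (x0 - r) (?WG t (x0 - r)))
        = integral ?T (\<lambda>t. \<theta> t (x0 - r) *\<^sub>R f t (x0 - r) (bc.H t uL))"
    proof (rule integral_spike[of "{t0 + s}"])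
      fix t assume t: "t \<in> ?T - {t0 + s}"
      have "w t (x0 - r) = uL"
        using t far[of t] a1 r left[of "- r / (t - t0)"] by (auto simp: w_def)
      then show "\<theta> t (x0 - r) *\<^sub>R f t (x0 - r) (bc.H t uL) = \<theta> t (x0 - r) *\<^sub>R f t (x0 - r) (?WG t (x0 - r))"
        using t WG_w[of t] by simp
    qed simp
    have D: "Delta f g ?WG t0 x0 s r \<theta> = integral ?T (\<lambda>t. integral ?X (\<lambda>x. dt \<theta> t x *\<^sub>R bc.H t (w t x)
          + dx \<theta> t x *\<^sub>R f t x (bc.H t (w t x)) + \<theta> t x *\<^sub>R g t x (bc.H t (w t x))))"
      unfolding Delta_def by (intro integral_cong) (simp add: WG_w)
    have E: "boundary_terms f ?WG t0 x0 s r \<theta>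
        = integral ?X (\<lambda>x. \<theta> (t0 + s) x *\<^sub>R bc.H (t0 + s) (w (t0 + s) x))
          - integral ?X (\<lambda>x. \<theta> t0 x *\<^sub>R bc.H t0 (w t0 x))
          + integral ?T (\<lambda>t. \<theta> t (x0 + r) *\<^sub>R f t (x0 + r) (bc.H t uR))
          - integral ?T (\<lambda>t. \<theta> t (x0 - r) *\<^sub>R f t (x0 - r) (bc.H t uL))"
      unfolding boundary_terms_def side_l side_r using s by (simp add: WG_w)
    show ?thesis using main unfolding D E bc.jump_const_def V_def .
  qed
qed

section \<open>Shape of the remainder and choice of the constants\<close>

lemma remainder_arith:
  fixes s r d D k m N :: real
  assumes "0 < s" "0 < r" "0 \<le> d" "d \<le> D" "0 \<le> k" "0 \<le> m" "0 \<le> N"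
  shows "N * (s * (k * s * (1 + s) * d) + m * (s + r) * (2 * r * s))
    \<le> (k * (1 + D) + m) * (s\<^sup>2 + r\<^sup>2) * (s + r + d) * N"
proof -
  let ?E = "(s\<^sup>2 + r\<^sup>2) * (s + r + d)"
  have E: "0 \<le> ?E" using assms by simp
  \<comment> \<open>Here the boundedness of the data matters: \<open>s * d\<close> is at most
    \<open>s * D\<close>, so an unbounded \<open>s\<close> does no harm.\<close>
  have "(1 + s) * d \<le> (1 + D) * (s + r + d)"
  proof -
    have le: "s * d \<le> s * D" "0 \<le> D * r" "0 \<le> D * d"
      using assms by (auto intro: mult_left_mono)
    have e: "(1 + D) * (s + r + d) = s + r + d + s * D + D * r + D * d" "(1 + s) * d = d + s * d"
      by algebra+
    from le show ?thesis unfolding e using assms by linarith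
  qed
  then have "s\<^sup>2 * ((1 + s) * d) \<le> (s\<^sup>2 + r\<^sup>2) * ((1 + D) * (s + r + d))"
    by (rule mult_mono[rotated]) (use assms in auto)
  then have "k * (s\<^sup>2 * ((1 + s) * d)) \<le> k * ((s\<^sup>2 + r\<^sup>2) * ((1 + D) * (s + r + d)))"
    using assms by (intro mult_left_mono) auto
  then have 1: "s * (k * s * (1 + s) * d) \<le> k * (1 + D) * ?E"
    by (simp add: power2_eq_square mult_ac)
  have "2 * r * s \<le> s\<^sup>2 + r\<^sup>2" using sum_squares_bound[of s r] by (simp add: mult_ac)
  then have "(s + r) * (2 * r * s) \<le> (s + r + d) * (s\<^sup>2 + r\<^sup>2)"
    using assms by (intro mult_mono) auto
  then have "m * ((s + r) * (2 * r * s)) \<le> m * ((s + r + d) * (s\<^sup>2 + r\<^sup>2))"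
    using assms by (intro mult_left_mono) auto
  then have 2: "m * (s + r) * (2 * r * s) \<le> m * ?E" by (simp add: mult_ac)
  have "N * (s * (k * s * (1 + s) * d) + m * (s + r) * (2 * r * s)) \<le> N * (k * (1 + D) * ?E + m * ?E)"
    using 1 2 assms by (intro mult_left_mono add_mono) auto
  also have "\<dots> = (k * (1 + D) + m) * (s\<^sup>2 + r\<^sup>2) * (s + r + d) * N" by (simp add: algebra_simps)
  finally show ?thesis .
qed

theorem proposition2p1:
  fixes \<Omega> :: "(real ^ 'n::finite) set" and M c :: real
  assumes "open \<Omega>" and "0 \<in> \<Omega>" and "0 < c"
  shows "\<exists>\<delta>>0. ball 0 \<delta> \<subseteq> \<Omega> \<and>
    (\<forall>U. open U \<longrightarrow> 0 \<in> U \<longrightarrow> U \<subseteq> ball 0 \<delta> \<longrightarrow>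
      (\<exists>C. \<forall>f g lam rv. balance_law \<Omega> f g lam rv \<longrightarrow>
        (\<forall>\<theta> t0 x0 uL uR W s r.
          test_function \<theta> \<longrightarrow> 0 \<le> t0 \<longrightarrow> uL \<in> U \<longrightarrow> uR \<in> U \<longrightarrow> 0 < s \<longrightarrow> 0 < r \<longrightarrow>
          ereal (s / r) * sup_speed U lam \<le> 1 \<longrightarrow>
          bounds_on M c ({t0..t0 + s} \<times> {x0 - r..x0 + r}) \<Omega> f g lam \<longrightarrow>
          lax_solution \<Omega> f lam rv uL uR t0 x0 W \<longrightarrow>
          (\<forall>\<xi>. W \<xi> \<in> U) \<longrightarrow>
          (\<forall>t\<in>{t0<..t0 + s}. \<forall>x\<in>{x0 - r..x0 + r}. approx_sol f g uL uR t0 x0 W t x \<in> U) \<longrightarrow>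
          (let WG = approx_sol f g uL uR t0 x0 W in
            norm (Delta f g WG t0 x0 s r \<theta> - boundary_terms f WG t0 x0 s r \<theta>)
              \<le> C * (s\<^sup>2 + r\<^sup>2) * (s + r + norm (uR - uL)) * C1_norm \<theta>))))"
proof -
  \<comment> \<open>The given \<open>M\<close> may be small compared with 1 or with
    \<open>c\<close>.\<close>
  define M' where "M' = max 1 (max M c)"
  have M': "1 \<le> M'" "c \<le> 2 * M'" "M \<le> M'" by (auto simp: M'_def)
  define n where "n = real CARD('n)"
  define K where "K = (2 * M' / c) ^ (CARD('n) - 1)"
  have K: "0 < K" using M' assms(3) by (simp add: K_def)
  have n: "0 < n" by (simp add: n_def)
  obtain \<delta>0 where \<delta>0: "0 < \<delta>0" "cball 0 \<delta>0 \<subseteq> \<Omega>"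
    using assms(1,2) open_contains_cball by blast
  \<comment> \<open>The coefficient of \<open>\<delta>\<close> in the smallness condition of
    \<open>frozen_system\<close>; the radius \<open>c / p\<close> makes that condition an
    equality.\<close>
  define p where "p = 4 * n * K * M' * (1 + n * K)"
  have p: "0 < p" using n K M' by (simp add: p_def add_pos_pos)
  define \<delta> where "\<delta> = min \<delta>0 (c / p)"
  have \<delta>: "0 < \<delta>" using \<delta>0 p assms(3) by (simp add: \<delta>_def)
  have \<Omega>: "cball 0 \<delta> \<subseteq> \<Omega>" using \<delta>0(2) by (auto simp: \<delta>_def)
  have "p * \<delta> \<le> p * (c / p)" using p by (intro mult_left_mono) (auto simp: \<delta>_def)
  then have "p * \<delta> \<le> c" using p by simp
  moreover have "p * \<delta> = 4 * CARD('n) * (2 * M' / c) ^ (CARD('n) - 1) * M' * \<delta>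
      * (1 + CARD('n) * (2 * M' / c) ^ (CARD('n) - 1))"
    by (simp add: p_def n_def K_def)
  ultimately have small: "4 * CARD('n) * (2 * M' / c) ^ (CARD('n) - 1) * M' * \<delta>
      * (1 + CARD('n) * (2 * M' / c) ^ (CARD('n) - 1)) \<le> c"
    by simp
  define k where "k = 12 * M' ^ 3 * (4 * n * K)"
  define m where "m = 2 * M' * (1 + 2 * M')"
  have km: "0 \<le> k" "0 \<le> m" using n K M' by (simp_all add: k_def m_def)
  have est: "norm (Delta f g (approx_sol f g uL uR t0 x0 W) t0 x0 s r \<theta>
        - boundary_terms f (approx_sol f g uL uR t0 x0 W) t0 x0 s r \<theta>)
      \<le> (k * (1 + 2 * \<delta>) + m) * (s\<^sup>2 + r\<^sup>2) * (s + r + norm (uR - uL)) * C1_norm \<theta>"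
    if U: "U \<subseteq> ball 0 \<delta>" and law: "balance_law \<Omega> f g lam rv" and \<theta>: "test_function \<theta>"
      and t0: "0 \<le> t0" and uL: "uL \<in> U" and uR: "uR \<in> U" and s: "0 < s" and r: "0 < r"
      and cfl: "ereal (s / r) * sup_speed U lam \<le> 1"
      and bnd: "bounds_on M c ({t0..t0 + s} \<times> {x0 - r..x0 + r}) \<Omega> f g lam"
      and lax: "lax_solution \<Omega> f lam rv uL uR t0 x0 W"
      and WU: "\<forall>\<xi>. W \<xi> \<in> U"
      and WGU: "\<forall>t\<in>{t0<..t0 + s}. \<forall>x\<in>{x0 - r..x0 + r}. approx_sol f g uL uR t0 x0 W t x \<in> U"
    for U f g lam rv \<theta> t0 x0 uL uR W s r
  proof -
    have U': "U \<subseteq> cball 0 \<delta>" using U by (meson ball_subset_cball order_trans)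
    have N: "0 \<le> C1_norm \<theta>"
      by (rule test_functionE[OF \<theta>]) (meson abs_ge_zero order_refl order_trans)
    have d: "norm (uR - uL) \<le> 2 * \<delta>"
      using norm_triangle_ineq4[of uR uL] subsetD[OF U' uL] subsetD[OF U' uR] by simp
    have "norm (Delta f g (approx_sol f g uL uR t0 x0 W) t0 x0 s r \<theta>
        - boundary_terms f (approx_sol f g uL uR t0 x0 W) t0 x0 s r \<theta>)
      \<le> C1_norm \<theta> * (s * (12 * M' ^ 3 * s * (1 + s) * (4 * CARD('n) * (2 * M' / c) ^ (CARD('n) - 1) * norm (uR - uL)))
        + 2 * M' * (1 + 2 * M') * (s + r) * (2 * r * s))"
      by (rule cell_estimate[OF assms(1) \<Omega> less_imp_le[OF \<delta>] assms(3) M' small U' law \<theta> t0 uL uR s r cfl bnd lax])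
        (use WU WGU in auto)
    also have "\<dots> = C1_norm \<theta> * (s * (k * s * (1 + s) * norm (uR - uL)) + m * (s + r) * (2 * r * s))"
      by (simp add: k_def m_def n_def K_def mult_ac)
    also have "\<dots> \<le> (k * (1 + 2 * \<delta>) + m) * (s\<^sup>2 + r\<^sup>2) * (s + r + norm (uR - uL)) * C1_norm \<theta>"
      by (rule remainder_arith[OF s r norm_ge_zero d km N])
    finally show ?thesis .
  qed
  have "ball 0 \<delta> \<subseteq> \<Omega>" using \<Omega> by (meson ball_subset_cball order_trans)
  show ?thesis
    unfolding Let_def
  proof (rule exI[of _ \<delta>], intro conjI allI impI)
    show "0 < \<delta>" "ball 0 \<delta> \<subseteq> \<Omega>" by fact+
    fix U :: "(real ^ 'n) set" assume U: "U \<subseteq> ball 0 \<delta>"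
    show "\<exists>C. \<forall>f g lam rv. balance_law \<Omega> f g lam rv \<longrightarrow>
        (\<forall>\<theta> t0 x0 uL uR W s r.
          test_function \<theta> \<longrightarrow> 0 \<le> t0 \<longrightarrow> uL \<in> U \<longrightarrow> uR \<in> U \<longrightarrow> 0 < s \<longrightarrow> 0 < r \<longrightarrow>
          ereal (s / r) * sup_speed U lam \<le> 1 \<longrightarrow>
          bounds_on M c ({t0..t0 + s} \<times> {x0 - r..x0 + r}) \<Omega> f g lam \<longrightarrow>
          lax_solution \<Omega> f lam rv uL uR t0 x0 W \<longrightarrow>
          (\<forall>\<xi>. W \<xi> \<in> U) \<longrightarrow>
          (\<forall>t\<in>{t0<..t0 + s}. \<forall>x\<in>{x0 - r..x0 + r}. approx_sol f g uL uR t0 x0 W t x \<in> U) \<longrightarrow>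
          norm (Delta f g (approx_sol f g uL uR t0 x0 W) t0 x0 s r \<theta>
              - boundary_terms f (approx_sol f g uL uR t0 x0 W) t0 x0 s r \<theta>)
            \<le> C * (s\<^sup>2 + r\<^sup>2) * (s + r + norm (uR - uL)) * C1_norm \<theta>)"
      \<comment> \<open>The constant is the one in \<open>est\<close>, namely
        \<open>k * (1 + 2 * \<delta>) + m\<close>; it is built from \<open>M\<close>,
        \<open>c\<close>, \<open>\<delta>\<close> and the dimension.\<close>
      by (intro exI allI impI) (rule est[OF U])
  qed
qed

end
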